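(* Let $N\ge 1$ and let $\mu^{\rm b}=(\mu^{\rm b}_1,\dots,\mu^{\rm b}_N)$, $\mu^{\rm a}=(\mu^{\rm a}_1,\dots,\mu^{\rm a}_N)$ be vectors of probability measures on $\mathbb{R}_+$ with finite first moment and barycenter $x_0$, satisfying $\mu^{\rm b}_i\preceq_{\rm cx}\mu^{\rm a}_j$ for all $1\le i\le j\le N$. For every upper semicontinuous function $h:\mathbb{R}_+^N\to\mathbb{R}$ with linear growth, $$\sup_{\mathbb{Q}\in\mathcal{Q}(\mu^{\rm b},\mu^{\rm a})}\mathbb{E}_{\mathbb{Q}}[h(X_1,\dots,X_N)]=\inf_{(\psi^{\rm a},\psi^{\rm b})\in\Psi^{\rm b,a}(h)}\ \sum_{i=1}^N\big(\mu_i^{\rm a}(\psi_i^{\rm a})-\mu_i^{\rm b}(\psi_i^{\rm b})\big),$$ and there exists $\mathbb{Q}^\star\in\mathcal{Q}(\mu^{\rm b},\mu^{\rm a})$ attaining the supremum on the left-hand side.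
   Context: $\mathbb{R}_+=[0,\infty)$; $x_0\in\mathbb{R}_+$ is a fixed constant (spot price). A function $f$ on $\mathbb{R}_+^N$ has linear growth if $\sup_x |f(x)|/(1+\|x\|)<\infty$. $\mathrm{CVX}_L$ is the set of continuous convex functions $\psi:\mathbb{R}_+\to\mathbb{R}$ with linear growth. For probability measures $\mu,\nu$ on $\mathbb{R}_+$ with finite first moment, $\mu\preceq_{\rm cx}\nu$ (convex order) means $\mu(\psi)\le\nu(\psi)$ for all $\psi\in\mathrm{CVX}_L$, where $\mu(\psi)=\int\psi\,d\mu$. Let $X_1,\dots,X_N$ be the canonical process on $\mathbb{R}_+^N$ and $X_0:=x_0$. A martingale measure is a probability measure $\mathbb{Q}$ on $\mathbb{R}_+^N$ such that $(X_i)_{0\le i\le N}$ is a $\mathbb{Q}$-martingale (in its own filtration); $\mu_i^{\mathbb{Q}}$ is the law of $X_i$ under $\mathbb{Q}$. Set $\mathcal{Q}(\mu^{\rm b},\mu^{\rm a})=\{\mathbb{Q}\text{ martingale measure}: \mu_i^{\rm b}\preceq_{\rm cx}\mu_i^{\mathbb{Q}}\preceq_{\rm cx}\mu_i^{\rm a},\ i=1,\dots,N\}$. $\Psi^{\rm b,a}(h)$ is the set of all $(\psi^{\rm a},\psi^{\rm b})=(\psi_1^{\rm a},\dots,\psi_N^{\rm a},\psi_1^{\rm b},\dots,\psi_N^{\rm b})\in\mathrm{CVX}_L^{2N}$ for which there exist Borel measurable functions $\Delta_i:\mathbb{R}_+^i\to\mathbb{R}$, $i=1,\dots,N-1$, such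 that for all $(x_1,\dots,x_N)\in\mathbb{R}_+^N$ $$\sum_{i=1}^N(\psi_i^{\rm a}-\psi_i^{\rm b})(x_i)+\sum_{i=1}^{N-1}\Delta_i(x_1,\dots,x_i)(x_{i+1}-x_i)\ge h(x_1,\dots,x_N).$$ *)

theory Defs
  imports "HOL-Probability.Probability"
begin

definition borel_Rp :: "real measure" where
  "borel_Rp = restrict_space borel {0..}"

text \<open>
  The space \<open>\<real>\<^sub>+\<^sup>n\<close> with coordinates indexed by \<open>{1..n}\<close>. Its points are the functions
  \<open>x :: nat \<Rightarrow> real\<close> with \<open>x i \<ge> 0\<close> for \<open>i \<in> {1..n}\<close> and \<open>x i = undefined\<close> otherwise. On this set
  the topology of pointwise convergence of type \<open>nat \<Rightarrow> real\<close> induces the Euclidean topology, and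
  the product sigma-algebra is its Borel sigma-algebra.
\<close>

definition path_space :: "nat \<Rightarrow> (nat \<Rightarrow> real) measure" where
  "path_space n = PiM {1..n} (\<lambda>_. borel_Rp)"

definition linear_growth_on :: "'a set \<Rightarrow> ('a \<Rightarrow> real) \<Rightarrow> ('a \<Rightarrow> real) \<Rightarrow> bool" where
  "linear_growth_on S nrm f \<longleftrightarrow> bdd_above ((\<lambda>x. \<bar>f x\<bar> / (1 + nrm x)) ` S)"

definition upper_semicontinuous_on :: "'a::topological_space set \<Rightarrow> ('a \<Rightarrow> real) \<Rightarrow> bool" where
  "upper_semicontinuous_on S f \<longleftrightarrow>
     (\<forall>x\<in>S. \<forall>c. f x < c \<longrightarrow> (\<forall>\<^sub>F y in at x within S. f y < c))"

text \<open>Only the values on \<open>{0..}\<close> matter for members of \<open>CVX_L\<close>.\<close>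

definition CVX_L :: "(real \<Rightarrow> real) set" where
  "CVX_L = {\<psi>. continuous_on {0..} \<psi> \<and> convex_on {0..} \<psi> \<and> linear_growth_on {0..} norm \<psi>}"

definition prob_first_moment :: "real measure set" where
  "prob_first_moment = {\<mu>. prob_space \<mu> \<and> sets \<mu> = sets borel_Rp \<and> integrable \<mu> (\<lambda>x. x)}"

definition barycenter :: "real measure \<Rightarrow> real" where
  "barycenter \<mu> = (\<integral>x. x \<partial>\<mu>)"

definition convex_order :: "real measure \<Rightarrow> real measure \<Rightarrow> bool" (infix \<open>\<preceq>\<^sub>c\<^sub>x\<close> 50) where
  "\<mu> \<preceq>\<^sub>c\<^sub>x \<nu> \<longleftrightarrow> (\<forall>\<psi>\<in>CVX_L. (\<integral>x. \<psi> x \<partial>\<mu>) \<le> (\<integral>x. \<psi> x \<partial>\<nu>))"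

definition natural_filtration :: "'a measure \<Rightarrow> (nat \<Rightarrow> 'a \<Rightarrow> real) \<Rightarrow> nat \<Rightarrow> 'a measure" where
  "natural_filtration M X i =
     sigma (space M) (\<Union>j\<in>{..i}. {X j -` A \<inter> space M | A. A \<in> sets borel})"

text \<open>Adaptedness need not be demanded: the filtration is the one generated by the process.\<close>

definition martingale_upto :: "'a measure \<Rightarrow> nat \<Rightarrow> (nat \<Rightarrow> 'a \<Rightarrow> real) \<Rightarrow> bool" where
  "martingale_upto M n X \<longleftrightarrow>
     (\<forall>i\<le>n. integrable M (X i)) \<and>
     (\<forall>i j. i \<le> j \<and> j \<le> n \<longrightarrow>
        (AE \<omega> in M. real_cond_exp M (natural_filtration M X i) (X j) \<omega> = X i \<omega>))"

definition canonical_process :: "real \<Rightarrow> nat \<Rightarrow> (nat \<Rightarrow> real) \<Rightarrow> real" where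
  "canonical_process x0 i \<omega> = (if i = 0 then x0 else \<omega> i)"

definition martingale_measures :: "nat \<Rightarrow> real \<Rightarrow> (nat \<Rightarrow> real) measure set" where
  "martingale_measures n x0 =
     {Q. prob_space Q \<and> sets Q = sets (path_space n) \<and> martingale_upto Q n (canonical_process x0)}"

definition marginal_law :: "(nat \<Rightarrow> real) measure \<Rightarrow> nat \<Rightarrow> real measure" where
  "marginal_law Q i = distr Q borel_Rp (\<lambda>\<omega>. \<omega> i)"

definition consistent_martingale_measures ::
  "nat \<Rightarrow> real \<Rightarrow> (nat \<Rightarrow> real measure) \<Rightarrow> (nat \<Rightarrow> real measure) \<Rightarrow> (nat \<Rightarrow> real) measure set" where
  "consistent_martingale_measures n x0 \<mu>b \<mu>a =
     {Q \<in> martingale_measures n x0.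
        \<forall>i\<in>{1..n}. \<mu>b i \<preceq>\<^sub>c\<^sub>x marginal_law Q i \<and> marginal_law Q i \<preceq>\<^sub>c\<^sub>x \<mu>a i}"

text \<open>
  Semi-static superhedges, as pairs \<open>(\<psi>a, \<psi>b)\<close> of families of which only the members with index
  in \<open>{1..n}\<close> are relevant.
\<close>

definition superhedges ::
  "nat \<Rightarrow> ((nat \<Rightarrow> real) \<Rightarrow> real) \<Rightarrow> ((nat \<Rightarrow> real \<Rightarrow> real) \<times> (nat \<Rightarrow> real \<Rightarrow> real)) set" where
  "superhedges n h =
     {(\<psi>a, \<psi>b). (\<forall>i\<in>{1..n}. \<psi>a i \<in> CVX_L \<and> \<psi>b i \<in> CVX_L) \<and>
        (\<exists>\<Delta> :: nat \<Rightarrow> (nat \<Rightarrow> real) \<Rightarrow> real.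
           (\<forall>i\<in>{1..<n}. \<Delta> i \<in> borel_measurable (path_space i)) \<and>
           (\<forall>x\<in>space (path_space n).
              (\<Sum>i\<in>{1..n}. \<psi>a i (x i) - \<psi>b i (x i)) +
              (\<Sum>i\<in>{1..<n}. \<Delta> i (restrict x {1..i}) * (x (i + 1) - x i)) \<ge> h x))}"

end

theory Submission
  imports Defs
begin

text \<open>
  Weak duality is the supermartingale property of the martingale transforms in a superhedge, whose
  terminal values have integrable negative part. For the converse, the superhedging cost \<open>\<pi>\<close> is a sublinear
  functional on the functions of linear growth on \<open>\<real>\<^sub>+\<^sup>n\<close>, so Hahn-Banach gives a linear \<open>L \<le> \<pi>\<close> with
  \<open>L h = \<pi> h\<close>. The functional \<open>L\<close> is positive, and it has small tails because it is dominated by \<open>\<mu>a\<close> on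
  call payoffs; hence on continuous functions it is integration against a probability measure, which
  is a consistent martingale measure since the hedging instruments are priced correctly by \<open>L\<close>.
  An upper semicontinuous \<open>h\<close> is a decreasing limit of Lipschitz functions \<open>H\<^sub>m\<close>, so
  \<open>\<pi> h = L h \<le> L H\<^sub>m = \<integral> H\<^sub>m \<rightarrow> \<integral> h\<close>.

  The market assumption enters through \<open>\<pi> 0 \<ge> 0\<close>. The functions \<open>C\<^sub>i = max\<^bsub>j \<le> i\<^esub> (call prices of \<mu>b\<^sub>j)\<close>
  are again call price functions of measures; these increase in convex order with \<open>i\<close> and lie between
  \<open>\<mu>b\<^sub>i\<close> and \<open>\<mu>a\<^sub>i\<close>. A hedge of zero is then reduced backwards in time, replacing the last payoff by
  its convex envelope at the preceding date.
\<close>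

section \<open>The Hahn-Banach theorem for function spaces\<close>

text \<open>The path space is not compact and L is a priori only finitely additive. Payoffs
  therefore range over all functions of linear growth, discontinuous ones included: L then assigns
  masses to the cells of ever finer partitions, and a random variable on the unit interval with
  these cell probabilities supplies countable additivity. Nested cells may shrink to a point outside
  them, so agreement with L is obtained for continuous payoffs only; hence the continuous test
  functions for the martingale property. Fixing the value of L at h in advance makes the measure
  obtained the maximiser itself. In the proof of \<open>\<pi> 0 \<ge> 0\<close> no measure with call
  prices C_i is produced. A payoff is integrated against C_i by a finite sum over the grid of mesh
  1/n on [0,n]. For convex payoffs this sum is monotone in the call prices, up to the growth
  constant of the payoff times the larger price at strike n. The ask marginals force these errors to
  zero. Limits of grid sums are taken only for the hedge's own payoffs under the given
  measures.\<close>

definition sublinear_on :: "('a \<Rightarrow> real) set \<Rightarrow> (('a \<Rightarrow> real) \<Rightarrow> real) \<Rightarrow> bool" where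
  "sublinear_on E p \<longleftrightarrow>
     (\<forall>f\<in>E. \<forall>g\<in>E. p (\<lambda>x. f x + g x) \<le> p f + p g) \<and>
     (\<forall>f\<in>E. \<forall>c\<ge>0. p (\<lambda>x. c * f x) = c * p f)"

definition function_subspace :: "('a \<Rightarrow> real) set \<Rightarrow> bool" where
  "function_subspace E \<longleftrightarrow>
     E \<noteq> {} \<and> (\<forall>f\<in>E. \<forall>g\<in>E. (\<lambda>x. f x + g x) \<in> E) \<and> (\<forall>f\<in>E. \<forall>c. (\<lambda>x. c * f x) \<in> E)"

lemma sublinear_onD:
  assumes "sublinear_on E p" "f \<in> E"
  shows "g \<in> E \<Longrightarrow> p (\<lambda>x. f x + g x) \<le> p f + p g" "c \<ge> 0 \<Longrightarrow> p (\<lambda>x. c * f x) = c * p f"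
  using assms unfolding sublinear_on_def by blast+

lemma function_subspaceD:
  assumes "function_subspace E" "f \<in> E"
  shows "g \<in> E \<Longrightarrow> (\<lambda>x. f x + g x) \<in> E" "(\<lambda>x. c * f x) \<in> E"
  using assms unfolding function_subspace_def by blast+

lemma sublinear_on_lower:
  assumes p: "sublinear_on E p" and E: "function_subspace E" and f: "f \<in> E"
  shows "- p (\<lambda>x. - f x) \<le> p f"
proof -
  have m: "(\<lambda>x. - f x) \<in> E" using function_subspaceD(2)[OF E f, of "-1"] by simp
  have "p (\<lambda>x. f x + - f x) \<le> p f + p (\<lambda>x. - f x)" by (rule sublinear_onD(1)[OF p f m])
  moreover have "p (\<lambda>x. f x + - f x) = 0" using sublinear_onD(2)[OF p f, of 0] by simp
  ultimately show ?thesis by simp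
qed

text \<open>The device that makes \<open>q\<close> additive along \<open>g\<close>: taking t = 1 at
  -g gives a value of at most \<open>- q g\<close>, while the functional stays sublinear and below
  \<open>q\<close>.\<close>

definition directional :: "('a \<Rightarrow> real) \<Rightarrow> (('a \<Rightarrow> real) \<Rightarrow> real) \<Rightarrow> ('a \<Rightarrow> real) \<Rightarrow> real" where
  "directional g q f = (INF t\<in>{0..}. q (\<lambda>x. f x + t * g x) - t * q g)"

text \<open>Subadditivity of \<open>q\<close> bounds every candidate below by
  \<open>- q (\<lambda>x. - f x)\<close>, independently of \<open>t\<close>, so the infimum is a
  genuine one. Near-optimal parameters add up under sums and rescale under positive
  multiples.\<close>

lemma directional_sublinear:
  assumes q: "sublinear_on E q" and E: "function_subspace E" and g: "g \<in> E"
  shows "sublinear_on E (directional g q)"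
    and "\<And>f. f \<in> E \<Longrightarrow> directional g q f \<le> q f"
    and "\<And>f t. f \<in> E \<Longrightarrow> t \<ge> 0 \<Longrightarrow> directional g q f \<le> q (\<lambda>x. f x + t * g x) - t * q g"
proof -
  have E': "(\<lambda>x. f x + t * g x) \<in> E" if "f \<in> E" for f t
    using function_subspaceD[OF E] that g by blast
  have lower: "- q (\<lambda>x. - f x) \<le> q (\<lambda>x. f x + t * g x) - t * q g" if f: "f \<in> E" and t: "t \<ge> 0" for f t
  proof -
    have m: "(\<lambda>x. - f x) \<in> E" using function_subspaceD(2)[OF E f, of "-1"] by simp
    have "t * q g = q (\<lambda>x. t * g x)" using sublinear_onD(2)[OF q g t] by simp
    also have "(\<lambda>x. t * g x) = (\<lambda>x. (f x + t * g x) + - f x)" by auto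
    also have "q \<dots> \<le> q (\<lambda>x. f x + t * g x) + q (\<lambda>x. - f x)"
      by (rule sublinear_onD(1)[OF q E'[OF f] m])
    finally show ?thesis by simp
  qed
  have bdd: "bdd_below ((\<lambda>t. q (\<lambda>x. f x + t * g x) - t * q g) ` {0..})" if "f \<in> E" for f
    using lower[OF that] by (intro bdd_belowI2[where m = "- q (\<lambda>x. - f x)"]) auto
  show le: "directional g q f \<le> q (\<lambda>x. f x + t * g x) - t * q g" if "f \<in> E" "t \<ge> 0" for f t
    unfolding directional_def using that by (intro cINF_lower bdd) auto
  show "directional g q f \<le> q f" if "f \<in> E" for f using le[OF that, of 0] by simp
  have ge: "c \<le> directional g q f" if "f \<in> E" "\<And>t. t \<ge> 0 \<Longrightarrow> c \<le> q (\<lambda>x. f x + t * g x) - t * q g" for c f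
    unfolding directional_def using that by (intro cINF_greatest) auto
  have approx: "\<exists>t\<ge>0. q (\<lambda>x. f x + t * g x) - t * q g < directional g q f + e" if "f \<in> E" "e > 0" for f e
    using cINF_less_iff[OF _ bdd[OF that(1)], of "directional g q f + e"] that(2)
    unfolding directional_def by auto
  show "sublinear_on E (directional g q)"
    unfolding sublinear_on_def
  proof (intro conjI ballI allI impI)
    fix f1 f2 assume f: "f1 \<in> E" "f2 \<in> E"
    show "directional g q (\<lambda>x. f1 x + f2 x) \<le> directional g q f1 + directional g q f2"
    proof (rule field_le_epsilon)
      fix e :: real assume "e > 0"
      then obtain t1 t2 where t: "t1 \<ge> 0" "t2 \<ge> 0"
        "q (\<lambda>x. f1 x + t1 * g x) - t1 * q g < directional g q f1 + e/2"
        "q (\<lambda>x. f2 x + t2 * g x) - t2 * q g < directional g q f2 + e/2"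
        using approx[OF f(1), of "e/2"] approx[OF f(2), of "e/2"] by auto
      have "directional g q (\<lambda>x. f1 x + f2 x)
          \<le> q (\<lambda>x. (f1 x + f2 x) + (t1 + t2) * g x) - (t1 + t2) * q g"
        using t by (intro le function_subspaceD(1)[OF E] f) auto
      also have "(\<lambda>x. (f1 x + f2 x) + (t1 + t2) * g x) = (\<lambda>x. (f1 x + t1 * g x) + (f2 x + t2 * g x))"
        by (auto simp: algebra_simps)
      also have "q \<dots> \<le> q (\<lambda>x. f1 x + t1 * g x) + q (\<lambda>x. f2 x + t2 * g x)"
        by (intro sublinear_onD(1)[OF q] E' f)
      finally show "directional g q (\<lambda>x. f1 x + f2 x) \<le> directional g q f1 + directional g q f2 + e"
        using t(3,4) by (simp add: algebra_simps)
    qed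
  next
    fix f c assume f: "f \<in> E" and c: "(0::real) \<le> c"
    have cf: "(\<lambda>x. c * f x) \<in> E" using function_subspaceD(2)[OF E f] .
    show "directional g q (\<lambda>x. c * f x) = c * directional g q f"
    proof (cases "c = 0")
      case True
      have z: "(\<lambda>x. 0 * f x) \<in> E" using function_subspaceD(2)[OF E f] .
      have "q (\<lambda>x. 0 * f x + t * g x) - t * q g = 0" if "t \<ge> 0" for t
        using sublinear_onD(2)[OF q g that] by simp
      then have "directional g q (\<lambda>x. 0 * f x) = 0"
        unfolding directional_def by (subst INF_cong[OF refl, where D = "\<lambda>_. 0"]) auto
      then show ?thesis using True by simp
    next
      case False
      then have c: "c > 0" using c by simp
      show ?thesis
      proof (rule antisym)
        have "directional g q (\<lambda>x. c * f x) / c \<le> directional g q f"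
        proof (rule ge[OF f])
          fix t :: real assume t: "t \<ge> 0"
          have "directional g q (\<lambda>x. c * f x) \<le> q (\<lambda>x. c * f x + (c * t) * g x) - (c * t) * q g"
            using t c by (intro le cf) auto
          also have "(\<lambda>x. c * f x + (c * t) * g x) = (\<lambda>x. c * (f x + t * g x))"
            by (auto simp: algebra_simps)
          also have "q \<dots> = c * q (\<lambda>x. f x + t * g x)" using c by (intro sublinear_onD(2)[OF q] E' f) auto
          finally show "directional g q (\<lambda>x. c * f x) / c \<le> q (\<lambda>x. f x + t * g x) - t * q g"
            using c by (simp add: field_simps)
        qed
        then show "directional g q (\<lambda>x. c * f x) \<le> c * directional g q f" using c by (simp add: field_simps)
        show "c * directional g q f \<le> directional g q (\<lambda>x. c * f x)"
        proof (rule ge[OF cf])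
          fix t :: real assume t: "t \<ge> 0"
          have "directional g q f \<le> q (\<lambda>x. f x + (t / c) * g x) - (t / c) * q g"
            using t c by (intro le f) auto
          then have "c * directional g q f \<le> c * q (\<lambda>x. f x + (t / c) * g x) - t * q g"
            using c by (simp add: field_simps)
          also have "c * q (\<lambda>x. f x + (t / c) * g x) = q (\<lambda>x. c * (f x + (t / c) * g x))"
            using c by (intro sublinear_onD(2)[OF q, symmetric] E' f) auto
          also have "(\<lambda>x. c * (f x + (t / c) * g x)) = (\<lambda>x. c * f x + t * g x)"
            using c by (auto simp: field_simps)
          finally show "c * directional g q f \<le> q (\<lambda>x. c * f x + t * g x) - t * q g" .
        qed
      qed
    qed
  qed
qed

text \<open>Only functionals vanishing off \<open>E\<close> are compared, so that the pointwise order is antisymmetric.\<close>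

lemma minimal_sublinear:
  assumes p: "sublinear_on E p" and E: "function_subspace E"
  obtains q where "sublinear_on E q" "\<And>f. f \<in> E \<Longrightarrow> q f \<le> p f"
    "\<And>r. sublinear_on E r \<Longrightarrow> \<forall>f\<in>E. r f \<le> q f \<Longrightarrow> \<forall>f\<in>E. r f = q f"
proof -
  define A where "A = {q. sublinear_on E q \<and> (\<forall>f\<in>E. q f \<le> p f) \<and> (\<forall>f. f \<notin> E \<longrightarrow> q f = 0)}"
  \<comment> \<open>The order is reversed: a maximal element in Zorn's lemma is then a minimal
    sublinear functional.\<close>
  define P where "P = (\<lambda>q r :: ('a \<Rightarrow> real) \<Rightarrow> real. \<forall>f. r f \<le> q f)"
  have cut: "sublinear_on E (\<lambda>f. if f \<in> E then q f else 0) \<longleftrightarrow> sublinear_on E q" for q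
    unfolding sublinear_on_def using function_subspaceD[OF E] by auto
  \<comment> \<open>The bound does not depend on \<open>q\<close>, so the infimum over a chain
    exists.\<close>
  have lower: "- p (\<lambda>x. - f x) \<le> q f" if "q \<in> A" "f \<in> E" for q f
  proof -
    have "(\<lambda>x. - f x) \<in> E" using function_subspaceD(2)[OF E that(2), of "-1"] by simp
    then have "q (\<lambda>x. - f x) \<le> p (\<lambda>x. - f x)" using that unfolding A_def by auto
    moreover have "- q (\<lambda>x. - f x) \<le> q f" using that E unfolding A_def by (auto intro: sublinear_on_lower)
    ultimately show ?thesis by simp
  qed
  have "\<exists>m\<in>A. \<forall>a\<in>A. P m a \<longrightarrow> a = m"
  proof (rule predicate_Zorn)
    show "partial_order_on A (relation_of P A)"
      by (rule partial_order_on_relation_ofI) (auto simp: P_def intro: order_trans intro!: ext antisym)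
    fix C assume C: "C \<in> Chains (relation_of P A)"
    then have CA: "C \<subseteq> A" and tot: "\<And>q r. q \<in> C \<Longrightarrow> r \<in> C \<Longrightarrow> P q r \<or> P r q"
      unfolding Chains_def relation_of_def by auto
    show "\<exists>u\<in>A. \<forall>a\<in>C. P a u"
    proof (cases "C = {}")
      case True
      have "(\<lambda>f. if f \<in> E then p f else 0) \<in> A" unfolding A_def using p by (simp add: cut)
      then show ?thesis using True by auto
    next
      case False
      define u where "u = (\<lambda>f. if f \<in> E then INF q\<in>C. q f else 0)"
      have bdd: "bdd_below ((\<lambda>q. q f) ` C)" if "f \<in> E" for f
        using lower that CA by (intro bdd_belowI2[where m = "- p (\<lambda>x. - f x)"]) auto
      have le: "u f \<le> q f" if "q \<in> C" "f \<in> E" for f q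
        unfolding u_def using cINF_lower[OF bdd[OF that(2)] that(1)] that(2) by simp
      have ge: "c \<le> u f" if "f \<in> E" "\<And>q. q \<in> C \<Longrightarrow> c \<le> q f" for c f
        unfolding u_def using that False by (simp add: cINF_greatest)
      have sub: "q \<in> C \<Longrightarrow> sublinear_on E q" for q using CA unfolding A_def by auto
      have "sublinear_on E u"
        unfolding sublinear_on_def
      proof (intro conjI ballI allI impI)
        fix f g assume f: "f \<in> E" and g: "g \<in> E"
        have fg: "(\<lambda>x. f x + g x) \<in> E" using function_subspaceD(1)[OF E f g] .
        \<comment> \<open>In a chain one functional lies below both \<open>q\<close> and
          \<open>r\<close>; this makes the infimum subadditive.\<close>
        have *: "u (\<lambda>x. f x + g x) \<le> q f + r g" if qr: "q \<in> C" "r \<in> C" for q r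
        proof -
          obtain s where s: "s \<in> C" "s f \<le> q f" "s g \<le> r g"
            using tot[OF qr] qr unfolding P_def by blast
          have "u (\<lambda>x. f x + g x) \<le> s (\<lambda>x. f x + g x)" by (rule le[OF s(1) fg])
          also have "\<dots> \<le> s f + s g" by (rule sublinear_onD(1)[OF sub[OF s(1)] f g])
          finally show ?thesis using s by simp
        qed
        have "u (\<lambda>x. f x + g x) - r g \<le> u f" if "r \<in> C" for r
          using *[OF _ that] by (intro ge f) (simp add: algebra_simps)
        then have "u (\<lambda>x. f x + g x) - u f \<le> u g" by (intro ge g) (simp add: algebra_simps)
        then show "u (\<lambda>x. f x + g x) \<le> u f + u g" by simp
      next
        fix f c assume f: "f \<in> E" and c: "(0::real) \<le> c"
        have cf: "(\<lambda>x. c * f x) \<in> E" using function_subspaceD(2)[OF E f] .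
        have eq: "q (\<lambda>x. c * f x) = c * q f" if "q \<in> C" for q using sublinear_onD(2)[OF sub[OF that] f c] .
        show "u (\<lambda>x. c * f x) = c * u f"
        proof (cases "c = 0")
          case True
          have "u (\<lambda>x. c * f x) = (INF q\<in>C. 0)" unfolding u_def using cf eq True by (auto intro!: INF_cong)
          then show ?thesis using False True by simp
        next
          case cn: False
          show ?thesis
          proof (rule antisym)
            have "u (\<lambda>x. c * f x) / c \<le> u f"
              using le[OF _ cf] eq c cn by (intro ge f) (simp add: field_simps)
            then show "u (\<lambda>x. c * f x) \<le> c * u f" using c cn by (simp add: field_simps)
            show "c * u f \<le> u (\<lambda>x. c * f x)"
              using le[OF _ f] c by (intro ge cf) (simp add: eq mult_left_mono)
          qed
        qed
      qed
      moreover have "u f \<le> p f" if "f \<in> E" for f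
      proof -
        obtain q where "q \<in> C" using False by auto
        then have "u f \<le> q f" "q f \<le> p f" using le[OF _ that] CA that unfolding A_def by auto
        then show ?thesis by simp
      qed
      moreover have u0: "u f = 0" if "f \<notin> E" for f using that by (simp add: u_def)
      ultimately have "u \<in> A" unfolding A_def by blast
      moreover have "P a u" if "a \<in> C" for a
        unfolding P_def
      proof
        fix f
        have "f \<notin> E \<Longrightarrow> a f = 0" using that CA unfolding A_def by blast
        then show "u f \<le> a f" using le[OF that, of f] u0[of f] by (cases "f \<in> E") auto
      qed
      ultimately show ?thesis by blast
    qed
  qed
  then obtain m where m: "m \<in> A" and min: "\<And>a. a \<in> A \<Longrightarrow> P m a \<Longrightarrow> a = m" by blast
  show ?thesis
  proof
    show "sublinear_on E m" "\<And>f. f \<in> E \<Longrightarrow> m f \<le> p f" using m unfolding A_def by auto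
    fix r assume r: "sublinear_on E r" "\<forall>f\<in>E. r f \<le> m f"
    have "(\<lambda>f. if f \<in> E then r f else 0) = m"
    proof (rule min)
      have "\<forall>f\<in>E. r f \<le> p f" using r(2) m unfolding A_def by (blast intro: order_trans)
      then show "(\<lambda>f. if f \<in> E then r f else 0) \<in> A" unfolding A_def using r(1) by (simp add: cut)
      have "\<forall>f. f \<notin> E \<longrightarrow> m f = 0" using m unfolding A_def by blast
      then show "P m (\<lambda>f. if f \<in> E then r f else 0)" unfolding P_def using r(2) by simp
    qed
    then show "\<forall>f\<in>E. r f = m f" by (auto dest: fun_cong split: if_splits)
  qed
qed

text \<open>A minimal sublinear functional coincides with each of its own directional modifications,
  and their bound at t = 1 is the missing inequality
  \<open>q f + q g \<le> q (\<lambda>x. f x + g x)\<close>. Searching below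
  \<open>directional h p\<close> instead of \<open>p\<close> forces the value at -h down to
  \<open>- p h\<close>, hence equality at \<open>h\<close>.\<close>

lemma hahn_banach_functions:
  assumes p: "sublinear_on E p" and E: "function_subspace E" and h: "h \<in> E"
  obtains L where "\<And>f. f \<in> E \<Longrightarrow> L f \<le> p f"
    "\<And>f g. f \<in> E \<Longrightarrow> g \<in> E \<Longrightarrow> L (\<lambda>x. f x + g x) = L f + L g"
    "\<And>f c. f \<in> E \<Longrightarrow> L (\<lambda>x. c * f x) = c * L f"
    "L h = p h"
proof -
  note d = directional_sublinear[OF p E h]
  obtain q where q: "sublinear_on E q" "\<And>f. f \<in> E \<Longrightarrow> q f \<le> directional h p f"
    and min: "\<And>r. sublinear_on E r \<Longrightarrow> \<forall>f\<in>E. r f \<le> q f \<Longrightarrow> \<forall>f\<in>E. r f = q f"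
    using minimal_sublinear[OF d(1) E] by blast
  have neg: "(\<lambda>x. - f x) \<in> E" if "f \<in> E" for f using function_subspaceD(2)[OF E that, of "-1"] by simp
  have add: "q (\<lambda>x. f x + g x) = q f + q g" if f: "f \<in> E" and g: "g \<in> E" for f g
  proof (rule antisym[OF sublinear_onD(1)[OF q(1) f g]])
    note dq = directional_sublinear[OF q(1) E g]
    have "q f = directional g q f" using min[OF dq(1)] dq(2) f by simp
    also have "\<dots> \<le> q (\<lambda>x. f x + 1 * g x) - 1 * q g" by (rule dq(3)) (use f in auto)
    finally show "q f + q g \<le> q (\<lambda>x. f x + g x)" by simp
  qed
  have negq: "q (\<lambda>x. - f x) = - q f" if f: "f \<in> E" for f
    using add[OF f neg[OF f]] sublinear_onD(2)[OF q(1) f, of 0] by simp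
  have scale: "q (\<lambda>x. c * f x) = c * q f" if f: "f \<in> E" for f c
  proof (cases "c \<ge> 0")
    case False
    then have "q (\<lambda>x. - c * f x) = - c * q f" by (intro sublinear_onD(2)[OF q(1) f]) auto
    moreover have "q (\<lambda>x. - (c * f x)) = - q (\<lambda>x. c * f x)" by (rule negq[OF function_subspaceD(2)[OF E f]])
    ultimately show ?thesis by simp
  qed (rule sublinear_onD(2)[OF q(1) f])
  have le: "q f \<le> p f" if "f \<in> E" for f using q(2)[OF that] d(2)[OF that] by simp
  have "q (\<lambda>x. - h x) \<le> - p h"
    using q(2)[OF neg[OF h]] d(3)[OF neg[OF h], of 1] sublinear_onD(2)[OF p h, of 0] by simp
  then have "q h = p h" using negq[OF h] le[OF h] by simp
  then show thesis using that[of q] le add scale by blast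
qed

section \<open>Nested subdivisions of the unit interval\<close>

text \<open>Left end of the half-open interval of length \<open>w s\<close> attached to the word
  \<open>s\<close>: every bit \<open>True\<close> skips the interval of the sibling ending in
  \<open>False\<close>. \<open>code\<close> returns the address at level n of a point of
  [0,1).\<close>

definition code_lo :: "(bool list \<Rightarrow> real) \<Rightarrow> bool list \<Rightarrow> real" where
  "code_lo w s = (\<Sum>j<length s. if s ! j then w (take j s @ [False]) else 0)"

lemma code_lo_Nil [simp]: "code_lo w [] = 0"
  by (simp add: code_lo_def)

lemma code_lo_snoc [simp]: "code_lo w (s @ [b]) = code_lo w s + (if b then w (s @ [False]) else 0)"
  by (auto simp: code_lo_def nth_append intro!: sum.cong)

primrec code :: "(bool list \<Rightarrow> real) \<Rightarrow> nat \<Rightarrow> real \<Rightarrow> bool list" where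
  "code w 0 u = []"
| "code w (Suc n) u = code w n u @ [code_lo w (code w n u) + w (code w n u @ [False]) \<le> u]"

lemma length_code [simp]: "length (code w n u) = n"
  by (induction n) auto

abbreviation unit_interval :: "real measure" where
  "unit_interval \<equiv> restrict_space lborel {0..<1}"

lemma prob_space_unit_interval: "prob_space unit_interval"
  by (rule prob_spaceI) (simp add: emeasure_restrict_space)

text \<open>The masses \<open>w\<close> are consistent along the binary tree, which is finite
  additivity only. Lebesgue measure on the subdivided interval turns them into one probability space
  carrying all levels at once.\<close>

locale mass_splitting =
  fixes w :: "bool list \<Rightarrow> real"
  assumes w_Nil: "w [] = 1"
    and w_nonneg: "w s \<ge> 0"
    and w_split: "w s = w (s @ [False]) + w (s @ [True])"
begin

text \<open>The last bit compares \<open>u\<close> with the division point inside the interval of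
  the preceding word, and by \<open>w_split\<close> the two halves fill that interval.\<close>

lemma code_eq_iff:
  assumes "u \<in> {0..<1}" "length s = n"
  shows "code w n u = s \<longleftrightarrow> code_lo w s \<le> u \<and> u < code_lo w s + w s"
  using assms(2)
proof (induction n arbitrary: s)
  case 0
  then show ?case using assms(1) by (simp add: w_Nil)
next
  case (Suc n)
  then obtain t b where s: "s = t @ [b]" "length t = n" by (cases s rule: rev_cases) auto
  show ?case
    using Suc.IH[OF s(2)] w_nonneg[of "t @ [False]"] w_nonneg[of "t @ [True]"] w_split[of t]
    by (cases b) (auto simp: s(1))
qed

lemma code_vimage_sets: "{u \<in> {0..<1}. code w n u = s} \<in> sets unit_interval"
proof (cases "length s = n")
  case True
  have "{u \<in> {0..<1}. code w n u = s} = {0..<1} \<inter> {code_lo w s..<code_lo w s + w s}"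
    unfolding set_eq_iff
  proof
    fix u show "u \<in> {u \<in> {0..<1}. code w n u = s} \<longleftrightarrow> u \<in> {0..<1} \<inter> {code_lo w s..<code_lo w s + w s}"
      using code_eq_iff[OF _ True, of u] by (cases "u \<in> {0..<1}") auto
  qed
  then show ?thesis unfolding sets_restrict_space by (simp only:) (intro imageI, simp)
next
  case False
  then have "{u \<in> {0..<1}. code w n u = s} = {}" using length_code by blast
  then show ?thesis by (metis sets.empty_sets)
qed

lemma measurable_code [measurable]: "code w n \<in> unit_interval \<rightarrow>\<^sub>M count_space UNIV"
proof (subst measurable_count_space_eq_countable, simp, intro conjI ballI)
  show "code w n \<in> space unit_interval \<rightarrow> UNIV" by simp
  fix s
  have "code w n -` {s} \<inter> space unit_interval = {u \<in> {0..<1}. code w n u = s}"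
    by (auto simp: space_restrict_space)
  then show "code w n -` {s} \<inter> space unit_interval \<in> sets unit_interval"
    using code_vimage_sets by simp
qed

lemma code_lo_bounds: "code_lo w s \<ge> 0" "code_lo w s + w s \<le> 1"
proof (induction s rule: rev_induct)
  case (snoc b t)
  { case 1 show ?case using snoc w_nonneg[of "t @ [False]"] by auto }
  { case 2 show ?case using snoc w_split[of t] w_nonneg[of "t @ [True]"] by (cases b) auto }
qed (auto simp: w_Nil)

lemma measure_code:
  assumes "length s = n"
  shows "measure unit_interval {u \<in> {0..<1}. code w n u = s} = w s"
proof -
  have "{u \<in> {0..<1}. code w n u = s} = {code_lo w s..<code_lo w s + w s}"
    unfolding set_eq_iff
  proof
    fix u show "u \<in> {u \<in> {0..<1}. code w n u = s} \<longleftrightarrow> u \<in> {code_lo w s..<code_lo w s + w s}"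
      using code_eq_iff[OF _ assms, of u] code_lo_bounds[of s] by (cases "u \<in> {0..<1}") auto
  qed
  then show ?thesis
    using code_lo_bounds[of s] w_nonneg[of s] by (simp add: measure_restrict_space)
qed

lemma finite_bool_lists: "finite {s :: bool list. length s = n}"
  using finite_lists_length_eq[of "UNIV :: bool set" n] by simp

lemma
  fixes g :: "bool list \<Rightarrow> real"
  shows integrable_code: "integrable unit_interval (\<lambda>u. g (code w n u))"
    and integral_code: "(\<integral>u. g (code w n u) \<partial>unit_interval) = (\<Sum>s | length s = n. g s * w s)"
proof -
  interpret prob_space unit_interval by (rule prob_space_unit_interval)
  let ?A = "\<lambda>s. {u \<in> {0..<1::real}. code w n u = s}"
  have eq: "g (code w n u) = (\<Sum>s | length s = n. g s * indicator (?A s) u)"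
    if "u \<in> space unit_interval" for u
  proof -
    have "(\<Sum>s | length s = n. g s * indicator (?A s) u) = (\<Sum>s | length s = n. if s = code w n u then g s else 0)"
      using that by (intro sum.cong) (auto simp: space_restrict_space indicator_def)
    then show ?thesis by (simp add: finite_bool_lists)
  qed
  have int: "integrable unit_interval (\<lambda>u. g s * indicator (?A s) u)" for s
    using code_vimage_sets[of n s] by (intro integrable_mult_right integrable_real_indicator) (auto simp: less_top[symmetric])
  then have "integrable unit_interval (\<lambda>u. \<Sum>s | length s = n. g s * indicator (?A s) u)"
    by (rule Bochner_Integration.integrable_sum)
  then show "integrable unit_interval (\<lambda>u. g (code w n u))"
    by (subst Bochner_Integration.integrable_cong[OF refl eq])
  have "(\<integral>u. g (code w n u) \<partial>unit_interval)
      = (\<integral>u. (\<Sum>s | length s = n. g s * indicator (?A s) u) \<partial>unit_interval)"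
    by (intro Bochner_Integration.integral_cong refl eq)
  also have "\<dots> = (\<Sum>s | length s = n. g s * measure unit_interval (?A s \<inter> space unit_interval))"
    by (subst Bochner_Integration.integral_sum[OF int]) (simp add: integral_indicator)
  also have "\<dots> = (\<Sum>s | length s = n. g s * w s)"
    by (intro sum.cong refl) (auto simp: space_restrict_space Collect_conj_eq[symmetric] measure_code[symmetric] intro!: arg_cong2[where f = "(*)"] arg_cong[where f = "measure unit_interval"])
  finally show "(\<integral>u. g (code w n u) \<partial>unit_interval) = (\<Sum>s | length s = n. g s * w s)" .
qed

end

section \<open>Paths\<close>

lemma space_path_space: "space (path_space n) = {1..n} \<rightarrow>\<^sub>E {0..}"
  by (simp add: path_space_def space_PiM borel_Rp_def space_restrict_space)

lemma path_nonneg: "x \<in> space (path_space n) \<Longrightarrow> i \<in> {1..n} \<Longrightarrow> x i \<ge> 0"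
  by (auto simp: space_path_space PiE_def Pi_def)

abbreviation paths :: "nat \<Rightarrow> (nat \<Rightarrow> real) set" where
  "paths n \<equiv> space (path_space n)"

abbreviation path_sum :: "nat \<Rightarrow> (nat \<Rightarrow> real) \<Rightarrow> real" where
  "path_sum n x \<equiv> \<Sum>i\<in>{1..n}. x i"

lemma measurable_borel_Rp_imp: "f \<in> M \<rightarrow>\<^sub>M borel_Rp \<Longrightarrow> f \<in> borel_measurable M"
  by (simp add: borel_Rp_def measurable_restrict_space2_iff)

lemma measurable_coordinate_Rp: "i \<in> {1..n} \<Longrightarrow> (\<lambda>x. x i) \<in> path_space n \<rightarrow>\<^sub>M borel_Rp"
  unfolding path_space_def by (rule measurable_component_singleton)

text \<open>Off the index set every path takes the value \<open>undefined\<close>, so such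
  coordinates are constant. Covering all \<open>i\<close> matters because \<open>bit_coord\<close>
  enumerates every natural number as a coordinate.\<close>

lemma measurable_coordinate: "(\<lambda>x. x i) \<in> borel_measurable (path_space n)"
proof (cases "i \<in> {1..n}")
  case False
  then have "(\<lambda>x. x i) \<in> borel_measurable (path_space n) \<longleftrightarrow> (\<lambda>x. undefined :: real) \<in> borel_measurable (path_space n)"
    by (intro measurable_cong) (auto simp: space_path_space PiE_def extensional_def)
  then show ?thesis by simp
qed (intro measurable_borel_Rp_imp measurable_coordinate_Rp)

section \<open>Encoding of paths by sequences of bits\<close>

text \<open>Each bit compares one coordinate with one rational threshold; all such pairs are enumerated.\<close>

definition bit_coord :: "nat \<Rightarrow> nat" where
  "bit_coord j = fst (prod_decode j)"

definition bit_thr :: "nat \<Rightarrow> real" where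
  "bit_thr j = (case prod_decode (snd (prod_decode j)) of (k, l) \<Rightarrow> real k / real (Suc l))"

definition bits :: "nat \<Rightarrow> (nat \<Rightarrow> real) \<Rightarrow> bool list" where
  "bits n x = map (\<lambda>j. bit_thr j < x (bit_coord j)) [0..<n]"

text \<open>The best lower estimate of coordinate \<open>i\<close> among the thresholds that
  \<open>s\<close> reports as exceeded; 0 is the default when there is none, in keeping with
  nonnegative paths. Longer words only improve it.\<close>

definition bit_value :: "bool list \<Rightarrow> nat \<Rightarrow> real" where
  "bit_value s i = Max (insert 0 (bit_thr ` {j. j < length s \<and> s ! j \<and> bit_coord j = i}))"

definition bit_point :: "nat \<Rightarrow> bool list \<Rightarrow> nat \<Rightarrow> real" where
  "bit_point n s = restrict (bit_value s) {1..n}"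

lemma length_bits [simp]: "length (bits n x) = n"
  by (simp add: bits_def)

lemma bits_Suc: "bits (Suc n) x = bits n x @ [bit_thr n < x (bit_coord n)]"
  by (simp add: bits_def)

lemma bit_value_nonneg: "bit_value s i \<ge> 0"
  by (simp add: bit_value_def)

lemma bit_point_space: "bit_point n s \<in> paths n"
  by (auto simp: space_path_space bit_point_def bit_value_nonneg)

lemma bit_value_le: "x i \<ge> 0 \<Longrightarrow> bit_value (bits n x) i \<le> x i"
  by (auto simp: bit_value_def bits_def less_imp_le)

lemma bit_value_snoc: "bit_value s i \<le> bit_value (s @ [b]) i"
  unfolding bit_value_def by (intro Max_mono) (auto simp: nth_append)

lemma measurable_bits: "bits n \<in> path_space m \<rightarrow>\<^sub>M count_space UNIV"
proof (induction n)
  case (Suc n)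
  have [measurable]: "(\<lambda>x. bit_thr n < x (bit_coord n)) \<in> path_space m \<rightarrow>\<^sub>M count_space UNIV"
    using measurable_coordinate[measurable] by measurable
  have "(\<lambda>x. bits n x @ [bit_thr n < x (bit_coord n)]) \<in> path_space m \<rightarrow>\<^sub>M count_space UNIV"
    using Suc by (intro measurable_compose_countable[where f = "\<lambda>s x. s @ [bit_thr n < x (bit_coord n)]" and g = "bits n"])
      measurable
  then show ?case by (simp add: bits_Suc)
qed (simp add: bits_def)

text \<open>Below the bound \<open>K\<close> the finitely many thresholds with one fine denominator
  suffice for the precision \<open>e\<close>; once all of them have been tested, the estimate is
  good uniformly in the path.\<close>

lemma bit_value_approx:
  assumes "e > 0"
  obtains n0 where "\<And>n x i. n \<ge> n0 \<Longrightarrow> i \<in> {1..m} \<Longrightarrow> 0 \<le> x i \<Longrightarrow> x i \<le> K \<Longrightarrow> x i - e \<le> bit_value (bits n x) i"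
proof -
  obtain l where l: "inverse (real (Suc l)) < e" using reals_Archimedean[OF assms] by blast
  define J where "J = (\<lambda>(i, k). prod_encode (i, prod_encode (k, l))) ` ({1..m} \<times> {..nat \<lceil>K * real (Suc l)\<rceil>})"
  have fin: "finite J" unfolding J_def by simp
  show thesis
  proof (rule that)
    fix n and x :: "nat \<Rightarrow> real" and i
    assume n: "n \<ge> Suc (Max (insert 0 J))" and i: "i \<in> {1..m}" and x: "0 \<le> x i" "x i \<le> K"
    show "x i - e \<le> bit_value (bits n x) i"
    proof (cases "x i = 0")
      case True
      then show ?thesis using assms bit_value_nonneg[of "bits n x" i] by simp
    next
      case False
      \<comment> \<open>The largest integer strictly below x_i (l + 1): a bit records a strict
        excess over its threshold, so the floor would fail when this product is an integer.\<close>
      define k where "k = nat (\<lceil>x i * real (Suc l)\<rceil> - 1)"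
      have pos: "x i * real (Suc l) > 0" using x False by simp
      then have k: "real k = of_int \<lceil>x i * real (Suc l)\<rceil> - 1" unfolding k_def by simp
      have k1: "real k < x i * real (Suc l)" "x i * real (Suc l) \<le> real k + 1" unfolding k by linarith+
      have "k \<le> nat \<lceil>K * real (Suc l)\<rceil>"
      proof -
        have "\<lceil>x i * real (Suc l)\<rceil> \<le> \<lceil>K * real (Suc l)\<rceil>" using x(2) by (intro ceiling_mono mult_right_mono) auto
        then show ?thesis unfolding k_def by (intro nat_mono) simp
      qed
      then have jJ: "prod_encode (i, prod_encode (k, l)) \<in> J" using i unfolding J_def by auto
      define j where "j = prod_encode (i, prod_encode (k, l))"
      have j: "j < n" "bit_coord j = i" "bit_thr j = real k / real (Suc l)"
        using Max_ge[OF finite.insertI[OF fin], of j 0] jJ n unfolding j_def bit_coord_def bit_thr_def by auto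
      have lt: "bit_thr j < x i" using k1 by (simp add: j divide_simps)
      then have "bit_thr j \<le> bit_value (bits n x) i"
        unfolding bit_value_def using j(1,2) by (intro Max_ge finite.insertI insertI2 imageI) (auto simp: bits_def)
      moreover have "x i \<le> bit_thr j + inverse (real (Suc l))" using k1 by (simp add: j divide_simps inverse_eq_divide)
      ultimately show ?thesis using l by linarith
    qed
  qed
qed

section \<open>Representation of positive functionals on path space\<close>

text \<open>Discontinuous functions belong to the space, so that a functional on it can be evaluated
  at indicators of cells. The coordinate sum replaces the Euclidean norm, to which it is equivalent
  on nonnegative paths.\<close>

definition lin_growth :: "nat \<Rightarrow> ((nat \<Rightarrow> real) \<Rightarrow> real) set" where
  "lin_growth n = {f. \<exists>C\<ge>0. \<forall>x\<in>paths n. \<bar>f x\<bar> \<le> C * (1 + path_sum n x)}"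

lemma lin_growthI:
  assumes "\<And>x. x \<in> paths n \<Longrightarrow> \<bar>f x\<bar> \<le> C * (1 + path_sum n x)"
  shows "f \<in> lin_growth n"
proof -
  have "\<bar>f x\<bar> \<le> \<bar>C\<bar> * (1 + path_sum n x)" if x: "x \<in> paths n" for x
  proof -
    have "0 \<le> path_sum n x" using path_nonneg[OF x] by (intro sum_nonneg) auto
    then have "C * (1 + path_sum n x) \<le> \<bar>C\<bar> * (1 + path_sum n x)" by (intro mult_right_mono) auto
    with assms[OF x] show ?thesis by simp
  qed
  then show ?thesis unfolding lin_growth_def by (intro CollectI exI[of _ "\<bar>C\<bar>"]) auto
qed

lemma lin_growthE:
  assumes "f \<in> lin_growth n"
  obtains C where "C \<ge> 0" "\<And>x. x \<in> paths n \<Longrightarrow> \<bar>f x\<bar> \<le> C * (1 + path_sum n x)"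
  using assms unfolding lin_growth_def by blast

lemma sum_path_nonneg: "x \<in> paths n \<Longrightarrow> 0 \<le> path_sum n x"
  using path_nonneg by (intro sum_nonneg) auto

lemma coordinate_le_sum: "x \<in> paths n \<Longrightarrow> i \<in> {1..n} \<Longrightarrow> x i \<le> path_sum n x"
  using path_nonneg by (intro member_le_sum) auto

section \<open>Closure properties of the functions of linear growth\<close>

lemma lin_growth_add:
  assumes "f \<in> lin_growth n" "g \<in> lin_growth n"
  shows "(\<lambda>x. f x + g x) \<in> lin_growth n"
proof -
  obtain C D where C: "\<And>x. x \<in> paths n \<Longrightarrow> \<bar>f x\<bar> \<le> C * (1 + path_sum n x)"
    and D: "\<And>x. x \<in> paths n \<Longrightarrow> \<bar>g x\<bar> \<le> D * (1 + path_sum n x)"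
    using lin_growthE[OF assms(1)] lin_growthE[OF assms(2)] by metis
  have "\<bar>f x + g x\<bar> \<le> (C + D) * (1 + path_sum n x)" if "x \<in> paths n" for x
    unfolding distrib_right using C[OF that] D[OF that] by linarith
  then show ?thesis by (rule lin_growthI)
qed

lemma lin_growth_cmult:
  assumes "f \<in> lin_growth n"
  shows "(\<lambda>x. c * f x) \<in> lin_growth n"
proof -
  obtain C where C: "\<And>x. x \<in> paths n \<Longrightarrow> \<bar>f x\<bar> \<le> C * (1 + path_sum n x)"
    using lin_growthE[OF assms] by metis
  have "\<bar>c * f x\<bar> \<le> (\<bar>c\<bar> * C) * (1 + path_sum n x)" if "x \<in> paths n" for x
    using mult_left_mono[OF C[OF that], of "\<bar>c\<bar>"] by (simp add: abs_mult mult.assoc)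
  then show ?thesis by (rule lin_growthI)
qed

lemma lin_growth_const: "(\<lambda>x. c) \<in> lin_growth n"
proof (rule lin_growthI[where C = "\<bar>c\<bar>"])
  fix x assume "x \<in> paths n"
  then show "\<bar>c\<bar> \<le> \<bar>c\<bar> * (1 + path_sum n x)"
    using mult_left_mono[of 1 "1 + path_sum n x" "\<bar>c\<bar>"] sum_path_nonneg[of x n] by simp
qed

lemma lin_growth_mono:
  assumes "g \<in> lin_growth n" "\<And>x. x \<in> paths n \<Longrightarrow> \<bar>f x\<bar> \<le> \<bar>g x\<bar>"
  shows "f \<in> lin_growth n"
proof -
  obtain C where C: "\<And>x. x \<in> paths n \<Longrightarrow> \<bar>g x\<bar> \<le> C * (1 + path_sum n x)"
    using lin_growthE[OF assms(1)] by metis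
  show ?thesis by (rule lin_growthI[OF order_trans[OF assms(2) C]])
qed

lemma lin_growth_coordinate:
  assumes "i \<in> {1..n}"
  shows "(\<lambda>x. x i) \<in> lin_growth n"
proof (rule lin_growthI[where C = 1])
  fix x assume x: "x \<in> paths n"
  show "\<bar>x i\<bar> \<le> 1 * (1 + path_sum n x)"
    using coordinate_le_sum[OF x assms] path_nonneg[OF x assms] by simp
qed

lemma lin_growth_uminus: "f \<in> lin_growth n \<Longrightarrow> (\<lambda>x. - f x) \<in> lin_growth n"
  using lin_growth_cmult[of f n "-1"] by simp

lemma lin_growth_diff: "f \<in> lin_growth n \<Longrightarrow> g \<in> lin_growth n \<Longrightarrow> (\<lambda>x. f x - g x) \<in> lin_growth n"
  using lin_growth_add[of f n "\<lambda>x. - g x"] lin_growth_uminus[of g n] by simp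

lemma lin_growth_sum: "(\<And>i. i \<in> I \<Longrightarrow> f i \<in> lin_growth n) \<Longrightarrow> (\<lambda>x. \<Sum>i\<in>I. f i x) \<in> lin_growth n"
  by (induction I rule: infinite_finite_induct) (simp_all add: lin_growth_const lin_growth_add)

lemma function_subspace_lin_growth: "function_subspace (lin_growth n)"
  unfolding function_subspace_def using lin_growth_const[of 0 n] lin_growth_add lin_growth_cmult by blast

text \<open>Uniform continuity on each box [0,K]^n, which for functions on the path space amounts to
  continuity. The modulus is what a comparison with bit approximations uses.\<close>

definition unif_cont_bounded :: "nat \<Rightarrow> ((nat \<Rightarrow> real) \<Rightarrow> real) \<Rightarrow> bool" where
  "unif_cont_bounded n f \<longleftrightarrow> (\<forall>K. \<forall>e>0. \<exists>d>0. \<forall>x\<in>paths n. \<forall>y\<in>paths n.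
     (\<forall>i\<in>{1..n}. x i \<le> K \<and> y i \<le> K \<and> \<bar>x i - y i\<bar> < d) \<longrightarrow> \<bar>f x - f y\<bar> < e)"

lemma unif_cont_bounded_tendsto:
  assumes f: "unif_cont_bounded n f" and x: "x \<in> paths n"
    and y: "\<And>k. y k \<in> paths n" and lim: "\<And>i. i \<in> {1..n} \<Longrightarrow> (\<lambda>k. y k i) \<longlonglongrightarrow> x i"
  shows "(\<lambda>k. f (y k)) \<longlonglongrightarrow> f x"
proof (rule tendstoI)
  fix e :: real assume "e > 0"
  \<comment> \<open>The extra 1 leaves room for nearby points: once \<open>y k\<close> is within
    distance 1 of \<open>x\<close> in each coordinate, both lie in this box.\<close>
  define K where "K = path_sum n x + 1"
  obtain d where d: "d > 0" "\<And>x y. x \<in> paths n \<Longrightarrow> y \<in> paths n \<Longrightarrow>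
     (\<forall>i\<in>{1..n}. x i \<le> K \<and> y i \<le> K \<and> \<bar>x i - y i\<bar> < d) \<Longrightarrow> \<bar>f x - f y\<bar> < e"
    using f[unfolded unif_cont_bounded_def, THEN spec, THEN spec, THEN mp, OF \<open>e > 0\<close>, of K] by auto
  have "\<forall>\<^sub>F k in sequentially. \<forall>i\<in>{1..n}. \<bar>y k i - x i\<bar> < min d 1"
    using tendstoD[OF lim, of _ "min d 1"] d(1) by (intro eventually_ball_finite ballI) (auto simp: dist_real_def)
  then show "\<forall>\<^sub>F k in sequentially. dist (f (y k)) (f x) < e"
  proof eventually_elim
    case (elim k)
    have "y k i \<le> K \<and> x i \<le> K \<and> \<bar>y k i - x i\<bar> < d" if "i \<in> {1..n}" for i
    proof -
      have "\<bar>y k i - x i\<bar> < min d 1" using elim that by blast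
      then show ?thesis using coordinate_le_sum[OF x that] by (simp add: K_def abs_less_iff)
    qed
    then show ?case using d(2)[OF y x, of k] by (simp add: dist_real_def)
  qed
qed

lemma bit_value_tendsto:
  assumes "x \<in> space (path_space m)" "i \<in> {1..m}"
  shows "(\<lambda>n. bit_value (bits n x) i) \<longlonglongrightarrow> x i"
proof (rule tendstoI)
  fix e :: real assume "e > 0"
  then obtain n0 where n0: "\<And>n y j. n \<ge> n0 \<Longrightarrow> j \<in> {1..m} \<Longrightarrow> 0 \<le> y j \<Longrightarrow> y j \<le> x i \<Longrightarrow> y j - e / 2 \<le> bit_value (bits n y) j"
    using bit_value_approx[of "e / 2" m "x i"] by auto
  have "\<forall>n\<ge>n0. dist (bit_value (bits n x) i) (x i) < e"
  proof (intro allI impI)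
    fix n assume n: "n \<ge> n0"
    have "x i \<ge> 0" using path_nonneg assms by blast
    then have "x i - e / 2 \<le> bit_value (bits n x) i" "bit_value (bits n x) i \<le> x i"
      using n0[OF n assms(2)] bit_value_le by auto
    then show "dist (bit_value (bits n x) i) (x i) < e" using \<open>e > 0\<close> by (simp add: dist_real_def abs_less_iff)
  qed
  then show "\<forall>\<^sub>F n in sequentially. dist (bit_value (bits n x) i) (x i) < e"
    by (auto simp: eventually_sequentially)
qed

text \<open>The function is the pointwise limit of its values at bit points, each of which depends
  on finitely many measurable bits.\<close>

lemma unif_cont_bounded_measurable:
  assumes "unif_cont_bounded n f"
  shows "f \<in> borel_measurable (path_space n)"
proof (rule borel_measurable_LIMSEQ_real)
  show "(\<lambda>k. f (bit_point n (bits k x))) \<longlonglongrightarrow> f x" if "x \<in> paths n" for x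
    using bit_value_tendsto[OF that]
    by (intro unif_cont_bounded_tendsto[OF assms that] bit_point_space) (simp add: bit_point_def)
  show "(\<lambda>x. f (bit_point n (bits k x))) \<in> borel_measurable (path_space n)" for k
    by (rule measurable_compose[OF measurable_bits, of "\<lambda>s. f (bit_point n s)"]) simp
qed

text \<open>The values of \<open>L\<close> on bit cells form a \<open>mass_splitting\<close>, so on
  functions of finitely many bits \<open>L\<close> is an integral over the unit interval. Refining
  the bits gives dominated convergence on the probabilistic side and, by the tail assumption,
  convergence under \<open>L\<close> on the other. The limit of nested cells may lie outside them,
  for instance when \<open>L\<close> concentrates just to the right of a threshold; continuity of
  the integrand makes this harmless.\<close>

lemma path_space_representation:
  fixes L :: "((nat \<Rightarrow> real) \<Rightarrow> real) \<Rightarrow> real"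
  assumes L_add: "\<And>f g. f \<in> lin_growth n \<Longrightarrow> g \<in> lin_growth n \<Longrightarrow> L (\<lambda>x. f x + g x) = L f + L g"
    and L_scale: "\<And>f c. f \<in> lin_growth n \<Longrightarrow> L (\<lambda>x. c * f x) = c * L f"
    and L_mono: "\<And>f g. f \<in> lin_growth n \<Longrightarrow> g \<in> lin_growth n \<Longrightarrow>
      (\<And>x. x \<in> paths n \<Longrightarrow> f x \<le> g x) \<Longrightarrow> L f \<le> L g"
    and L_one: "L (\<lambda>x. 1) = 1"
    and L_tail: "\<And>i. i \<in> {1..n} \<Longrightarrow> (\<lambda>k. L (\<lambda>x. max 0 (x i - real k))) \<longlonglongrightarrow> 0"
  obtains Q where "prob_space Q" "sets Q = sets (path_space n)"
    "\<And>i. i \<in> {1..n} \<Longrightarrow> integrable Q (\<lambda>x. x i)"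
    "\<And>f. f \<in> lin_growth n \<Longrightarrow> unif_cont_bounded n f \<Longrightarrow> (\<integral>x. f x \<partial>Q) = L f"
proof -
  let ?S = "paths n"
  define w where "w s = L (\<lambda>x. if bits (length s) x = s then 1 else 0)" for s
  have ind: "(\<lambda>x. if P x then 1 else 0) \<in> lin_growth n" for P
    by (rule lin_growth_mono[OF lin_growth_const[of 1]]) auto
  interpret mass_splitting w
  proof
    show "w [] = 1" by (simp add: w_def bits_def L_one)
    fix s
    have "L (\<lambda>x. 0) = 0" using L_scale[OF lin_growth_const, of 0 1] by simp
    then show "w s \<ge> 0" unfolding w_def using L_mono[OF lin_growth_const[of 0] ind, of "\<lambda>x. bits (length s) x = s"] by simp
    have "w s = L (\<lambda>x. (if bits (Suc (length s)) x = s @ [False] then 1 else 0) + (if bits (Suc (length s)) x = s @ [True] then 1 else 0))"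
      unfolding w_def by (intro arg_cong[where f = L] ext) (auto simp: bits_Suc)
    then show "w s = w (s @ [False]) + w (s @ [True])" by (simp add: L_add[OF ind ind] w_def)
  qed
  interpret U: prob_space unit_interval by (rule prob_space_unit_interval)
  have L_sum: "L (\<lambda>x. \<Sum>i\<in>I. f i x) = (\<Sum>i\<in>I. L (f i))"
    if "\<And>i. i \<in> I \<Longrightarrow> f i \<in> lin_growth n" "finite I" for I :: "'i set" and f
    using that(2,1)
  proof (induction I)
    case empty show ?case using L_scale[OF lin_growth_const, of 0 1] by simp
  next
    case (insert i I) then show ?case by (simp add: L_add lin_growth_sum)
  qed
  have step: "(\<integral>u. g (code w k u) \<partial>unit_interval) = L (\<lambda>x. g (bits k x))" for g k
  proof -
    have "(\<integral>u. g (code w k u) \<partial>unit_interval) = (\<Sum>s | length s = k. L (\<lambda>x. g s * (if bits k x = s then 1 else 0)))"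
      unfolding integral_code by (intro sum.cong refl) (auto simp: w_def L_scale[OF ind])
    also have "\<dots> = L (\<lambda>x. \<Sum>s | length s = k. g s * (if bits k x = s then 1 else 0))"
      by (intro L_sum[symmetric] lin_growth_cmult ind finite_bool_lists)
    also have "(\<lambda>x. \<Sum>s | length s = k. g s * (if bits k x = s then 1 else 0)) = (\<lambda>x. g (bits k x))"
    proof
      fix x
      have "(\<Sum>s | length s = k. g s * (if bits k x = s then 1 else 0)) = (\<Sum>s | length s = k. if s = bits k x then g s else 0)"
        by (intro sum.cong) auto
      then show "(\<Sum>s | length s = k. g s * (if bits k x = s then 1 else 0)) = g (bits k x)" by (simp add: finite_bool_lists)
    qed
    finally show ?thesis .
  qed
  have bv_mono: "bit_value (code w k u) i \<le> bit_value (code w (Suc k) u) i" for k u i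
    by (simp add: bit_value_snoc)
  \<comment> \<open>The increasing estimates may be unbounded on a null set, where
    \<open>enn2real\<close> sets the limit to 0; that the set is null follows from
    \<open>sup_bound\<close>.\<close>
  define Y where "Y u i = enn2real (SUP k. ennreal (bit_value (code w k u) i))" for u i
  have bv_meas: "(\<lambda>u. bit_value (code w k u) i) \<in> borel_measurable unit_interval" for k i
    by (rule measurable_compose[OF measurable_code, of "\<lambda>s. bit_value s i"]) simp
  have Y_meas: "(\<lambda>u. Y u i) \<in> borel_measurable unit_interval" for i
    unfolding Y_def using bv_meas[measurable] by measurable
  have Y_nonneg: "Y u i \<ge> 0" for u i by (simp add: Y_def)
  have bv_in: "(\<lambda>x. bit_value (bits k x) i) \<in> lin_growth n" if "i \<in> {1..n}" for k i
    by (rule lin_growth_mono[OF lin_growth_coordinate[OF that]])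
      (use path_nonneg[OF _ that] in \<open>simp add: bit_value_le bit_value_nonneg\<close>)
  have sup_bound: "(\<integral>\<^sup>+u. (SUP k. ennreal (bit_value (code w k u) i)) \<partial>unit_interval) \<le> ennreal (L (\<lambda>x. x i))"
    if i: "i \<in> {1..n}" for i
  proof -
    have "(\<integral>\<^sup>+u. (SUP k. ennreal (bit_value (code w k u) i)) \<partial>unit_interval)
        = (SUP k. \<integral>\<^sup>+u. ennreal (bit_value (code w k u) i) \<partial>unit_interval)"
      using bv_mono bv_meas
      by (intro nn_integral_monotone_convergence_SUP incseq_SucI le_funI ennreal_leI) auto
    also have "\<dots> \<le> ennreal (L (\<lambda>x. x i))"
    proof (rule SUP_least)
      fix k
      have "(\<integral>\<^sup>+u. ennreal (bit_value (code w k u) i) \<partial>unit_interval) = ennreal (\<integral>u. bit_value (code w k u) i \<partial>unit_interval)"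
        using bit_value_nonneg by (intro nn_integral_eq_integral integrable_code[where g = "\<lambda>s. bit_value s i"]) auto
      also have "\<dots> = ennreal (L (\<lambda>x. bit_value (bits k x) i))" using step[of "\<lambda>s. bit_value s i"] by simp
      also have "\<dots> \<le> ennreal (L (\<lambda>x. x i))"
        using path_nonneg i by (intro ennreal_leI L_mono bv_in lin_growth_coordinate bit_value_le) auto
      finally show "(\<integral>\<^sup>+u. ennreal (bit_value (code w k u) i) \<partial>unit_interval) \<le> ennreal (L (\<lambda>x. x i))" .
    qed
    finally show ?thesis .
  qed
  have sup_fin: "AE u in unit_interval. (SUP k. ennreal (bit_value (code w k u) i)) \<noteq> \<infinity>" if "i \<in> {1..n}" for i
    using sup_bound[OF that] bv_meas by (intro nn_integral_noteq_infinite) (auto simp: top_unique)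
  have Y_lim: "(\<lambda>k. bit_value (code w k u) i) \<longlonglongrightarrow> Y u i" and Y_ge: "\<And>k. bit_value (code w k u) i \<le> Y u i"
    if fin: "(SUP k. ennreal (bit_value (code w k u) i)) \<noteq> \<infinity>" for u i
  proof -
    have eq: "(SUP k. ennreal (bit_value (code w k u) i)) = ennreal (Y u i)" 
      unfolding Y_def using fin unfolding infinity_ennreal_def less_top by (rule ennreal_enn2real[symmetric])
    have "(\<lambda>k. ennreal (bit_value (code w k u) i)) \<longlonglongrightarrow> ennreal (Y u i)"
      unfolding eq[symmetric] using bv_mono by (intro LIMSEQ_SUP incseq_SucI ennreal_leI)
    then show "(\<lambda>k. bit_value (code w k u) i) \<longlonglongrightarrow> Y u i"
      using bit_value_nonneg Y_nonneg by (subst (asm) tendsto_ennreal_iff) auto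
    fix k show "bit_value (code w k u) i \<le> Y u i"
      using SUP_upper[of k UNIV "\<lambda>k. ennreal (bit_value (code w k u) i)"] Y_nonneg[of u i]
      unfolding eq by simp
  qed
  have Y_int: "integrable unit_interval (\<lambda>u. Y u i)" if i: "i \<in> {1..n}" for i
  proof (rule integrableI_nonneg[OF Y_meas])
    show "AE u in unit_interval. 0 \<le> Y u i" by (simp add: Y_nonneg)
    have "(\<integral>\<^sup>+u. ennreal (Y u i) \<partial>unit_interval) \<le> (\<integral>\<^sup>+u. (SUP k. ennreal (bit_value (code w k u) i)) \<partial>unit_interval)"
      unfolding Y_def by (intro nn_integral_mono) (simp add: ennreal_enn2real_if)
    also note sup_bound[OF i]
    finally show "(\<integral>\<^sup>+u. ennreal (Y u i) \<partial>unit_interval) < \<infinity>" by (rule le_less_trans) simp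
  qed
  define Z where "Z u = restrict (Y u) {1..n}" for u
  have Z_space: "Z u \<in> ?S" for u by (auto simp: Z_def space_path_space Y_nonneg)
  have Z_meas: "Z \<in> unit_interval \<rightarrow>\<^sub>M path_space n"
    unfolding path_space_def Z_def restrict_def[abs_def]
    by (intro measurable_PiM_single') (auto simp: space_path_space borel_Rp_def measurable_restrict_space2_iff Y_meas Y_nonneg space_restrict_space)
  define Q where "Q = distr unit_interval (path_space n) Z"
  have Q_int: "(\<integral>x. f x \<partial>Q) = (\<integral>u. f (Z u) \<partial>unit_interval)" if "f \<in> borel_measurable (path_space n)" for f :: "_ \<Rightarrow> real"
    unfolding Q_def by (rule integral_distr[OF Z_meas that])
  show thesis
  proof
    show "prob_space Q" unfolding Q_def by (rule U.prob_space_distr[OF Z_meas])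
    show "sets Q = sets (path_space n)" by (simp add: Q_def)
    show "integrable Q (\<lambda>x. x i)" if "i \<in> {1..n}" for i
      unfolding Q_def using Y_int[OF that] that measurable_coordinate Z_meas
      by (subst integrable_distr_eq) (auto simp: Z_def)
    fix f assume f: "f \<in> lin_growth n" and uc: "unif_cont_bounded n f"
    obtain C where C: "C \<ge> 0" "\<And>x. x \<in> ?S \<Longrightarrow> \<bar>f x\<bar> \<le> C * (1 + path_sum n x)"
      using lin_growthE[OF f] by metis
    have f_meas: "f \<in> borel_measurable (path_space n)" by (rule unif_cont_bounded_measurable[OF uc])
    have AE_fin: "AE u in unit_interval. \<forall>i\<in>{1..n}. (SUP k. ennreal (bit_value (code w k u) i)) \<noteq> \<infinity>"
      by (rule AE_finite_allI[OF _ sup_fin]) simp_all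
    have lim1: "(\<lambda>k. \<integral>u. f (bit_point n (code w k u)) \<partial>unit_interval) \<longlonglongrightarrow> (\<integral>u. f (Z u) \<partial>unit_interval)"
    proof (rule integral_dominated_convergence[where w = "\<lambda>u. C * (1 + (\<Sum>i\<in>{1..n}. Y u i))"])
      show "(\<lambda>u. f (Z u)) \<in> borel_measurable unit_interval" by (rule measurable_compose[OF Z_meas f_meas])
      show "(\<lambda>u. f (bit_point n (code w k u))) \<in> borel_measurable unit_interval" for k
        by (rule measurable_compose[OF measurable_code, of "\<lambda>s. f (bit_point n s)"]) simp
      show "integrable unit_interval (\<lambda>u. C * (1 + (\<Sum>i\<in>{1..n}. Y u i)))"
        using Y_int by (intro integrable_mult_right Bochner_Integration.integrable_add Bochner_Integration.integrable_sum) auto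
      show "AE u in unit_interval. (\<lambda>k. f (bit_point n (code w k u))) \<longlonglongrightarrow> f (Z u)"
        using AE_fin
      proof eventually_elim
        case (elim u)
        show ?case
          using elim Y_lim by (intro unif_cont_bounded_tendsto[OF uc Z_space] bit_point_space) (simp add: bit_point_def Z_def)
      qed
      show "AE u in unit_interval. norm (f (bit_point n (code w k u))) \<le> C * (1 + (\<Sum>i\<in>{1..n}. Y u i))" for k
        using AE_fin
      proof eventually_elim
        case (elim u)
        have "\<bar>f (bit_point n (code w k u))\<bar> \<le> C * (1 + (\<Sum>i\<in>{1..n}. bit_point n (code w k u) i))"
          by (rule C(2)[OF bit_point_space])
        also have "\<dots> \<le> C * (1 + (\<Sum>i\<in>{1..n}. Y u i))"
          using elim Y_ge C(1) by (intro mult_left_mono add_left_mono sum_mono) (auto simp: bit_point_def)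
        finally show ?case by simp
      qed
    qed
    have approx_in: "(\<lambda>x. f (bit_point n (bits k x))) \<in> lin_growth n" for k
    proof (rule lin_growthI[where C = C])
      fix x assume x: "x \<in> ?S"
      have "\<bar>f (bit_point n (bits k x))\<bar> \<le> C * (1 + (\<Sum>i\<in>{1..n}. bit_point n (bits k x) i))"
        by (rule C(2)[OF bit_point_space])
      also have "\<dots> \<le> C * (1 + path_sum n x)"
        using C(1) path_nonneg[OF x] by (intro mult_left_mono add_left_mono sum_mono) (auto simp: bit_point_def bit_value_le)
      finally show "\<bar>f (bit_point n (bits k x))\<bar> \<le> C * (1 + path_sum n x)" .
    qed
    have tail_in: "(\<lambda>x. max 0 (x i - real m)) \<in> lin_growth n" if "i \<in> {1..n}" for i m
      by (rule lin_growth_mono[OF lin_growth_coordinate[OF that]]) (use path_nonneg[OF _ that] in simp)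
    have lim2: "(\<lambda>k. L (\<lambda>x. f (bit_point n (bits k x)))) \<longlonglongrightarrow> L f"
    proof (rule tendstoI)
      fix e :: real assume e: "e > 0"
      \<comment> \<open>With K = 2m, a path leaving the box has a largest coordinate M > 2m, so M
        \<le> 2 (M - m) and, as m \<ge> 1, its growth factor is at most (n + 1) M. The values of
        \<open>f\<close> at the path and at the smaller bit point contribute 2C; together this gives
        4C (n + 1).\<close>
      define D where "D = 4 * C * (n + 1)"
      have D: "D \<ge> 0" using C by (simp add: D_def)
      have "(\<lambda>m. D * (\<Sum>i\<in>{1..n}. L (\<lambda>x. max 0 (x i - real m)))) \<longlonglongrightarrow> D * (\<Sum>i\<in>{1..n}. 0)"
        by (intro tendsto_mult_left tendsto_sum L_tail)
      then have "\<forall>\<^sub>F m in sequentially. D * (\<Sum>i\<in>{1..n}. L (\<lambda>x. max 0 (x i - real m))) < e / 2"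
        using e by (intro order_tendstoD(2)[where a = "e / 2"]) auto
      then obtain m0 where m0: "\<And>m. m \<ge> m0 \<Longrightarrow> D * (\<Sum>i\<in>{1..n}. L (\<lambda>x. max 0 (x i - real m))) < e / 2"
        by (auto simp: eventually_sequentially)
      define m where "m = max m0 1"
      have m: "D * (\<Sum>i\<in>{1..n}. L (\<lambda>x. max 0 (x i - real m))) < e / 2" "m \<ge> 1" using m0[of m] by (auto simp: m_def)
      define K where "K = 2 * real m"
      obtain d where d: "d > 0" "\<And>x y. x \<in> ?S \<Longrightarrow> y \<in> ?S \<Longrightarrow>
         (\<forall>i\<in>{1..n}. x i \<le> K \<and> y i \<le> K \<and> \<bar>x i - y i\<bar> < d) \<Longrightarrow> \<bar>f x - f y\<bar> < e / 4"
        using uc[unfolded unif_cont_bounded_def, THEN spec, THEN spec, THEN mp, of "e / 4" K] e by auto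
      obtain k0 where k0: "\<And>k x i. k \<ge> k0 \<Longrightarrow> i \<in> {1..n} \<Longrightarrow> 0 \<le> x i \<Longrightarrow> x i \<le> K \<Longrightarrow> x i - d / 2 \<le> bit_value (bits k x) i"
        using bit_value_approx[of "d / 2" n K] d(1) by auto
      have "\<forall>k\<ge>k0. dist (L (\<lambda>x. f (bit_point n (bits k x)))) (L f) < e"
      proof (intro allI impI)
        fix k assume k: "k \<ge> k0"
        \<comment> \<open>Inside the box the modulus gives e/4, outside it the call payoffs at
          strike m dominate; \<open>L\<close> of the sum stays below e/4 + e/2.\<close>
        let ?B = "\<lambda>x. e / 4 + D * (\<Sum>i\<in>{1..n}. max 0 (x i - real m))"
        have B_in: "?B \<in> lin_growth n"
          by (intro lin_growth_add lin_growth_const lin_growth_cmult lin_growth_sum tail_in)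
        have bound: "\<bar>f (bit_point n (bits k x)) - f x\<bar> \<le> ?B x" if x: "x \<in> ?S" for x
        proof (cases "\<forall>i\<in>{1..n}. x i \<le> K")
          case True
          have "\<bar>f (bit_point n (bits k x)) - f x\<bar> < e / 4"
          proof (rule d(2)[OF bit_point_space x], intro ballI)
            fix i assume i: "i \<in> {1..n}"
            have "x i - d / 2 \<le> bit_value (bits k x) i" "bit_value (bits k x) i \<le> x i"
              using k0[OF k i] bit_value_le path_nonneg[OF x i] True i by auto
            then show "bit_point n (bits k x) i \<le> K \<and> x i \<le> K \<and> \<bar>bit_point n (bits k x) i - x i\<bar> < d"
              using True[rule_format, OF i] i d(1) by (simp add: bit_point_def)
          qed
          moreover have "0 \<le> D * (\<Sum>i\<in>{1..n}. max 0 (x i - real m))" using D by (intro mult_nonneg_nonneg sum_nonneg) auto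
          ultimately show ?thesis by simp
        next
          case False
          then obtain j where j: "j \<in> {1..n}" "x j > K" by auto
          define M where "M = Max (x ` {1..n})"
          have Mx: "x i \<le> M" if "i \<in> {1..n}" for i unfolding M_def using that by (intro Max_ge) auto
          have "M \<in> x ` {1..n}" unfolding M_def using j(1) by (intro Max_in) auto
          then obtain l where l: "l \<in> {1..n}" "M = x l" by blast
          have M: "M > K" using Mx[OF j(1)] j(2) by simp
          have "path_sum n x \<le> real n * M" using sum_bounded_above[of "{1..n}" x M] Mx by simp
          then have "1 + path_sum n x \<le> (real n + 1) * M" using M m(2) by (simp add: K_def algebra_simps)
          also have "\<dots> \<le> (real n + 1) * (2 * (M - real m))" using M by (intro mult_left_mono) (auto simp: K_def)
          also have "M - real m \<le> (\<Sum>i\<in>{1..n}. max 0 (x i - real m))"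
            using l member_le_sum[of l "{1..n}" "\<lambda>i. max 0 (x i - real m)"] by simp
          finally have s: "1 + path_sum n x \<le> (real n + 1) * (2 * (\<Sum>i\<in>{1..n}. max 0 (x i - real m)))"
            by (simp add: mult_left_mono)
          have "\<bar>f (bit_point n (bits k x))\<bar> \<le> C * (1 + (\<Sum>i\<in>{1..n}. bit_point n (bits k x) i))"
            by (rule C(2)[OF bit_point_space])
          also have "\<dots> \<le> C * (1 + path_sum n x)"
            using C(1) path_nonneg[OF x] by (intro mult_left_mono add_left_mono sum_mono) (auto simp: bit_point_def bit_value_le)
          finally have "\<bar>f (bit_point n (bits k x)) - f x\<bar> \<le> 2 * C * (1 + path_sum n x)"
            using C(2)[OF x] by simp
          also have "\<dots> \<le> 2 * C * ((real n + 1) * (2 * (\<Sum>i\<in>{1..n}. max 0 (x i - real m))))"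
            using s C(1) by (intro mult_left_mono) auto
          also have "\<dots> = D * (\<Sum>i\<in>{1..n}. max 0 (x i - real m))" by (simp add: D_def algebra_simps)
          finally show ?thesis using e by simp
        qed
        have LB: "L ?B < e"
        proof -
          have "L ?B = L (\<lambda>x. e / 4) + L (\<lambda>x. D * (\<Sum>i\<in>{1..n}. max 0 (x i - real m)))"
            by (intro L_add lin_growth_const lin_growth_cmult lin_growth_sum tail_in)
          also have "L (\<lambda>x. e / 4) = e / 4"
            using L_scale[OF lin_growth_const[of 1], of "e / 4"] L_one by simp
          also have "L (\<lambda>x. D * (\<Sum>i\<in>{1..n}. max 0 (x i - real m))) = D * L (\<lambda>x. \<Sum>i\<in>{1..n}. max 0 (x i - real m))"
            by (intro L_scale lin_growth_sum tail_in)
          also have "L (\<lambda>x. \<Sum>i\<in>{1..n}. max 0 (x i - real m)) = (\<Sum>i\<in>{1..n}. L (\<lambda>x. max 0 (x i - real m)))"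
            by (intro L_sum tail_in) auto
          finally show ?thesis using m(1) e by simp
        qed
        have diff: "L (\<lambda>x. f (bit_point n (bits k x))) - L f = L (\<lambda>x. f (bit_point n (bits k x)) - f x)"
          using L_add[OF approx_in lin_growth_uminus[OF f], of k] L_scale[OF f, of "-1"] by simp
        have "L (\<lambda>x. f (bit_point n (bits k x)) - f x) \<le> L ?B"
          using bound by (intro L_mono lin_growth_diff approx_in f B_in) (auto simp: abs_le_iff)
        moreover have "L (\<lambda>x. - ?B x) \<le> L (\<lambda>x. f (bit_point n (bits k x)) - f x)"
          using bound by (intro L_mono lin_growth_diff approx_in f lin_growth_uminus[OF B_in]) (force simp: abs_le_iff)
        moreover have "L (\<lambda>x. - ?B x) = - L ?B" using L_scale[OF B_in, of "-1"] by simp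
        ultimately show "dist (L (\<lambda>x. f (bit_point n (bits k x)))) (L f) < e"
          using LB unfolding dist_real_def diff by simp
      qed
      then show "\<forall>\<^sub>F k in sequentially. dist (L (\<lambda>x. f (bit_point n (bits k x)))) (L f) < e"
        by (auto simp: eventually_sequentially)
    qed
    show "(\<integral>x. f x \<partial>Q) = L f"
      unfolding Q_int[OF f_meas] using LIMSEQ_unique[OF lim1] lim2 step[of "\<lambda>s. f (bit_point n s)"] by simp
  qed
qed

section \<open>Sup-convolutions\<close>

lemma lipschitz_unif_cont_bounded:
  assumes "\<And>x y. x \<in> paths n \<Longrightarrow> y \<in> paths n \<Longrightarrow>
    \<bar>f x - f y\<bar> \<le> M * (\<Sum>i\<in>{1..n}. \<bar>x i - y i\<bar>)"
  shows "unif_cont_bounded n f"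
  unfolding unif_cont_bounded_def
proof (intro allI impI)
  fix K e :: real assume e: "e > 0"
  \<comment> \<open>The summand 1 keeps the denominator positive and makes the final estimate
    strict.\<close>
  define d where "d = e / (\<bar>M\<bar> * n + 1)"
  have D: "\<bar>M\<bar> * n + 1 > 0" by (simp add: add_nonneg_pos)
  have d: "d > 0" unfolding d_def using e D by (rule divide_pos_pos)
  have "\<bar>f x - f y\<bar> < e"
    if x: "x \<in> paths n" and y: "y \<in> paths n"
      and close: "\<forall>i\<in>{1..n}. x i \<le> K \<and> y i \<le> K \<and> \<bar>x i - y i\<bar> < d" for x y
  proof -
    have "(\<Sum>i\<in>{1..n}. \<bar>x i - y i\<bar>) \<le> (\<Sum>i\<in>{1..n}. d)" using close by (intro sum_mono) (auto simp: less_imp_le)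
    then have "\<bar>M\<bar> * (\<Sum>i\<in>{1..n}. \<bar>x i - y i\<bar>) \<le> \<bar>M\<bar> * (n * d)" by (intro mult_left_mono) auto
    moreover have "M * (\<Sum>i\<in>{1..n}. \<bar>x i - y i\<bar>) \<le> \<bar>M\<bar> * (\<Sum>i\<in>{1..n}. \<bar>x i - y i\<bar>)"
      by (intro mult_right_mono sum_nonneg) auto
    ultimately have "\<bar>f x - f y\<bar> \<le> \<bar>M\<bar> * n * d" using assms[OF x y] by simp
    also have "\<dots> < (\<bar>M\<bar> * n + 1) * d" using d by (simp add: algebra_simps)
    also have "\<dots> = e" unfolding d_def using D by simp
    finally show ?thesis .
  qed
  then show "\<exists>d>0. \<forall>x\<in>paths n. \<forall>y\<in>paths n.
      (\<forall>i\<in>{1..n}. x i \<le> K \<and> y i \<le> K \<and> \<bar>x i - y i\<bar> < d) \<longrightarrow> \<bar>f x - f y\<bar> < e"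
    using d by blast
qed

text \<open>Semicontinuity refers to the product topology on all functions
  \<open>nat \<Rightarrow> real\<close>. A sequence of counterexamples for shrinking radii converges
  coordinatewise, its coordinates off 1..n being the same constant, and so it converges in that
  topology.\<close>

lemma upper_semicontinuous_on_path_space:
  assumes h: "upper_semicontinuous_on (paths n) h"
    and x: "x \<in> paths n" and c: "h x < c"
  obtains r where "r > 0"
    "\<And>y. y \<in> paths n \<Longrightarrow> (\<Sum>i\<in>{1..n}. \<bar>x i - y i\<bar>) < r \<Longrightarrow> h y < c"
proof (rule ccontr)
  assume neg: "\<not> thesis"
  have "\<exists>y. y \<in> paths n \<and> (\<Sum>i\<in>{1..n}. \<bar>x i - y i\<bar>) < inverse (real (Suc k)) \<and> \<not> h y < c" for k
    using neg that[of "inverse (real (Suc k))"] by auto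
  then obtain y where y: "\<And>k. y k \<in> paths n"
    "\<And>k. (\<Sum>i\<in>{1..n}. \<bar>x i - y k i\<bar>) < inverse (real (Suc k))" "\<And>k. \<not> h (y k) < c" by metis
  have lim: "(\<lambda>k. y k i) \<longlonglongrightarrow> x i" for i
  proof (cases "i \<in> {1..n}")
    case True
    have "(\<lambda>k. y k i - x i) \<longlonglongrightarrow> 0"
    proof (rule Lim_null_comparison[OF _ LIMSEQ_inverse_real_of_nat])
      show "\<forall>\<^sub>F k in sequentially. norm (y k i - x i) \<le> inverse (real (Suc k))"
      proof (intro always_eventually allI)
        fix k
        have "\<bar>x i - y k i\<bar> \<le> (\<Sum>i\<in>{1..n}. \<bar>x i - y k i\<bar>)" using True by (intro member_le_sum) auto
        then show "norm (y k i - x i) \<le> inverse (real (Suc k))" using y(2)[of k] by (simp add: abs_minus_commute)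
      qed
    qed
    then show ?thesis by (simp add: LIM_zero_iff)
  next
    case False
    then have "y k i = x i" for k using x y(1)[of k] by (auto simp: space_path_space PiE_def extensional_def)
    then show ?thesis by simp
  qed
  have "filterlim y (nhds x) sequentially"
  proof -
    have "limitin (product_topology (\<lambda>i. euclidean) UNIV) y x sequentially"
      by (subst limitin_componentwise) (use lim in auto)
    then show ?thesis by (simp add: euclidean_product_topology)
  qed
  \<comment> \<open>The filter \<open>at x within\<close> is punctured; the point \<open>x\<close>
    itself is taken care of by \<open>h x < c\<close>.\<close>
  moreover have "\<forall>\<^sub>F z in nhds x. z \<noteq> x \<longrightarrow> z \<in> paths n \<longrightarrow> h z < c"
    using h x c unfolding upper_semicontinuous_on_def eventually_at_filter by blast
  ultimately have "\<forall>\<^sub>F k in sequentially. y k \<noteq> x \<longrightarrow> y k \<in> paths n \<longrightarrow> h (y k) < c"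
    by (rule eventually_compose_filterlim[rotated])
  then obtain k where "y k \<noteq> x \<longrightarrow> y k \<in> paths n \<longrightarrow> h (y k) < c"
    by (auto simp: eventually_sequentially)
  then show False using y[of k] c by auto
qed

lemma linear_growth_on_path_space:
  assumes "linear_growth_on (paths n) (\<lambda>x. L2_set x {1..n}) h"
  shows "h \<in> lin_growth n"
proof -
  obtain C where C: "\<And>x. x \<in> paths n \<Longrightarrow> \<bar>h x\<bar> / (1 + L2_set x {1..n}) \<le> C"
    using assms unfolding linear_growth_on_def bdd_above_def by auto
  show ?thesis
  proof (rule lin_growthI[where C = "\<bar>C\<bar>"])
    fix x assume x: "x \<in> paths n"
    have L2: "0 \<le> L2_set x {1..n}" "L2_set x {1..n} \<le> path_sum n x"
      using path_nonneg[OF x] by (auto intro: L2_set_le_sum)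
    have "\<bar>h x\<bar> \<le> C * (1 + L2_set x {1..n})" using C[OF x] L2(1) by (simp add: pos_divide_le_eq add_pos_nonneg)
    also have "\<dots> \<le> \<bar>C\<bar> * (1 + L2_set x {1..n})" using L2(1) by (intro mult_right_mono) auto
    also have "\<dots> \<le> \<bar>C\<bar> * (1 + path_sum n x)" using L2(2) by (intro mult_left_mono) auto
    finally show "\<bar>h x\<bar> \<le> \<bar>C\<bar> * (1 + path_sum n x)" .
  qed
qed

text \<open>Distance is penalised with slope C + m. The part C offsets the growth of
  \<open>h\<close>, so the supremum is finite already for m = 0, with a bound uniform in m. The part
  m confines near-maximisers to any given neighbourhood of the point, where semicontinuity
  applies.\<close>

lemma sup_convolution:
  assumes usc: "upper_semicontinuous_on (paths n) h" and h: "h \<in> lin_growth n"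
  obtains H C where "\<And>m. unif_cont_bounded n (H m)"
    "\<And>m x. x \<in> paths n \<Longrightarrow> \<bar>H m x\<bar> \<le> C * (1 + path_sum n x)"
    "\<And>m x. x \<in> paths n \<Longrightarrow> h x \<le> H m x"
    "\<And>x. x \<in> paths n \<Longrightarrow> (\<lambda>m. H m x) \<longlonglongrightarrow> h x"
proof -
  let ?S = "paths n"
  define d where "d x y = (\<Sum>i\<in>{1..n}. \<bar>x i - y i\<bar>)" for x y :: "nat \<Rightarrow> real"
  have d_nonneg: "d x y \<ge> 0" for x y unfolding d_def by (intro sum_nonneg) auto
  have d_tri: "d x z \<le> d x y + d y z" for x y z
    unfolding d_def sum.distrib[symmetric] by (intro sum_mono) auto
  have d_sum: "(\<Sum>i\<in>{1..n}. y i) \<le> path_sum n x + d x y" for x y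
    unfolding d_def sum.distrib[symmetric] by (intro sum_mono) auto
  obtain C where C: "C \<ge> 0" "\<And>x. x \<in> ?S \<Longrightarrow> \<bar>h x\<bar> \<le> C * (1 + path_sum n x)"
    using lin_growthE[OF h] by metis
  have hC: "h y - C * d x y \<le> C * (1 + path_sum n x)" if y: "y \<in> ?S" for x y
  proof -
    have "C * (1 + (\<Sum>i\<in>{1..n}. y i)) \<le> C * (1 + (path_sum n x + d x y))"
      using d_sum[of y x] C(1) by (intro mult_left_mono) auto
    then show ?thesis using C(2)[OF y] by (simp add: algebra_simps)
  qed
  define H where "H m x = (SUP y\<in>?S. h y - (C + real m) * d x y)" for m x
  have bound: "h y - (C + real m) * d x y \<le> C * (1 + path_sum n x) - real m * d x y" if "y \<in> ?S" for m x y
    using hC[OF that, of x] by (simp add: algebra_simps)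
  have bdd: "bdd_above ((\<lambda>y. h y - (C + real m) * d x y) ` ?S)" for m x
  proof (rule bdd_aboveI2)
    fix y assume "y \<in> ?S"
    then show "h y - (C + real m) * d x y \<le> C * (1 + path_sum n x)"
      using bound[of y m x] mult_nonneg_nonneg[OF of_nat_0_le_iff[of m] d_nonneg[of x y]] by linarith
  qed
  have upper: "h y - (C + real m) * d x y \<le> H m x" if "y \<in> ?S" for m x y
    unfolding H_def using that by (intro cSUP_upper bdd) auto
  have least: "H m x \<le> c" if "\<And>y. y \<in> ?S \<Longrightarrow> h y - (C + real m) * d x y \<le> c" for m x c
    unfolding H_def using that bit_point_space[of n "[]"] by (intro cSUP_least) auto
  have h_le: "h x \<le> H m x" if x: "x \<in> ?S" for m x using upper[OF x, of m x] by (simp add: d_def)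
  have H_le: "H m x \<le> C * (1 + path_sum n x)" for m x
  proof (rule least)
    fix y assume "y \<in> ?S"
    then show "h y - (C + real m) * d x y \<le> C * (1 + path_sum n x)"
      using bound[of y m x] mult_nonneg_nonneg[OF of_nat_0_le_iff[of m] d_nonneg[of x y]] by linarith
  qed
  have lip: "H m x \<le> H m x' + (C + real m) * d x x'" for m x x'
  proof (rule least)
    fix y assume y: "y \<in> ?S"
    have "(C + real m) * d x' y \<le> (C + real m) * (d x' x + d x y)"
      using d_tri[of x' y x] C(1) by (intro mult_left_mono) auto
    moreover have "d x' x = d x x'" unfolding d_def by (simp add: abs_minus_commute)
    ultimately show "h y - (C + real m) * d x y \<le> H m x' + (C + real m) * d x x'"
      using upper[OF y, of m x'] by (simp add: algebra_simps)
  qed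
  show thesis
  proof
    show "unif_cont_bounded n (H m)" for m
    proof (rule lipschitz_unif_cont_bounded[where M = "C + real m"])
      fix x y
      have "d y x = d x y" unfolding d_def by (simp add: abs_minus_commute)
      then show "\<bar>H m x - H m y\<bar> \<le> (C + real m) * (\<Sum>i\<in>{1..n}. \<bar>x i - y i\<bar>)"
        using lip[of m x y] lip[of m y x] unfolding d_def[symmetric] by (simp add: abs_le_iff)
    qed
    show "\<bar>H m x\<bar> \<le> C * (1 + path_sum n x)" if "x \<in> ?S" for m x
      using H_le[of m x] h_le[OF that, of m] C(2)[OF that] by (simp add: abs_le_iff)
    show "h x \<le> H m x" if "x \<in> ?S" for m x using h_le[OF that] .
    show "(\<lambda>m. H m x) \<longlonglongrightarrow> h x" if x: "x \<in> ?S" for x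
    proof (rule order_tendstoI)
      fix c assume "c < h x"
      then show "\<forall>\<^sub>F m in sequentially. c < H m x" using h_le[OF x] by (intro always_eventually) (auto intro: less_le_trans)
    next
      fix c assume "h x < c"
      then obtain c' where c': "h x < c'" "c' < c" using dense by blast
      obtain r where r: "r > 0" "\<And>y. y \<in> ?S \<Longrightarrow> d x y < r \<Longrightarrow> h y < c'"
        using upper_semicontinuous_on_path_space[OF usc x c'(1)] unfolding d_def by metis
      \<comment> \<open>From this index on, every point at distance at least r is penalised below
        c'.\<close>
      obtain m0 where m0: "(C * (1 + path_sum n x) - c') / r < real m0" using reals_Archimedean2 by blast
      have "H m x < c" if m: "m \<ge> m0" for m
      proof -
        have "(C * (1 + path_sum n x) - c') / r < real m" using m0 m by linarith
        then have big: "C * (1 + path_sum n x) - real m * r < c'" using r(1) by (simp add: pos_divide_less_eq)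
        have "H m x \<le> c'"
        proof (rule least)
          fix y assume y: "y \<in> ?S"
          show "h y - (C + real m) * d x y \<le> c'"
          proof (cases "d x y < r")
            case True
            have "0 \<le> (C + real m) * d x y" using C(1) d_nonneg by simp
            then show ?thesis using r(2)[OF y True] by simp
          next
            case False
            then have "real m * r \<le> real m * d x y" by (intro mult_left_mono) auto
            then show ?thesis using bound[OF y, of m x] big by linarith
          qed
        qed
        then show ?thesis using c'(2) by simp
      qed
      then show "\<forall>\<^sub>F m in sequentially. H m x < c" unfolding eventually_sequentially by blast
    qed
  qed
qed

section \<open>Convex functions of linear growth\<close>

lemma CVX_L_D:
  assumes "f \<in> CVX_L"
  shows "continuous_on {0..} f" "convex_on {0..} f" "\<exists>K\<ge>0. \<forall>x\<ge>0. \<bar>f x\<bar> \<le> K * (1 + x)"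
proof -
  show "continuous_on {0..} f" "convex_on {0..} f" using assms unfolding CVX_L_def by auto
  obtain K where K: "\<And>x. x \<ge> 0 \<Longrightarrow> \<bar>f x\<bar> / (1 + x) \<le> K"
    using assms unfolding CVX_L_def linear_growth_on_def bdd_above_def by auto
  have "K \<ge> 0" using K[of 0] by (simp add: order_trans[OF abs_ge_zero])
  moreover have "\<bar>f x\<bar> \<le> K * (1 + x)" if "x \<ge> 0" for x using K[OF that] that by (simp add: divide_simps)
  ultimately show "\<exists>K\<ge>0. \<forall>x\<ge>0. \<bar>f x\<bar> \<le> K * (1 + x)" by blast
qed

lemma CVX_L_I:
  assumes "continuous_on {0..} f" "convex_on {0..} f" "\<And>x. x \<ge> 0 \<Longrightarrow> \<bar>f x\<bar> \<le> K * (1 + x)"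
  shows "f \<in> CVX_L"
  using assms unfolding CVX_L_def linear_growth_on_def
  by (auto intro!: bdd_aboveI2[where M = K] simp: divide_simps)

lemma CVX_L_affine: "(\<lambda>x. a + b * x) \<in> CVX_L"
proof (rule CVX_L_I[where K = "\<bar>a\<bar> + \<bar>b\<bar>"])
  show "continuous_on {0..} (\<lambda>x. a + b * x)" by (intro continuous_intros)
  show "convex_on {0..} (\<lambda>x. a + b * x)"
  proof (rule convex_onI)
    fix t x y :: real
    show "a + b * ((1 - t) *\<^sub>R x + t *\<^sub>R y) \<le> (1 - t) * (a + b * x) + t * (a + b * y)"
      by (simp add: algebra_simps)
  qed simp
  fix x :: real assume x: "x \<ge> 0"
  have "\<bar>a + b * x\<bar> \<le> \<bar>a\<bar> + \<bar>b\<bar> * x" using abs_triangle_ineq[of a "b * x"] x by (simp add: abs_mult)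
  also have "\<dots> \<le> (\<bar>a\<bar> + \<bar>b\<bar>) * (1 + x)" using x by (simp add: algebra_simps)
  finally show "\<bar>a + b * x\<bar> \<le> (\<bar>a\<bar> + \<bar>b\<bar>) * (1 + x)" .
qed

lemma CVX_L_const: "(\<lambda>x. a) \<in> CVX_L"
  using CVX_L_affine[of a 0] by simp

lemma CVX_L_id: "(\<lambda>x. x) \<in> CVX_L"
  using CVX_L_affine[of 0 1] by simp

lemma CVX_L_add:
  assumes f: "f \<in> CVX_L" and g: "g \<in> CVX_L"
  shows "(\<lambda>x. f x + g x) \<in> CVX_L"
proof -
  obtain K L where K: "\<And>x. x \<ge> 0 \<Longrightarrow> \<bar>f x\<bar> \<le> K * (1 + x)" and L: "\<And>x. x \<ge> 0 \<Longrightarrow> \<bar>g x\<bar> \<le> L * (1 + x)"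
    using CVX_L_D(3)[OF f] CVX_L_D(3)[OF g] by blast
  show ?thesis
  proof (rule CVX_L_I[where K = "K + L"])
    show "continuous_on {0..} (\<lambda>x. f x + g x)" by (intro continuous_on_add CVX_L_D(1) f g)
    show "convex_on {0..} (\<lambda>x. f x + g x)" by (intro convex_on_add CVX_L_D(2) f g)
    fix x :: real assume "x \<ge> 0"
    then show "\<bar>f x + g x\<bar> \<le> (K + L) * (1 + x)" using K[of x] L[of x] unfolding distrib_right by linarith
  qed
qed

lemma CVX_L_cmult:
  assumes f: "f \<in> CVX_L" and c: "c \<ge> 0"
  shows "(\<lambda>x. c * f x) \<in> CVX_L"
proof -
  obtain K where K: "\<And>x. x \<ge> 0 \<Longrightarrow> \<bar>f x\<bar> \<le> K * (1 + x)"
    using CVX_L_D(3)[OF f] by blast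
  show ?thesis
  proof (rule CVX_L_I[where K = "c * K"])
    show "continuous_on {0..} (\<lambda>x. c * f x)" by (intro continuous_on_mult_left CVX_L_D(1) f)
    show "convex_on {0..} (\<lambda>x. c * f x)" by (intro convex_on_cmul CVX_L_D(2) f c)
    fix x :: real assume "x \<ge> 0"
    then show "\<bar>c * f x\<bar> \<le> c * K * (1 + x)" using mult_left_mono[OF K c] c by (simp add: abs_mult mult.assoc)
  qed
qed

lemma CVX_L_call: "k \<ge> 0 \<Longrightarrow> (\<lambda>x. max 0 (x - k)) \<in> CVX_L"
proof (rule CVX_L_I[where K = 1])
  assume k: "k \<ge> 0"
  show "continuous_on {0..} (\<lambda>x. max 0 (x - k))" by (intro continuous_intros)
  show "convex_on {0..} (\<lambda>x. max 0 (x - k))"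
  proof (rule convex_onI)
    fix t x y :: real assume t: "0 < t" "t < 1"
    have "(1 - t) * x + t * y - k = (1 - t) * (x - k) + t * (y - k)" by (simp add: algebra_simps)
    also have "\<dots> \<le> (1 - t) * max 0 (x - k) + t * max 0 (y - k)"
      using t by (intro add_mono mult_left_mono) auto
    finally show "max 0 ((1 - t) *\<^sub>R x + t *\<^sub>R y - k) \<le> (1 - t) * max 0 (x - k) + t * max 0 (y - k)"
      using t by simp
  qed simp
  show "\<bar>max 0 (x - k)\<bar> \<le> 1 * (1 + x)" if "x \<ge> 0" for x using that k by simp
qed

section \<open>Measurability and integrability on the half-line\<close>

lemma borel_measurable_borel_Rp: "continuous_on {0..} f \<Longrightarrow> f \<in> borel_measurable borel_Rp"
  unfolding borel_Rp_def by (rule borel_measurable_continuous_on_restrict)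

lemma borel_measurable_call: "(\<lambda>x. max 0 (x - k)) \<in> borel_measurable borel_Rp" for k :: real
  by (intro borel_measurable_borel_Rp continuous_intros)

context
  fixes \<mu> :: "real measure"
  assumes mu: "\<mu> \<in> prob_first_moment"
begin

lemma prob_first_momentD: "prob_space \<mu>" "sets \<mu> = sets borel_Rp" "integrable \<mu> (\<lambda>x. x)" "space \<mu> = {0..}"
proof -
  show "prob_space \<mu>" "sets \<mu> = sets borel_Rp" "integrable \<mu> (\<lambda>x. x)"
    using mu unfolding prob_first_moment_def by auto
  then show "space \<mu> = {0..}" using sets_eq_imp_space_eq[of \<mu> borel_Rp] by (simp add: borel_Rp_def space_restrict_space)
qed

lemma measurable_prob_first_moment: "f \<in> borel_measurable borel_Rp \<Longrightarrow> f \<in> borel_measurable \<mu>"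
  using measurable_cong_sets[OF prob_first_momentD(2) refl] by auto

lemma integrable_linear_growth:
  assumes "f \<in> borel_measurable borel_Rp" "\<And>x. x \<ge> 0 \<Longrightarrow> \<bar>f x\<bar> \<le> K * (1 + x)"
  shows "integrable \<mu> f"
proof (rule Bochner_Integration.integrable_bound)
  interpret prob_space \<mu> by (rule prob_first_momentD)
  show "integrable \<mu> (\<lambda>x. K * (1 + x))"
    using prob_first_momentD(3) by (intro integrable_mult_right Bochner_Integration.integrable_add) auto
  show "f \<in> borel_measurable \<mu>" by (rule measurable_prob_first_moment[OF assms(1)])
  show "AE x in \<mu>. norm (f x) \<le> norm (K * (1 + x))"
    using assms(2) by (intro AE_I2) (force simp: prob_first_momentD)
qed

lemma integrable_CVX_L: "f \<in> CVX_L \<Longrightarrow> integrable \<mu> f"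
  using CVX_L_D[of f] by (auto intro: integrable_linear_growth borel_measurable_borel_Rp)

end

section \<open>Integration against a grid measure determined by call prices\<close>

text \<open>The discrete measure on \<open>{0, 1/n, \<dots>, n}\<close> whose call prices at the grid points are those of \<open>C\<close>
  (up to the mass that \<open>C\<close> places beyond \<open>n\<close>), written after one summation by parts.\<close>

definition grid_slope :: "nat \<Rightarrow> (real \<Rightarrow> real) \<Rightarrow> nat \<Rightarrow> real" where
  "grid_slope n f j = real n * (f (real (Suc j) / real n) - f (real j / real n))"

definition grid_integral :: "(real \<Rightarrow> real) \<Rightarrow> nat \<Rightarrow> (real \<Rightarrow> real) \<Rightarrow> real" where
  "grid_integral C n f = f 0 +
     (\<Sum>j<n * n. grid_slope n f j * (C (real j / real n) - C (real (Suc j) / real n)))"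

text \<open>Traits of k -> E max(0, X - k) for X \<ge> 0 with mean \<open>x0\<close> that survive
  finite maxima. Convexity is kept in midpoint form, which is what three neighbouring grid points
  test.\<close>

definition call_like :: "real \<Rightarrow> (real \<Rightarrow> real) \<Rightarrow> bool" where
  "call_like x0 C \<longleftrightarrow> C 0 = x0 \<and> (\<forall>k\<ge>0. 0 \<le> C k \<and> x0 - k \<le> C k) \<and>
     (\<forall>k\<ge>0. \<forall>l\<ge>k. C l \<le> C k) \<and> (\<forall>a\<ge>0. \<forall>d\<ge>0. 2 * C (a + d) \<le> C a + C (a + 2 * d))"

lemma call_likeD:
  assumes "call_like x0 C"
  shows "C 0 = x0" "k \<ge> 0 \<Longrightarrow> 0 \<le> C k" "k \<ge> 0 \<Longrightarrow> x0 - k \<le> C k"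
    "0 \<le> k \<Longrightarrow> k \<le> l \<Longrightarrow> C l \<le> C k" "a \<ge> 0 \<Longrightarrow> d \<ge> 0 \<Longrightarrow> 2 * C (a + d) \<le> C a + C (a + 2 * d)"
  using assms unfolding call_like_def by blast+

lemma grid_integral_add:
  "grid_integral C n (\<lambda>x. f x + g x) = grid_integral C n f + grid_integral C n g"
proof -
  have "grid_slope n (\<lambda>x. f x + g x) j = grid_slope n f j + grid_slope n g j" for j
    by (simp add: grid_slope_def algebra_simps)
  then show ?thesis unfolding grid_integral_def by (simp add: distrib_right sum.distrib)
qed

lemma grid_integral_diff:
  "grid_integral C n (\<lambda>x. f x - g x) = grid_integral C n f - grid_integral C n g"
proof -
  have "grid_slope n (\<lambda>x. f x - g x) j = grid_slope n f j - grid_slope n g j" for j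
    by (simp add: grid_slope_def algebra_simps)
  then show ?thesis unfolding grid_integral_def by (simp add: left_diff_distrib sum_subtractf)
qed

text \<open>Abel summation gives the value F_0 the weight 1 - r d_0 and F_j the weight r (d_{j-1} -
  d_j), all nonnegative. Induction retains the boundary term, which absorbs the next step.\<close>

lemma summation_by_parts_nonneg:
  fixes F d :: "nat \<Rightarrow> real"
  assumes F: "\<And>j. F j \<ge> 0" and d: "\<And>j. d (Suc j) \<le> d j" and r: "r \<ge> 0" "r * d 0 \<le> 1"
  shows "r * F (Suc M) * d M \<le> F 0 + (\<Sum>j<Suc M. r * (F (Suc j) - F j) * d j)"
proof (induction M)
  case 0
  have "F 0 * (r * d 0) \<le> F 0 * 1" using F r by (intro mult_left_mono)
  then show ?case by (simp add: algebra_simps)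
next
  case (Suc M)
  have "r * F (Suc M) * d (Suc M) \<le> r * F (Suc M) * d M" using F d r by (intro mult_left_mono) auto
  then show ?case using Suc by (simp add: algebra_simps)
qed

text \<open>After Abel summation the increments of \<open>s\<close> multiply nonnegative values of
  \<open>e\<close>, and since \<open>e 0 = 0\<close> only the boundary term at the right end can be
  negative.\<close>

lemma summation_by_parts_lower:
  fixes s e :: "nat \<Rightarrow> real"
  assumes s: "\<And>j. s j \<le> s (Suc j)" and e: "\<And>j. e j \<ge> 0" "e 0 = 0"
  shows "- s M * e (Suc M) \<le> (\<Sum>j<Suc M. s j * (e j - e (Suc j)))"
proof (induction M)
  case 0 show ?case using e by simp
next
  case (Suc M)
  have "s M * e (Suc M) \<le> s (Suc M) * e (Suc M)" using e s by (intro mult_right_mono)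
  then show ?case using Suc by (simp add: algebra_simps)
qed

text \<open>The weights of the grid measure are n times the second differences of \<open>C\<close>,
  nonnegative by convexity. The mass at 0 is nonnegative because \<open>C\<close> lies above x0 - k,
  and the last one because \<open>C\<close> decreases.\<close>

lemma grid_integral_nonneg:
  assumes C: "call_like x0 C" and n: "n \<ge> 1" and f: "\<And>x. x \<ge> 0 \<Longrightarrow> f x \<ge> 0"
  shows "grid_integral C n f \<ge> 0"
proof -
  define F where "F j = f (real j / real n)" for j
  define d where "d j = C (real j / real n) - C (real (Suc j) / real n)" for j
  have d_mono: "d (Suc j) \<le> d j" for j
  proof -
    have "2 * C (real j / real n + 1 / real n) \<le> C (real j / real n) + C (real j / real n + 2 * (1 / real n))"
      by (rule call_likeD(5)[OF C]) auto
    moreover have "real j / real n + 1 / real n = real (Suc j) / real n"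
      "real j / real n + 2 * (1 / real n) = real (Suc (Suc j)) / real n"
      using n by (simp_all add: field_simps)
    ultimately show ?thesis unfolding d_def by simp
  qed
  have d_nonneg: "d j \<ge> 0" for j
  proof -
    have "real j / real n \<le> real (Suc j) / real n" by (intro divide_right_mono) auto
    then show ?thesis using call_likeD(4)[OF C, of "real j / real n"] unfolding d_def by simp
  qed
  have "x0 - 1 / real n \<le> C (1 / real n)" "C 0 = x0" using call_likeD(1,3)[OF C] by auto
  then have "real n * d 0 \<le> real n * (1 / real n)" unfolding d_def by (intro mult_left_mono) auto
  then have d0: "real n * d 0 \<le> 1" using n by simp
  have Fn: "F j \<ge> 0" for j unfolding F_def by (rule f) simp
  obtain M where M: "n * n = Suc M" using n by (cases "n * n") auto
  have "0 \<le> real n * F (Suc M) * d M" using Fn d_nonneg by simp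
  also have "\<dots> \<le> F 0 + (\<Sum>j<Suc M. real n * (F (Suc j) - F j) * d j)"
    by (rule summation_by_parts_nonneg[OF Fn d_mono _ d0]) simp
  also have "\<dots> = grid_integral C n f"
    unfolding grid_integral_def grid_slope_def M F_def d_def by simp
  finally show ?thesis .
qed

text \<open>Convexity makes a chord slope persist to the right, so a slope above \<open>K\<close>
  would eventually carry the function beyond K (1 + x).\<close>

lemma convex_slope_bound:
  assumes f: "convex_on {0..} f" and K: "\<And>x. x \<ge> 0 \<Longrightarrow> \<bar>f x\<bar> \<le> K * (1 + x)" and ab: "0 \<le> a" "a < b"
  shows "(f b - f a) / (b - a) \<le> K"
proof (rule ccontr)
  define s where "s = (f b - f a) / (b - a)"
  assume "\<not> ?thesis"
  then have s: "s > K" unfolding s_def by simp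
  \<comment> \<open>The abscissa at which the line of slope s through (a, f a) meets K (1 +
    x).\<close>
  define q where "q = (K - f a + s * a) / (s - K)"
  define x where "x = b + 1 + \<bar>q\<bar>"
  have x: "x > b" unfolding x_def by simp
  have "q < x" unfolding x_def using ab by linarith
  then have big: "K - f a + s * a < (s - K) * x" using s unfolding q_def by (simp add: pos_divide_less_eq mult.commute)
  define t where "t = (b - a) / (x - a)"
  have "(1 - t) * a + t * x = a + t * (x - a)" by (simp add: algebra_simps)
  also have "\<dots> = b" using ab x by (simp add: t_def)
  finally have t: "0 \<le> t" "t \<le> 1" "(1 - t) * a + t * x = b" using ab x by (auto simp: t_def)
  have "f ((1 - t) *\<^sub>R a + t *\<^sub>R x) \<le> (1 - t) * f a + t * f x"
    using f t ab x by (intro convex_onD) auto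
  then have "f b - f a \<le> t * (f x - f a)" using t(3) by (simp add: algebra_simps)
  then have "s \<le> (f x - f a) / (x - a)" using ab x unfolding s_def t_def by (simp add: field_simps)
  then have "f a + s * (x - a) \<le> f x" using ab x by (simp add: field_simps)
  moreover have "f x \<le> K * (1 + x)" using K[of x] ab x by simp
  ultimately show False using big by (simp add: algebra_simps)
qed

text \<open>Monotonicity in convex order at the level of the grid: the slopes of a convex function
  increase, so Abel summation against C' - C leaves only the boundary term at strike n, and there
  the slope is at most \<open>K\<close>.\<close>

lemma grid_integral_mono:
  assumes C: "call_like x0 C" and C': "call_like x0 C'" and le: "\<And>k. k \<ge> 0 \<Longrightarrow> C k \<le> C' k"
    and n: "n \<ge> 1" and f: "convex_on {0..} f" and K: "\<And>x. x \<ge> 0 \<Longrightarrow> \<bar>f x\<bar> \<le> K * (1 + x)"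
  shows "grid_integral C n f \<le> grid_integral C' n f + K * C' (real n)"
proof -
  define e where "e j = C' (real j / real n) - C (real j / real n)" for j
  have slope: "grid_slope n f j \<le> K" for j
  proof -
    have "(f (real (Suc j) / real n) - f (real j / real n)) / (real (Suc j) / real n - real j / real n) \<le> K"
      using n by (intro convex_slope_bound[OF f K]) (auto simp: divide_strict_right_mono)
    moreover have "real (Suc j) / real n - real j / real n = 1 / real n" by (simp add: diff_divide_distrib[symmetric])
    ultimately show ?thesis by (simp add: grid_slope_def mult.commute)
  qed
  have slope_mono: "grid_slope n f j \<le> grid_slope n f (Suc j)" for j
  proof -
    have "f ((1 - 1/2) *\<^sub>R (real j / real n) + (1/2) *\<^sub>R (real (Suc (Suc j)) / real n))
        \<le> (1 - 1/2) * f (real j / real n) + (1/2) * f (real (Suc (Suc j)) / real n)"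
      by (rule convex_onD[OF f]) auto
    moreover have "(1 - 1/2) *\<^sub>R (real j / real n) + (1/2) *\<^sub>R (real (Suc (Suc j)) / real n) = real (Suc j) / real n"
      using n by (simp add: field_simps)
    ultimately have "f (real (Suc j) / real n) - f (real j / real n) \<le> f (real (Suc (Suc j)) / real n) - f (real (Suc j) / real n)"
      by simp
    then show ?thesis unfolding grid_slope_def by (intro mult_left_mono) auto
  qed
  have e: "e j \<ge> 0" for j unfolding e_def using le[of "real j / real n"] by simp
  have e0: "e 0 = 0" using call_likeD(1)[OF C] call_likeD(1)[OF C'] unfolding e_def by simp
  obtain M where M: "n * n = Suc M" using n by (cases "n * n") auto
  have eM: "e (Suc M) \<le> C' (real n)"
  proof -
    have "real (Suc M) / real n = real n" unfolding M[symmetric] using n by simp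
    then show ?thesis unfolding e_def using call_likeD(2)[OF C, of "real n"] by simp
  qed
  have K0: "K \<ge> 0" using K[of 0] by simp
  have "grid_slope n f M * e (Suc M) \<le> K * C' (real n)"
    using slope[of M] e[of "Suc M"] eM K0 by (meson mult_left_mono mult_right_mono order_trans)
  moreover have "- grid_slope n f M * e (Suc M) \<le> (\<Sum>j<Suc M. grid_slope n f j * (e j - e (Suc j)))"
    by (rule summation_by_parts_lower[of "grid_slope n f" e M, OF slope_mono e e0])
  moreover have "(\<Sum>j<Suc M. grid_slope n f j * (e j - e (Suc j))) = grid_integral C' n f - grid_integral C n f"
    unfolding grid_integral_def M[symmetric] e_def by (simp add: sum_subtractf[symmetric] algebra_simps)
  ultimately show ?thesis by simp
qed

text \<open>The piecewise linear interpolation of \<open>f\<close> at the grid points, constant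
  beyond n. It is written as a portfolio of call spreads, so that integrating term by term yields
  \<open>grid_integral\<close> of the call prices.\<close>

definition grid_interpolation :: "nat \<Rightarrow> (real \<Rightarrow> real) \<Rightarrow> real \<Rightarrow> real" where
  "grid_interpolation n f x = f 0 +
     (\<Sum>j<n * n. grid_slope n f j * (max 0 (x - real j / real n) - max 0 (x - real (Suc j) / real n)))"

text \<open>Between neighbouring grid points the interpolation is a convex combination of two
  values; this form serves both the growth bound and the convergence.\<close>

lemma grid_interpolation_eq:
  assumes n: "n \<ge> 1" and x: "x \<ge> 0"
  obtains y z t where "0 \<le> t" "t \<le> 1" "0 \<le> y" "0 \<le> z" "grid_interpolation n f x = (1 - t) * f y + t * f z"
    "(1 - t) * y + t * z = min x (real n)" "\<bar>y - min x (real n)\<bar> \<le> 1 / real n" "\<bar>z - min x (real n)\<bar> \<le> 1 / real n"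
proof -
  let ?c = "\<lambda>j. max 0 (x - real j / real n) - max 0 (x - real (Suc j) / real n)"
  \<comment> \<open>Spreads lying entirely below x pay their full width, so the sum
    telescopes.\<close>
  have full: "(\<Sum>j<m. grid_slope n f j * ?c j) = f (real m / real n) - f 0" if "real m / real n \<le> x" for m
    using that
  proof (induction m)
    case (Suc m)
    have "real m / real n \<le> real (Suc m) / real n" by (intro divide_right_mono) auto
    then have "?c m = real (Suc m) / real n - real m / real n" using Suc.prems by simp
    also have "\<dots> = 1 / real n" by (simp add: diff_divide_distrib[symmetric])
    finally have "grid_slope n f m * ?c m = f (real (Suc m) / real n) - f (real m / real n)"
      using n by (simp add: grid_slope_def)
    moreover have "real m / real n \<le> x" using \<open>real m / real n \<le> real (Suc m) / real n\<close> Suc.prems by simp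
    ultimately show ?case using Suc.IH by simp
  qed simp
  show thesis
  proof (cases "x \<ge> real n")
    case True
    have nn: "real (n * n) / real n = real n" using n by simp
    have "grid_interpolation n f x = f (real n)"
      unfolding grid_interpolation_def using full[of "n * n"] nn True by simp
    then show thesis using True by (intro that[of 0 "real n" "real n"]) auto
  next
    case False
    define m where "m = nat \<lfloor>real n * x\<rfloor>"
    have "real m = of_int \<lfloor>real n * x\<rfloor>" unfolding m_def using x n by simp
    then have m: "real m \<le> real n * x" "real n * x < real m + 1" by linarith+
    have "real n * x < real n * real n" using False n by simp
    then have "real m < real (n * n)" using m by simp
    then have mn: "m < n * n" by (simp only: of_nat_less_iff)
    have le: "real m / real n \<le> x" "x \<le> real (Suc m) / real n" using m n by (auto simp: field_simps)
    have "(\<Sum>j<n * n. grid_slope n f j * ?c j) = (\<Sum>j<Suc m. grid_slope n f j * ?c j)"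
    proof (rule sum.mono_neutral_right)
      show "\<forall>j\<in>{..<n * n} - {..<Suc m}. grid_slope n f j * ?c j = 0"
      proof
        fix j assume "j \<in> {..<n * n} - {..<Suc m}"
        then have "real (Suc m) / real n \<le> real j / real n" "real j / real n \<le> real (Suc j) / real n"
          by (auto intro!: divide_right_mono)
        then show "grid_slope n f j * ?c j = 0" using le by simp
      qed
    qed (use mn in auto)
    also have "\<dots> = f (real m / real n) - f 0 + grid_slope n f m * (x - real m / real n)"
      using full[OF le(1)] le by simp
    finally have eq: "grid_interpolation n f x = f (real m / real n) + grid_slope n f m * (x - real m / real n)"
      unfolding grid_interpolation_def by simp
    define t where "t = real n * x - real m"
    define y where "y = real m / real n"
    define z where "z = real (Suc m) / real n"
    have z: "z = y + 1 / real n" by (simp add: y_def z_def add_divide_distrib)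
    have t: "0 \<le> t" "t \<le> 1" using m by (auto simp: t_def)
    have nt: "real n * (x - y) = t" using n by (simp add: t_def y_def algebra_simps)
    have "grid_slope n f m * (x - y) = t * (f z - f y)"
      unfolding grid_slope_def y_def[symmetric] z_def[symmetric] nt[symmetric] by simp
    then have interp: "grid_interpolation n f x = (1 - t) * f y + t * f z"
      unfolding eq y_def[symmetric] by (simp add: algebra_simps)
    have "(1 - t) * y + t * z = y + t / real n" unfolding z by (simp add: algebra_simps)
    also have "\<dots> = x" using n unfolding nt[symmetric] by simp
    finally have comb: "(1 - t) * y + t * z = x" .
    have y0: "0 \<le> y" "0 \<le> z" by (auto simp: y_def z_def)
    have "y \<le> x" "x \<le> z" using le by (auto simp: y_def z_def)
    then show thesis using False interp comb t y0 z
      by (intro that[of t y z]) auto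
  qed
qed

lemma grid_interpolation_bound:
  assumes n: "n \<ge> 1" and x: "x \<ge> 0" and K: "\<And>x. x \<ge> 0 \<Longrightarrow> \<bar>f x\<bar> \<le> K * (1 + x)"
  shows "\<bar>grid_interpolation n f x\<bar> \<le> K * (1 + x)"
proof -
  obtain y z t where t: "0 \<le> t" "t \<le> 1" "0 \<le> y" "0 \<le> z" "grid_interpolation n f x = (1 - t) * f y + t * f z"
    "(1 - t) * y + t * z = min x (real n)"
    using grid_interpolation_eq[OF n x, of f] by metis
  have K0: "K \<ge> 0" using K[of 0] by simp
  have "\<bar>(1 - t) * f y + t * f z\<bar> \<le> (1 - t) * \<bar>f y\<bar> + t * \<bar>f z\<bar>"
    using abs_triangle_ineq[of "(1 - t) * f y" "t * f z"] t by (simp add: abs_mult)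
  also have "\<dots> \<le> (1 - t) * (K * (1 + y)) + t * (K * (1 + z))"
    using t by (intro add_mono mult_left_mono K) auto
  also have "\<dots> = K * (1 + ((1 - t) * y + t * z))" by (simp add: algebra_simps)
  also have "\<dots> \<le> K * (1 + x)" using t(6) K0 by (intro mult_left_mono) auto
  finally show ?thesis using t(5) by simp
qed

lemma grid_interpolation_tendsto:
  assumes f: "continuous_on {0..} f" and x: "x \<ge> 0"
  shows "(\<lambda>n. grid_interpolation n f x) \<longlonglongrightarrow> f x"
proof (rule tendstoI)
  fix e :: real assume e: "e > 0"
  obtain d where d: "d > 0" "\<And>y. y \<ge> 0 \<Longrightarrow> \<bar>y - x\<bar> < d \<Longrightarrow> \<bar>f y - f x\<bar> < e"
    using f x e unfolding continuous_on_iff by (force simp: dist_real_def)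
  \<comment> \<open>Beyond \<open>n1\<close> the point x lies below the truncation at n and the mesh
    is finer than d.\<close>
  obtain n1 where n1: "real n1 > max x (1 / d)" using reals_Archimedean2 by blast
  have "\<forall>n\<ge>max 1 n1. dist (grid_interpolation n f x) (f x) < e"
  proof (intro allI impI)
    fix n assume n: "n \<ge> max 1 n1"
    then have rn: "real n > max x (1 / d)" using n1 by linarith
    obtain y z t where t: "0 \<le> t" "t \<le> 1" "0 \<le> y" "0 \<le> z" "grid_interpolation n f x = (1 - t) * f y + t * f z"
      "\<bar>y - min x (real n)\<bar> \<le> 1 / real n" "\<bar>z - min x (real n)\<bar> \<le> 1 / real n"
      using grid_interpolation_eq[of n x f] n x by (metis max.bounded_iff)
    have "real n > 0" using rn x by simp
    then have "1 / real n < d" using rn d(1) by (simp add: field_simps)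
    then have yz: "\<bar>f y - f x\<bar> < e" "\<bar>f z - f x\<bar> < e" using t rn by (auto intro!: d(2))
    have "(1 - t) * f y + t * f z - f x = (1 - t) * (f y - f x) + t * (f z - f x)" by (simp add: algebra_simps)
    also have "\<bar>\<dots>\<bar> \<le> (1 - t) * \<bar>f y - f x\<bar> + t * \<bar>f z - f x\<bar>"
      using abs_triangle_ineq[of "(1 - t) * (f y - f x)" "t * (f z - f x)"] t by (simp add: abs_mult)
    also have "\<dots> < e"
    proof (cases "t = 0")
      case False
      then have "t * \<bar>f z - f x\<bar> < t * e" using t yz by simp
      moreover have "(1 - t) * \<bar>f y - f x\<bar> \<le> (1 - t) * e" using t yz by (intro mult_left_mono) auto
      ultimately show ?thesis by (simp add: algebra_simps)
    qed (use yz in simp)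
    finally show "dist (grid_interpolation n f x) (f x) < e" using t(5) by (simp add: dist_real_def)
  qed
  then show "\<forall>\<^sub>F n in sequentially. dist (grid_interpolation n f x) (f x) < e" 
    unfolding eventually_sequentially by blast
qed

section \<open>Call prices of a measure and convergence of their grid integrals\<close>

definition call_price :: "real measure \<Rightarrow> real \<Rightarrow> real" where
  "call_price \<mu> k = (\<integral>x. max 0 (x - k) \<partial>\<mu>)"

context
  fixes \<mu> :: "real measure"
  assumes mu: "\<mu> \<in> prob_first_moment"
begin

lemma call_price_call_like: "call_like (barycenter \<mu>) (call_price \<mu>)"
proof -
  interpret prob_space \<mu> by (rule prob_first_momentD[OF mu])
  note sp = prob_first_momentD(4)[OF mu]
  have int: "integrable \<mu> (\<lambda>x. max 0 (x - k))" if "k \<ge> 0" for k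
    by (rule integrable_CVX_L[OF mu CVX_L_call[OF that]])
  note int_id = prob_first_momentD(3)[OF mu]
  show ?thesis
    unfolding call_like_def
  proof (intro conjI allI impI)
    show "call_price \<mu> 0 = barycenter \<mu>"
      unfolding call_price_def barycenter_def by (intro Bochner_Integration.integral_cong) (auto simp: sp)
    fix k :: real assume k: "k \<ge> 0"
    show "0 \<le> call_price \<mu> k" unfolding call_price_def by (intro integral_nonneg_AE) auto
    have "(\<integral>x. x - k \<partial>\<mu>) \<le> call_price \<mu> k"
      unfolding call_price_def using k int_id by (intro integral_mono int) auto
    then show "barycenter \<mu> - k \<le> call_price \<mu> k"
      unfolding barycenter_def using int_id by (simp add: prob_space)
    show "call_price \<mu> l \<le> call_price \<mu> k" if "l \<ge> k" for l
      unfolding call_price_def using that k by (intro integral_mono int) auto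
    show "2 * call_price \<mu> (k + d) \<le> call_price \<mu> k + call_price \<mu> (k + 2 * d)" if "d \<ge> 0" for d
    proof -
      have "(\<integral>x. 2 * max 0 (x - (k + d)) \<partial>\<mu>) \<le> (\<integral>x. max 0 (x - k) + max 0 (x - (k + 2 * d)) \<partial>\<mu>)"
        using k that by (intro integral_mono integrable_mult_right Bochner_Integration.integrable_add int) (auto simp: max_def)
      then show ?thesis unfolding call_price_def using k that int by (simp add: int)
    qed
  qed
qed

lemma call_price_tendsto_0: "(\<lambda>n. call_price \<mu> (real n)) \<longlonglongrightarrow> 0"
proof -
  have "(\<lambda>n. \<integral>x. max 0 (x - real n) \<partial>\<mu>) \<longlonglongrightarrow> (\<integral>x. 0 \<partial>\<mu>)"
  proof (rule integral_dominated_convergence[where w = "\<lambda>x. x"])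
    show "integrable \<mu> (\<lambda>x. x)" by (rule prob_first_momentD[OF mu])
    show "(\<lambda>x. max 0 (x - real n)) \<in> borel_measurable \<mu>" for n
      by (rule measurable_prob_first_moment[OF mu borel_measurable_call])
    show "AE x in \<mu>. (\<lambda>n. max 0 (x - real n)) \<longlonglongrightarrow> 0"
    proof (intro AE_I2)
      fix x :: real
      obtain m where m: "x < real m" using reals_Archimedean2 by blast
      show "(\<lambda>n. max 0 (x - real n)) \<longlonglongrightarrow> 0"
        by (rule tendsto_eventually) (use m in \<open>auto simp: eventually_sequentially intro!: exI[of _ m]\<close>)
    qed
    show "AE x in \<mu>. norm (max 0 (x - real n)) \<le> x" for n
      by (intro AE_I2) (auto simp: prob_first_momentD[OF mu])
  qed simp
  then show ?thesis by (simp add: call_price_def)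
qed

lemma grid_integral_call_price:
  "grid_integral (call_price \<mu>) n f = (\<integral>x. grid_interpolation n f x \<partial>\<mu>)"
proof -
  interpret prob_space \<mu> by (rule prob_first_momentD[OF mu])
  have int: "integrable \<mu> (\<lambda>x. max 0 (x - k))" if "k \<ge> 0" for k
    by (rule integrable_CVX_L[OF mu CVX_L_call[OF that]])
  show ?thesis
    unfolding grid_integral_def grid_interpolation_def call_price_def
    by (simp add: int prob_space)
qed

text \<open>The interpolations converge pointwise under the growth bound they share with
  \<open>f\<close>; the index is shifted by one because the grid with n = 0 is degenerate.\<close>

lemma grid_integral_tendsto:
  assumes f: "continuous_on {0..} f" and K: "\<And>x. x \<ge> 0 \<Longrightarrow> \<bar>f x\<bar> \<le> K * (1 + x)"
  shows "(\<lambda>n. grid_integral (call_price \<mu>) n f) \<longlonglongrightarrow> (\<integral>x. f x \<partial>\<mu>)"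
proof -
  interpret prob_space \<mu> by (rule prob_first_momentD[OF mu])
  note sp = prob_first_momentD(4)[OF mu]
  have "(\<lambda>n. \<integral>x. grid_interpolation (Suc n) f x \<partial>\<mu>) \<longlonglongrightarrow> (\<integral>x. f x \<partial>\<mu>)"
  proof (rule integral_dominated_convergence[where w = "\<lambda>x. K * (1 + x)"])
    show "f \<in> borel_measurable \<mu>"
      by (rule measurable_prob_first_moment[OF mu borel_measurable_borel_Rp[OF f]])
    show "grid_interpolation (Suc n) f \<in> borel_measurable \<mu>" for n
      unfolding grid_interpolation_def[abs_def]
      by (intro borel_measurable_add borel_measurable_sum borel_measurable_times borel_measurable_diff
          borel_measurable_const measurable_prob_first_moment[OF mu borel_measurable_call])
    show "integrable \<mu> (\<lambda>x. K * (1 + x))"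
      using prob_first_momentD(3)[OF mu] by (intro integrable_mult_right Bochner_Integration.integrable_add) auto
    show "AE x in \<mu>. (\<lambda>n. grid_interpolation (Suc n) f x) \<longlonglongrightarrow> f x"
      by (intro AE_I2 LIMSEQ_Suc grid_interpolation_tendsto f) (simp add: sp)
    show "AE x in \<mu>. norm (grid_interpolation (Suc n) f x) \<le> K * (1 + x)" for n
      using grid_interpolation_bound[OF _ _ K, of "Suc n"] by (intro AE_I2) (simp add: sp)
  qed
  then show ?thesis unfolding grid_integral_call_price by (rule LIMSEQ_imp_Suc)
qed

end

section \<open>Affine minorants\<close>

text \<open>The closed convex envelope on the half-line. Affine minorants are the form in which a
  hedging inequality, read as a function of the last price, presents itself.\<close>

definition affine_envelope :: "(real \<Rightarrow> real) \<Rightarrow> real \<Rightarrow> real" where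
  "affine_envelope G y = Sup {a + b * y | a b. \<forall>z\<ge>0. a + b * z \<le> G z}"

context
  fixes G :: "real \<Rightarrow> real" and K :: real
  assumes K: "\<And>x. x \<ge> 0 \<Longrightarrow> \<bar>G x\<bar> \<le> K * (1 + x)"
begin

lemma affine_envelope_upper:
  assumes "y \<ge> 0" "\<And>z. z \<ge> 0 \<Longrightarrow> a + b * z \<le> G z"
  shows "a + b * y \<le> affine_envelope G y"
  unfolding affine_envelope_def using assms by (intro cSup_upper bdd_aboveI[where M = "G y"]) auto

lemma affine_minorant: "z \<ge> 0 \<Longrightarrow> - K + (- K) * z \<le> G z"
  using K[of z] by (simp add: algebra_simps abs_le_iff)

lemma affine_envelope_nonempty: "{a + b * y | a b. \<forall>z\<ge>0. a + b * z \<le> G z} \<noteq> {}"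
  using affine_minorant by blast

lemma affine_envelope_least:
  assumes "\<And>a b. (\<And>z. z \<ge> 0 \<Longrightarrow> a + b * z \<le> G z) \<Longrightarrow> a + b * y \<le> c"
  shows "affine_envelope G y \<le> c"
  unfolding affine_envelope_def using assms by (intro cSup_least affine_envelope_nonempty) auto

lemma affine_envelope_le: "y \<ge> 0 \<Longrightarrow> affine_envelope G y \<le> G y"
  by (rule affine_envelope_least) auto

lemma affine_envelope_growth: "y \<ge> 0 \<Longrightarrow> \<bar>affine_envelope G y\<bar> \<le> K * (1 + y)"
  using affine_envelope_upper[of y "- K" "- K", OF _ affine_minorant] affine_envelope_le[of y] K[of y]
  by (simp add: algebra_simps abs_le_iff)

lemma affine_envelope_convex: "convex_on {0..} (affine_envelope G)"
proof (rule convex_onI)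
  fix t x y :: real assume t: "0 < t" "t < 1" and xy: "x \<in> {0..}" "y \<in> {0..}"
  show "affine_envelope G ((1 - t) *\<^sub>R x + t *\<^sub>R y) \<le> (1 - t) * affine_envelope G x + t * affine_envelope G y"
  proof (rule affine_envelope_least)
    fix a b assume ab: "\<And>z. z \<ge> 0 \<Longrightarrow> a + b * z \<le> G z"
    have "a + b * ((1 - t) *\<^sub>R x + t *\<^sub>R y) = (1 - t) * (a + b * x) + t * (a + b * y)" by (simp add: algebra_simps)
    also have "\<dots> \<le> (1 - t) * affine_envelope G x + t * affine_envelope G y"
      using t xy ab by (intro add_mono mult_left_mono affine_envelope_upper) auto
    finally show "a + b * ((1 - t) *\<^sub>R x + t *\<^sub>R y) \<le> (1 - t) * affine_envelope G x + t * affine_envelope G y" .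
  qed
qed simp

end

section \<open>Semi-static hedges of zero\<close>

text \<open>With the past fixed, the hedging inequality places an affine function of the last price
  below the last payoff, so the envelope dominates the value of that function at the preceding
  price. On the cost side the envelope, being convex, is cheaper at the earlier date up to a
  vanishing boundary term, and it lies below the payoff it replaces.\<close>

lemma grid_hedge_bound:
  fixes g :: "nat \<Rightarrow> real \<Rightarrow> real" and \<Delta> :: "nat \<Rightarrow> (nat \<Rightarrow> real) \<Rightarrow> real"
  assumes N: "N \<ge> 1"
    and g: "\<And>i. i \<in> {1..N} \<Longrightarrow> \<exists>K. \<forall>x\<ge>0. \<bar>g i x\<bar> \<le> K * (1 + x)"
    and C: "\<And>i. i \<in> {1..N} \<Longrightarrow> call_like x0 (C i)"
    and C_mono: "\<And>i k. i \<in> {1..<N} \<Longrightarrow> k \<ge> 0 \<Longrightarrow> C i k \<le> C (Suc i) k"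
    and C_lim: "\<And>i. i \<in> {1..N} \<Longrightarrow> (\<lambda>n. C i (real n)) \<longlonglongrightarrow> 0"
    and hedge: "\<And>x. (\<And>i. i \<in> {1..N} \<Longrightarrow> x i \<ge> 0) \<Longrightarrow>
      0 \<le> (\<Sum>i\<in>{1..N}. g i (x i)) + (\<Sum>i\<in>{1..<N}. \<Delta> i (restrict x {1..i}) * (x (i + 1) - x i))"
  shows "\<exists>e. e \<longlonglongrightarrow> 0 \<and> (\<forall>n\<ge>1. - e n \<le> (\<Sum>i\<in>{1..N}. grid_integral (C i) n (g i)))"
  using assms
proof (induction N arbitrary: g rule: nat_induct_at_least)
  case base
  have "0 \<le> g 1 z" if "z \<ge> 0" for z using base.prems(5)[of "\<lambda>_. z"] that by simp
  then have "0 \<le> grid_integral (C 1) n (g 1)" if "n \<ge> 1" for n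
    using grid_integral_nonneg[OF base.prems(2)[of 1] that] by simp
  then show ?case by (intro exI[of _ "\<lambda>_. 0"]) simp
next
  case (Suc N)
  note IH = Suc.IH and gK = Suc.prems(1) and C = Suc.prems(2) and C_mono = Suc.prems(3)
    and C_lim = Suc.prems(4) and hedge = Suc.prems(5)
  obtain K where K: "\<And>x. x \<ge> 0 \<Longrightarrow> \<bar>g (Suc N) x\<bar> \<le> K * (1 + x)" using gK[of "Suc N"] by auto
  define f where "f = affine_envelope (g (Suc N))"
  define g' where "g' = g(N := (\<lambda>x. g N x + f x))"
  have f_le: "f y \<le> g (Suc N) y" if "y \<ge> 0" for y
    unfolding f_def by (rule affine_envelope_le) (use K that in auto)
  have f_growth: "\<bar>f y\<bar> \<le> K * (1 + y)" if "y \<ge> 0" for y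
    unfolding f_def by (rule affine_envelope_growth) (use K that in auto)
  have f_convex: "convex_on {0..} f"
    unfolding f_def by (rule affine_envelope_convex) (use K in auto)
  have f_upper: "a + b * y \<le> f y" if "y \<ge> 0" "\<And>z. z \<ge> 0 \<Longrightarrow> a + b * z \<le> g (Suc N) z" for a b y
    unfolding f_def by (rule affine_envelope_upper) (use K that in auto)
  have split: "(\<Sum>i\<in>{1..N}. q i) = (\<Sum>i\<in>{1..<N}. q i) + q N" for q :: "nat \<Rightarrow> real"
    using Suc.hyps by (cases N) (auto simp: atLeastLessThanSuc_atLeastAtMost)
  have "\<exists>e. e \<longlonglongrightarrow> 0 \<and> (\<forall>n\<ge>1. - e n \<le> (\<Sum>i\<in>{1..N}. grid_integral (C i) n (g' i)))"
  proof (rule IH)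
    fix i assume i: "i \<in> {1..N}"
    show "\<exists>K. \<forall>x\<ge>0. \<bar>g' i x\<bar> \<le> K * (1 + x)"
    proof (cases "i = N")
      case True
      obtain K' where K': "\<And>x. x \<ge> 0 \<Longrightarrow> \<bar>g N x\<bar> \<le> K' * (1 + x)" using gK[of N] Suc.hyps by auto
      have "\<bar>g N x + f x\<bar> \<le> (K' + K) * (1 + x)" if "x \<ge> 0" for x
        unfolding distrib_right using K'[OF that] f_growth[OF that] by linarith
      then show ?thesis unfolding g'_def True by auto
    qed (use gK i in \<open>auto simp: g'_def\<close>)
  next
    fix x :: "nat \<Rightarrow> real" assume x: "\<And>i. i \<in> {1..N} \<Longrightarrow> x i \<ge> 0"
    define R where "R = (\<Sum>i\<in>{1..N}. g i (x i)) + (\<Sum>i\<in>{1..<N}. \<Delta> i (restrict x {1..i}) * (x (i + 1) - x i))"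
    define D where "D = \<Delta> N (restrict x {1..N})"
    have "(- R + D * x N) + (- D) * z \<le> g (Suc N) z" if z: "z \<ge> 0" for z
    proof -
      \<comment> \<open>Positions up to date N see only prices up to that date, so a new last price
        affects just the last payoff and the last gain.\<close>
      let ?x = "x(Suc N := z)"
      have "0 \<le> (\<Sum>i\<in>{1..Suc N}. g i (?x i)) + (\<Sum>i\<in>{1..<Suc N}. \<Delta> i (restrict ?x {1..i}) * (?x (i + 1) - ?x i))"
        using x z by (intro hedge) auto
      also have "(\<Sum>i\<in>{1..Suc N}. g i (?x i)) = (\<Sum>i\<in>{1..N}. g i (x i)) + g (Suc N) z"
        by (simp add: atLeastAtMostSuc_conv)
      also have "(\<Sum>i\<in>{1..<Suc N}. \<Delta> i (restrict ?x {1..i}) * (?x (i + 1) - ?x i))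
          = (\<Sum>i\<in>{1..<N}. \<Delta> i (restrict x {1..i}) * (x (i + 1) - x i)) + D * (z - x N)"
      proof -
        have r: "restrict ?x {1..i} = restrict x {1..i}" if "i \<le> N" for i using that by (auto simp: restrict_def)
        have "(\<Sum>i\<in>{1..<N}. \<Delta> i (restrict ?x {1..i}) * (?x (i + 1) - ?x i))
            = (\<Sum>i\<in>{1..<N}. \<Delta> i (restrict x {1..i}) * (x (i + 1) - x i))"
          by (intro sum.cong refl) (auto simp: r)
        then show ?thesis
          unfolding atLeastLessThanSuc_atLeastAtMost split by (simp add: r D_def)
      qed
      finally show ?thesis unfolding R_def by (simp add: algebra_simps)
    qed
    \<comment> \<open>At z = x N the last trading gain vanishes, and with it the unknown position
      D.\<close>
    then have "(- R + D * x N) + (- D) * x N \<le> f (x N)" using x[of N] Suc.hyps by (intro f_upper) auto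
    then have "0 \<le> R + f (x N)" by simp
    also have "R + f (x N) = (\<Sum>i\<in>{1..N}. g' i (x i)) + (\<Sum>i\<in>{1..<N}. \<Delta> i (restrict x {1..i}) * (x (i + 1) - x i))"
    proof -
      have "(\<Sum>i\<in>{1..<N}. g' i (x i)) = (\<Sum>i\<in>{1..<N}. g i (x i))" by (intro sum.cong) (auto simp: g'_def)
      then show ?thesis unfolding R_def split by (simp add: g'_def)
    qed
    finally show "0 \<le> (\<Sum>i\<in>{1..N}. g' i (x i)) + (\<Sum>i\<in>{1..<N}. \<Delta> i (restrict x {1..i}) * (x (i + 1) - x i))" .
  qed (use C C_mono C_lim in auto)
  then obtain e where e: "e \<longlonglongrightarrow> 0" "\<And>n. n \<ge> 1 \<Longrightarrow> - e n \<le> (\<Sum>i\<in>{1..N}. grid_integral (C i) n (g' i))" by blast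
  \<comment> \<open>Moving the envelope from date N to N + 1 costs one more boundary term, which
    joins the error.\<close>
  have "- (e n + K * C (Suc N) (real n)) \<le> (\<Sum>i\<in>{1..Suc N}. grid_integral (C i) n (g i))" if n: "n \<ge> 1" for n
  proof -
    have "(\<Sum>i\<in>{1..N}. grid_integral (C i) n (g' i)) = (\<Sum>i\<in>{1..N}. grid_integral (C i) n (g i)) + grid_integral (C N) n f"
    proof -
      have "(\<Sum>i\<in>{1..<N}. grid_integral (C i) n (g' i)) = (\<Sum>i\<in>{1..<N}. grid_integral (C i) n (g i))"
        by (intro sum.cong) (auto simp: g'_def)
      then show ?thesis unfolding split by (simp add: g'_def grid_integral_add)
    qed
    moreover have "grid_integral (C N) n f \<le> grid_integral (C (Suc N)) n f + K * C (Suc N) (real n)"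
      using C C_mono Suc.hyps by (intro grid_integral_mono[OF _ _ _ n f_convex f_growth]) auto
    moreover have "0 \<le> grid_integral (C (Suc N)) n (\<lambda>x. g (Suc N) x - f x)"
      using f_le by (intro grid_integral_nonneg[OF C n]) auto
    ultimately show ?thesis using e(2)[OF n] unfolding grid_integral_diff by (simp add: atLeastAtMostSuc_conv)
  qed
  moreover have "(\<lambda>n. e n + K * C (Suc N) (real n)) \<longlonglongrightarrow> 0 + K * 0"
    by (intro tendsto_add tendsto_mult_left e C_lim) simp
  ultimately show ?case by (intro exI[of _ "\<lambda>n. e n + K * C (Suc N) (real n)"]) simp
qed

text \<open>Monotonicity and convexity bound a maximum from above; they are checked at an index
  attaining it and then relaxed on the larger side.\<close>

lemma call_like_Max:
  assumes "finite I" "I \<noteq> {}" "\<And>i. i \<in> I \<Longrightarrow> call_like x0 (C i)"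
  shows "call_like x0 (\<lambda>k. Max ((\<lambda>i. C i k) ` I))"
proof -
  have ge: "C i k \<le> Max ((\<lambda>i. C i k) ` I)" if "i \<in> I" for i k using assms that by (intro Max_ge) auto
  have ex: "\<exists>i\<in>I. Max ((\<lambda>i. C i k) ` I) = C i k" for k
  proof -
    have "Max ((\<lambda>i. C i k) ` I) \<in> (\<lambda>i. C i k) ` I" using assms by (intro Max_in) auto
    then show ?thesis by blast
  qed
  obtain i0 where i0: "i0 \<in> I" using assms by auto
  show ?thesis
    unfolding call_like_def
  proof (intro conjI allI impI)
    show "Max ((\<lambda>i. C i 0) ` I) = x0" using ex[of 0] assms(3) unfolding call_like_def by auto
    fix k :: real assume k: "k \<ge> 0"
    show "0 \<le> Max ((\<lambda>i. C i k) ` I)" "x0 - k \<le> Max ((\<lambda>i. C i k) ` I)"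
      using ge[OF i0, of k] assms(3)[OF i0] k unfolding call_like_def by (force intro: order_trans)+
    show "Max ((\<lambda>i. C i l) ` I) \<le> Max ((\<lambda>i. C i k) ` I)" if "l \<ge> k" for l
    proof -
      obtain i where i: "i \<in> I" "Max ((\<lambda>i. C i l) ` I) = C i l" using ex by blast
      have "C i l \<le> C i k" using assms(3)[OF i(1)] k that unfolding call_like_def by blast
      then show ?thesis using ge[OF i(1), of k] i(2) by simp
    qed
    show "2 * Max ((\<lambda>i. C i (k + d)) ` I) \<le> Max ((\<lambda>i. C i k) ` I) + Max ((\<lambda>i. C i (k + 2 * d)) ` I)" if "d \<ge> 0" for d
    proof -
      obtain i where i: "i \<in> I" "Max ((\<lambda>i. C i (k + d)) ` I) = C i (k + d)" using ex by blast
      have "2 * C i (k + d) \<le> C i k + C i (k + 2 * d)" using assms(3)[OF i(1)] k that unfolding call_like_def by blast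
      then show ?thesis using ge[OF i(1), of k] ge[OF i(1), of "k + 2 * d"] i(2) by simp
    qed
  qed
qed

text \<open>The functions \<open>C i\<close> increase with i and lie between the bid and ask call
  prices. A convex payoff is thus worth, under \<open>C i\<close>, at most its ask price and at
  least its bid price, up to vanishing errors; the true cost therefore dominates the discretised
  cost, which is nonnegative up to an error.\<close>

lemma hedge_cost_nonneg:
  fixes N :: nat and \<mu>b \<mu>a :: "nat \<Rightarrow> real measure"
  assumes N: "N \<ge> 1"
    and b: "\<And>i. i \<in> {1..N} \<Longrightarrow> \<mu>b i \<in> prob_first_moment \<and> barycenter (\<mu>b i) = x0"
    and a: "\<And>i. i \<in> {1..N} \<Longrightarrow> \<mu>a i \<in> prob_first_moment \<and> barycenter (\<mu>a i) = x0"
    and cx: "\<And>i j. 1 \<le> i \<Longrightarrow> i \<le> j \<Longrightarrow> j \<le> N \<Longrightarrow> \<mu>b i \<preceq>\<^sub>c\<^sub>x \<mu>a j"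
    and psi: "\<And>i. i \<in> {1..N} \<Longrightarrow> \<psi>a i \<in> CVX_L \<and> \<psi>b i \<in> CVX_L"
    and hedge: "\<And>x. (\<And>i. i \<in> {1..N} \<Longrightarrow> x i \<ge> 0) \<Longrightarrow>
      0 \<le> (\<Sum>i\<in>{1..N}. \<psi>a i (x i) - \<psi>b i (x i)) + (\<Sum>i\<in>{1..<N}. \<Delta> i (restrict x {1..i}) * (x (i + 1) - x i))"
  shows "0 \<le> (\<Sum>i\<in>{1..N}. (\<integral>x. \<psi>a i x \<partial>\<mu>a i) - (\<integral>x. \<psi>b i x \<partial>\<mu>b i))"
proof -
  define C where "C i k = Max ((\<lambda>j. call_price (\<mu>b j) k) ` {1..i})" for i k
  have Cb: "call_like x0 (call_price (\<mu>b i))" and Ca: "call_like x0 (call_price (\<mu>a i))" if "i \<in> {1..N}" for i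
    using call_price_call_like[of "\<mu>b i"] call_price_call_like[of "\<mu>a i"] b[OF that] a[OF that] by auto
  have CC: "call_like x0 (C i)" if "i \<in> {1..N}" for i
    unfolding C_def[abs_def] using that by (intro call_like_Max Cb) auto
  have bC: "call_price (\<mu>b i) k \<le> C i k" if "i \<in> {1..N}" for i k
    unfolding C_def using that by (intro Max_ge) auto
  have aC: "C i k \<le> call_price (\<mu>a i) k" if i: "i \<in> {1..N}" and k: "k \<ge> 0" for i k
  proof -
    \<comment> \<open>Here the order is used across dates: every earlier bid marginal lies below the
      current ask marginal.\<close>
    have "call_price (\<mu>b j) k \<le> call_price (\<mu>a i) k" if "j \<in> {1..i}" for j
      using cx[of j i] that i CVX_L_call[OF k] unfolding convex_order_def call_price_def by auto
    then show ?thesis unfolding C_def using i by (intro Max.boundedI) auto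
  qed
  have C_lim: "(\<lambda>n. C i (real n)) \<longlonglongrightarrow> 0" if i: "i \<in> {1..N}" for i
  proof (rule tendsto_sandwich[OF _ _ tendsto_const call_price_tendsto_0])
    show "\<mu>a i \<in> prob_first_moment" using a[OF i] by simp
    show "\<forall>\<^sub>F n in sequentially. 0 \<le> C i (real n)" using CC[OF i] unfolding call_like_def by simp
    show "\<forall>\<^sub>F n in sequentially. C i (real n) \<le> call_price (\<mu>a i) (real n)" using aC[OF i] by simp
  qed
  have "\<exists>K. \<forall>i\<in>{1..N}. \<forall>x\<ge>0. \<bar>\<psi>a i x\<bar> \<le> K i * (1 + x) \<and> \<bar>\<psi>b i x\<bar> \<le> K i * (1 + x)"
  proof (intro bchoice ballI)
    fix i assume i: "i \<in> {1..N}"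
    obtain K L where K: "\<And>x. x \<ge> 0 \<Longrightarrow> \<bar>\<psi>a i x\<bar> \<le> K * (1 + x)" and L: "\<And>x. x \<ge> 0 \<Longrightarrow> \<bar>\<psi>b i x\<bar> \<le> L * (1 + x)"
      using CVX_L_D(3)[of "\<psi>a i"] CVX_L_D(3)[of "\<psi>b i"] psi[OF i] by blast
    have "\<bar>\<psi>a i x\<bar> \<le> max K L * (1 + x) \<and> \<bar>\<psi>b i x\<bar> \<le> max K L * (1 + x)" if x: "x \<ge> 0" for x
    proof -
      have "K * (1 + x) \<le> max K L * (1 + x)" "L * (1 + x) \<le> max K L * (1 + x)"
        using x by (auto intro!: mult_right_mono)
      then show ?thesis using K[OF x] L[OF x] by linarith
    qed
    then show "\<exists>K. \<forall>x\<ge>0. \<bar>\<psi>a i x\<bar> \<le> K * (1 + x) \<and> \<bar>\<psi>b i x\<bar> \<le> K * (1 + x)" by blast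
  qed
  then obtain K where Ka: "\<And>i x. i \<in> {1..N} \<Longrightarrow> x \<ge> 0 \<Longrightarrow> \<bar>\<psi>a i x\<bar> \<le> K i * (1 + x)"
    and Kb: "\<And>i x. i \<in> {1..N} \<Longrightarrow> x \<ge> 0 \<Longrightarrow> \<bar>\<psi>b i x\<bar> \<le> K i * (1 + x)" by blast
  have "\<exists>e. e \<longlonglongrightarrow> 0 \<and> (\<forall>n\<ge>1. - e n \<le> (\<Sum>i\<in>{1..N}. grid_integral (C i) n (\<lambda>x. \<psi>a i x - \<psi>b i x)))"
  proof (rule grid_hedge_bound[OF N _ CC _ C_lim hedge])
    fix i assume i: "i \<in> {1..N}"
    have "\<bar>\<psi>a i x - \<psi>b i x\<bar> \<le> (K i + K i) * (1 + x)" if "x \<ge> 0" for x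
      unfolding distrib_right using Ka[OF i that] Kb[OF i that] by linarith
    then show "\<exists>K. \<forall>x\<ge>0. \<bar>\<psi>a i x - \<psi>b i x\<bar> \<le> K * (1 + x)" by blast
  next
    fix i and k :: real assume "i \<in> {1..<N}"
    then show "C i k \<le> C (Suc i) k" unfolding C_def by (intro Max_mono) auto
  qed
  then obtain e where e: "e \<longlonglongrightarrow> 0"
    "\<And>n. n \<ge> 1 \<Longrightarrow> - e n \<le> (\<Sum>i\<in>{1..N}. grid_integral (C i) n (\<lambda>x. \<psi>a i x - \<psi>b i x))" by blast
  \<comment> \<open>Upper bound for the grid integral under \<open>C i\<close> after passing to the
    given measures, with both boundary terms included; the sum over i tends to the cost.\<close>
  define q where "q n i = (grid_integral (call_price (\<mu>a i)) n (\<psi>a i) + K i * call_price (\<mu>a i) (real n))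
     - (grid_integral (call_price (\<mu>b i)) n (\<psi>b i) - K i * C i (real n))" for n i
  have q: "grid_integral (C i) n (\<lambda>x. \<psi>a i x - \<psi>b i x) \<le> q n i" if i: "i \<in> {1..N}" and n: "n \<ge> 1" for i n
  proof -
    have "grid_integral (C i) n (\<psi>a i) \<le> grid_integral (call_price (\<mu>a i)) n (\<psi>a i) + K i * call_price (\<mu>a i) (real n)"
      using CVX_L_D(2) psi[OF i] by (intro grid_integral_mono[OF CC[OF i] Ca[OF i] aC[OF i] n _ Ka[OF i]]) auto
    moreover have "grid_integral (call_price (\<mu>b i)) n (\<psi>b i) \<le> grid_integral (C i) n (\<psi>b i) + K i * C i (real n)"
      using CVX_L_D(2) psi[OF i] by (intro grid_integral_mono[OF Cb[OF i] CC[OF i] bC[OF i] n _ Kb[OF i]]) auto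
    ultimately show ?thesis unfolding q_def grid_integral_diff by simp
  qed
  have "(\<lambda>n. \<Sum>i\<in>{1..N}. q n i) \<longlonglongrightarrow> (\<Sum>i\<in>{1..N}. ((\<integral>x. \<psi>a i x \<partial>\<mu>a i) + K i * 0) - ((\<integral>x. \<psi>b i x \<partial>\<mu>b i) - K i * 0))"
    unfolding q_def
  proof (intro tendsto_sum tendsto_diff tendsto_add tendsto_mult_left)
    fix i assume i: "i \<in> {1..N}"
    have a': "\<mu>a i \<in> prob_first_moment" and b': "\<mu>b i \<in> prob_first_moment" using a[OF i] b[OF i] by auto
    show "(\<lambda>n. grid_integral (call_price (\<mu>a i)) n (\<psi>a i)) \<longlonglongrightarrow> (\<integral>x. \<psi>a i x \<partial>\<mu>a i)"
      using CVX_L_D(1) psi[OF i] by (intro grid_integral_tendsto[OF a' _ Ka[OF i]]) auto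
    show "(\<lambda>n. grid_integral (call_price (\<mu>b i)) n (\<psi>b i)) \<longlonglongrightarrow> (\<integral>x. \<psi>b i x \<partial>\<mu>b i)"
      using CVX_L_D(1) psi[OF i] by (intro grid_integral_tendsto[OF b' _ Kb[OF i]]) auto
    show "(\<lambda>n. call_price (\<mu>a i) (real n)) \<longlonglongrightarrow> 0" by (rule call_price_tendsto_0[OF a'])
    show "(\<lambda>n. C i (real n)) \<longlonglongrightarrow> 0" by (rule C_lim[OF i])
  qed
  then have lim: "(\<lambda>n. e n + (\<Sum>i\<in>{1..N}. q n i)) \<longlonglongrightarrow> 0 + (\<Sum>i\<in>{1..N}. (\<integral>x. \<psi>a i x \<partial>\<mu>a i) - (\<integral>x. \<psi>b i x \<partial>\<mu>b i))"
    by (intro tendsto_add e(1)) simp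
  have "0 \<le> e n + (\<Sum>i\<in>{1..N}. q n i)" if "n \<ge> 1" for n
    using e(2)[OF that] sum_mono[of "{1..N}" "\<lambda>i. grid_integral (C i) n (\<lambda>x. \<psi>a i x - \<psi>b i x)" "q n"] q that
    by force
  then have "0 \<le> 0 + (\<Sum>i\<in>{1..N}. (\<integral>x. \<psi>a i x \<partial>\<mu>a i) - (\<integral>x. \<psi>b i x \<partial>\<mu>b i))"
    by (intro tendsto_lowerbound[OF lim]) (auto simp: eventually_sequentially)
  then show ?thesis by simp
qed

section \<open>The canonical process\<close>

context
  fixes Q :: "(nat \<Rightarrow> real) measure" and N :: nat and x0 :: real
  assumes Q_sets: "sets Q = sets (path_space N)"
begin

private abbreviation "Y \<equiv> canonical_process x0"
private abbreviation "Fil \<equiv> natural_filtration Q Y"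

lemma space_Q: "space Q = space (path_space N)"
  by (rule sets_eq_imp_space_eq[OF Q_sets])

lemma measurable_canonical: "Y i \<in> borel_measurable Q"
proof -
  have "(\<lambda>x. x i) \<in> borel_measurable Q"
    using measurable_coordinate measurable_cong_sets[OF Q_sets refl] by blast
  then show ?thesis unfolding canonical_process_def[abs_def] by simp
qed

lemma space_natural_filtration: "space (Fil i) = space Q"
  unfolding natural_filtration_def by (rule space_measure_of) auto

lemma sets_natural_filtration:
  "sets (Fil i) = sigma_sets (space Q) (\<Union>j\<in>{..i}. {Y j -` A \<inter> space Q | A. A \<in> sets borel})"
  unfolding natural_filtration_def by (rule sets_measure_of) auto

lemma subalgebra_natural_filtration: "subalgebra Q (Fil i)"
  unfolding subalgebra_def space_natural_filtration sets_natural_filtration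
  using measurable_sets[OF measurable_canonical] by (auto intro!: sets.sigma_sets_subset)

lemma natural_filtration_mono: "i \<le> j \<Longrightarrow> sets (Fil i) \<subseteq> sets (Fil j)"
  unfolding sets_natural_filtration by (intro sigma_sets_mono' UN_mono) auto

lemma measurable_natural_filtration: "j \<le> i \<Longrightarrow> Y j \<in> borel_measurable (Fil i)"
proof (rule measurableI)
  fix A :: "real set" assume "j \<le> i" "A \<in> sets borel"
  then have "Y j -` A \<inter> space Q \<in> (\<Union>j\<in>{..i}. {Y j -` A \<inter> space Q | A. A \<in> sets borel})" by blast
  then show "Y j -` A \<inter> space (Fil i) \<in> sets (Fil i)"
    unfolding space_natural_filtration sets_natural_filtration by (rule sigma_sets.Basic)
qed simp

text \<open>A position given as a function on \<open>path_space i\<close> becomes adapted through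
  this map.\<close>

lemma measurable_restrict_path: "i \<le> N \<Longrightarrow> (\<lambda>x. restrict x {1..i}) \<in> Fil i \<rightarrow>\<^sub>M path_space i"
  unfolding path_space_def restrict_def[abs_def]
proof (rule measurable_PiM_single')
  assume i: "i \<le> N"
  fix k assume k: "k \<in> {1..i}"
  have "(\<lambda>x. x k) \<in> borel_measurable (Fil i)"
    using measurable_natural_filtration[of k i] k unfolding canonical_process_def[abs_def] by simp
  moreover have "x k \<in> {0..}" if "x \<in> space (Fil i)" for x
    using that path_nonneg[of x N k] i k unfolding space_natural_filtration space_Q by auto
  ultimately show "(\<lambda>x. if k \<in> {1..i} then x k else undefined) \<in> Fil i \<rightarrow>\<^sub>M borel_Rp"
    using k unfolding borel_Rp_def measurable_restrict_space2_iff by auto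
next
  assume i: "i \<le> N"
  show "(\<lambda>x k. if k \<in> {1..i} then x k else undefined) \<in> space (Fil i) \<rightarrow> (\<Pi>\<^sub>E k\<in>{1..i}. space borel_Rp)"
    using path_nonneg i unfolding space_natural_filtration space_Q
    by (auto simp: borel_Rp_def space_restrict_space)
qed

context
  assumes Q_prob: "prob_space Q" and Q_int: "\<And>i. i \<in> {1..N} \<Longrightarrow> integrable Q (\<lambda>x. x i)"
begin

lemma integrable_canonical: "i \<le> N \<Longrightarrow> integrable Q (Y i)"
proof -
  interpret prob_space Q by (rule Q_prob)
  show "i \<le> N \<Longrightarrow> integrable Q (Y i)"
    using Q_int[of i] unfolding canonical_process_def[abs_def] by (cases "i = 0") auto
qed

text \<open>The boxes are closed under intersection and generate the natural filtration, so a Dynkin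
  argument extends orthogonality of increments from boxes to all past events. Date 0 carries no box
  condition and is covered by the constant mean.\<close>

lemma martingale_measuresI:
  assumes mean: "\<And>i. i \<in> {1..N} \<Longrightarrow> (\<integral>x. x i \<partial>Q) = x0"
    and boxes: "\<And>i a. i \<in> {1..<N} \<Longrightarrow>
      (\<integral>x. indicator {x. \<forall>k\<in>{1..i}. x k \<le> a k} x * (x (i + 1) - x i) \<partial>Q) = 0"
  shows "Q \<in> martingale_measures N x0"
proof -
  interpret prob_space Q by (rule Q_prob)
  let ?box = "\<lambda>i a. {x \<in> space Q. \<forall>k\<in>{1..i}. x k \<le> a k}"
  define G where "G i = range (?box i)" for i
  have Y_int: "integrable Q (Y i)" if "i \<le> N" for i by (rule integrable_canonical[OF that])
  have Y_mean: "(\<integral>x. Y i x \<partial>Q) = x0" if "i \<le> N" for i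
    using mean[of i] that unfolding canonical_process_def by (cases "i = 0") (auto simp: prob_space)
  have G_sub: "G i \<subseteq> Pow (space Q)" for i unfolding G_def by auto
  have Fil_G: "sets (Fil i) \<subseteq> sigma_sets (space Q) (G i)" for i
  proof -
    have meas: "Y j \<in> borel_measurable (sigma (space Q) (G i))" if j: "j \<le> i" for j
    proof (cases "j = 0")
      case True
      then show ?thesis unfolding canonical_process_def[abs_def] by simp
    next
      case False
      show ?thesis
        unfolding borel_measurable_iff_le
      proof
        fix c
        have bx: "?box i a \<in> sets (sigma (space Q) (G i))" for a
          by (rule in_measure_of[OF G_sub]) (unfold G_def, rule rangeI)
        \<comment> \<open>Letting the bounds on the other coordinates grow isolates the condition on
          coordinate j.\<close>
        have "{x \<in> space Q. Y j x \<le> c} = (\<Union>n::nat. ?box i (\<lambda>k. if k = j then c else real n))"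
        proof (intro equalityI subsetI)
          fix x assume x: "x \<in> {x \<in> space Q. Y j x \<le> c}"
          obtain n where n: "Max (insert 0 (x ` {1..i})) < real n" using reals_Archimedean2 by blast
          have "x k \<le> real n" if "k \<in> {1..i}" for k
          proof -
            have "x k \<le> Max (insert 0 (x ` {1..i}))" using that by (intro Max_ge) auto
            then show ?thesis using n by linarith
          qed
          then have "x \<in> ?box i (\<lambda>k. if k = j then c else real n)"
            using x False by (auto simp: canonical_process_def)
          then show "x \<in> (\<Union>n::nat. ?box i (\<lambda>k. if k = j then c else real n))" by blast
        next
          fix x assume "x \<in> (\<Union>n::nat. ?box i (\<lambda>k. if k = j then c else real n))"
          then obtain n :: nat where "x \<in> space Q" "\<forall>k\<in>{1..i}. x k \<le> (if k = j then c else real n)" by blast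
          then show "x \<in> {x \<in> space Q. Y j x \<le> c}"
            using False j by (auto simp: canonical_process_def dest!: bspec[of _ _ j])
        qed
        also have "\<dots> \<in> sets (sigma (space Q) (G i))"
          by (rule sets.countable_UN) (rule image_subsetI, rule bx)
        finally show "{w \<in> space (sigma (space Q) (G i)). Y j w \<le> c} \<in> sets (sigma (space Q) (G i))"
          using G_sub by (simp add: space_measure_of)
      qed
    qed
    show ?thesis
      unfolding sets_natural_filtration
    proof (rule sigma_sets_mono, rule subsetI)
      fix B assume "B \<in> (\<Union>j\<in>{..i}. {Y j -` A \<inter> space Q | A. A \<in> sets borel})"
      then obtain j A where j: "j \<le> i" "A \<in> sets borel" and B: "B = Y j -` A \<inter> space Q" by blast
      show "B \<in> sigma_sets (space Q) (G i)"
        unfolding B using measurable_sets[OF meas[OF j(1)] j(2)] G_sub by (simp add: space_measure_of)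
    qed
  qed
  have G_Q: "G i \<subseteq> sets Q" for i
  proof
    fix B assume "B \<in> G i"
    then obtain a where B: "B = ?box i a" unfolding G_def by blast
    have "(\<lambda>x. x k) \<in> borel_measurable Q" for k
      using measurable_coordinate measurable_cong_sets[OF Q_sets refl] by blast
    note [measurable] = this
    show "B \<in> sets Q" unfolding B by measurable
  qed
  have step0: "(\<integral>x. indicator A x * (Y (Suc i) x - Y i x) \<partial>Q) = 0" if i: "i < N" and A: "A \<in> sets (Fil i)" for i A
  proof -
    have dint: "integrable Q (\<lambda>x. Y (Suc i) x - Y i x)"
      using i by (intro Bochner_Integration.integrable_diff Y_int) auto
    have dzero: "(\<integral>x. Y (Suc i) x - Y i x \<partial>Q) = 0"
      using i Y_int Y_mean by (subst Bochner_Integration.integral_diff) auto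
    have Aint: "integrable Q (\<lambda>x. indicator B x * (Y (Suc i) x - Y i x))" if "B \<in> sets Q" for B
      using integrable_mult_indicator[OF that dint] by simp
    have sub: "sigma_sets (space Q) (G i) \<subseteq> sets Q" by (rule sets.sigma_sets_subset[OF G_Q])
    have stable: "Int_stable (G i)"
    proof (rule Int_stableI)
      fix B C assume "B \<in> G i" "C \<in> G i"
      then obtain a b where "B = ?box i a" "C = ?box i b" unfolding G_def by blast
      then have "B \<inter> C = ?box i (\<lambda>k. min (a k) (b k))" by auto
      then show "B \<inter> C \<in> G i" unfolding G_def by (intro image_eqI[where x = "\<lambda>k. min (a k) (b k)"] UNIV_I)
    qed
    have "A \<in> sigma_sets (space Q) (G i)" using A Fil_G by blast
    with stable G_sub show ?thesis
    proof (induction rule: sigma_sets_induct_disjoint)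
      case (basic B)
      then obtain a where B: "B = ?box i a" unfolding G_def by blast
      show ?case
      proof (cases "i = 0")
        case True
        have "(\<integral>x. indicator B x * (Y (Suc i) x - Y i x) \<partial>Q) = (\<integral>x. Y (Suc i) x - Y i x \<partial>Q)"
          by (intro Bochner_Integration.integral_cong) (auto simp: B True)
        then show ?thesis using dzero by simp
      next
        case False
        have "(\<integral>x. indicator B x * (Y (Suc i) x - Y i x) \<partial>Q)
            = (\<integral>x. indicator {x. \<forall>k\<in>{1..i}. x k \<le> a k} x * (x (i + 1) - x i) \<partial>Q)"
          using False by (intro Bochner_Integration.integral_cong) (auto simp: B canonical_process_def indicator_def)
        then show ?thesis using boxes[of i a] False i by simp
      qed
    next
      case empty
      show ?case by simp
    next
      case (compl B)
      have B: "B \<in> sets Q" using compl sub by blast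
      have "(\<integral>x. indicator (space Q - B) x * (Y (Suc i) x - Y i x) \<partial>Q)
          = (\<integral>x. (Y (Suc i) x - Y i x) - indicator B x * (Y (Suc i) x - Y i x) \<partial>Q)"
        by (intro Bochner_Integration.integral_cong) (auto simp: indicator_def)
      also have "\<dots> = 0" using compl dzero by (subst Bochner_Integration.integral_diff[OF dint Aint[OF B]]) simp
      finally show ?case .
    next
      case (union B)
      have B: "B n \<in> sets Q" for n using union sub by blast
      \<comment> \<open>Countable unions follow from finite ones because the integrands are bounded
        by the absolute increment.\<close>
      have "(\<lambda>n. \<integral>x. indicator (\<Union>k<n. B k) x * (Y (Suc i) x - Y i x) \<partial>Q)
          \<longlonglongrightarrow> (\<integral>x. indicator (\<Union>k. B k) x * (Y (Suc i) x - Y i x) \<partial>Q)"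
      proof (rule integral_dominated_convergence[where w = "\<lambda>x. \<bar>Y (Suc i) x - Y i x\<bar>"])
        have BU: "(\<Union>k. B k) \<in> sets Q" using B by auto
        show "(\<lambda>x. indicator (\<Union>k. B k) x * (Y (Suc i) x - Y i x)) \<in> borel_measurable Q"
          using Aint[OF BU] by (rule borel_measurable_integrable)
        show "(\<lambda>x. indicator (\<Union>k<n. B k) x * (Y (Suc i) x - Y i x)) \<in> borel_measurable Q" for n
          using B by (intro borel_measurable_integrable Aint) auto
        show "integrable Q (\<lambda>x. \<bar>Y (Suc i) x - Y i x\<bar>)" using dint by simp
        show "AE x in Q. (\<lambda>n. indicator (\<Union>k<n. B k) x * (Y (Suc i) x - Y i x)) \<longlonglongrightarrow> indicator (\<Union>k. B k) x * (Y (Suc i) x - Y i x)"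
          by (intro AE_I2 tendsto_mult_right LIMSEQ_indicator_UN)
        show "AE x in Q. norm (indicator (\<Union>k<n. B k) x * (Y (Suc i) x - Y i x)) \<le> \<bar>Y (Suc i) x - Y i x\<bar>" for n
          by (intro AE_I2) (auto simp: indicator_def)
      qed
      moreover have "(\<integral>x. indicator (\<Union>k<n. B k) x * (Y (Suc i) x - Y i x) \<partial>Q) = 0" for n
      proof -
        have "indicator (\<Union>k<n. B k) x * (Y (Suc i) x - Y i x) = (\<Sum>k<n. indicator (B k) x * (Y (Suc i) x - Y i x))" for x
          using union(1) by (subst indicator_UN_disjoint) (auto simp: sum_distrib_right intro: disjoint_family_on_mono)
        then have "(\<integral>x. indicator (\<Union>k<n. B k) x * (Y (Suc i) x - Y i x) \<partial>Q)
            = (\<integral>x. (\<Sum>k<n. indicator (B k) x * (Y (Suc i) x - Y i x)) \<partial>Q)" by (intro Bochner_Integration.integral_cong refl)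
        also have "\<dots> = (\<Sum>k<n. \<integral>x. indicator (B k) x * (Y (Suc i) x - Y i x) \<partial>Q)"
          by (intro Bochner_Integration.integral_sum Aint B)
        finally show ?thesis using union(3) by simp
      qed
      ultimately show ?case by (simp add: LIMSEQ_const_iff)
    qed
  qed
  \<comment> \<open>Telescoping over one-step increments: an event known at date i is known at every
    later date.\<close>
  have incr: "(\<integral>x. indicator A x * Y j x \<partial>Q) = (\<integral>x. indicator A x * Y i x \<partial>Q)"
    if "i \<le> j" "j \<le> N" and A: "A \<in> sets (Fil i)" for i j A
    using that(1,2)
  proof (induction j rule: dec_induct)
    case (step j)
    have A': "A \<in> sets (Fil j)" "A \<in> sets Q"
      using A natural_filtration_mono[of i j] step(1) subalgebra_natural_filtration[of i] by (auto simp: subalgebra_def)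
    have Aint: "integrable Q (\<lambda>x. indicator A x * Y k x)" if "k \<le> N" for k
      using integrable_mult_indicator[OF A'(2) Y_int[OF that]] by simp
    have "(\<integral>x. indicator A x * Y (Suc j) x \<partial>Q) - (\<integral>x. indicator A x * Y j x \<partial>Q)
        = (\<integral>x. indicator A x * (Y (Suc j) x - Y j x) \<partial>Q)"
      using step by (subst Bochner_Integration.integral_diff[symmetric]) (auto intro: Aint simp: right_diff_distrib)
    also have "\<dots> = 0" using A' step by (intro step0) auto
    finally show ?case using step by simp
  qed simp
  have "AE x in Q. real_cond_exp Q (Fil i) (Y j) x = Y i x" if ij: "i \<le> j" "j \<le> N" for i j
  proof -
    interpret finite_measure_subalgebra Q "Fil i" by standard (rule subalgebra_natural_filtration)
    show ?thesis
    proof (rule real_cond_exp_charact)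
      show "(LINT x:A|Q. Y j x) = (LINT x:A|Q. Y i x)" if "A \<in> sets (Fil i)" for A
        using incr[OF ij that] unfolding set_lebesgue_integral_def by simp
      show "integrable Q (Y j)" "integrable Q (Y i)" using ij by (auto intro: Y_int)
      show "Y i \<in> borel_measurable (Fil i)" by (rule measurable_natural_filtration) simp
    qed
  qed
  then show ?thesis
    unfolding martingale_measures_def martingale_upto_def using Q_prob Q_sets Y_int by auto
qed

end

end

section \<open>Martingale transforms\<close>

text \<open>Nonnegativity permits passing to \<open>nn_integral\<close>, where the liminf inequality
  gives finiteness, hence integrability, together with the bound.\<close>

lemma Fatou_real:
  fixes f :: "nat \<Rightarrow> 'a \<Rightarrow> real"
  assumes f: "\<And>n. integrable M (f n)" "\<And>n x. x \<in> space M \<Longrightarrow> 0 \<le> f n x"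
    and lim: "\<And>x. x \<in> space M \<Longrightarrow> (\<lambda>n. f n x) \<longlonglongrightarrow> g x"
    and b: "\<And>n. (\<integral>x. f n x \<partial>M) \<le> b n" "b \<longlonglongrightarrow> B"
  shows "integrable M g" "(\<integral>x. g x \<partial>M) \<le> B"
proof -
  have g_meas: "g \<in> borel_measurable M"
    using f(1) by (intro borel_measurable_LIMSEQ_real[OF lim]) auto
  have g_nonneg: "0 \<le> g x" if "x \<in> space M" for x
    using f(2)[OF that] by (intro LIMSEQ_le_const[OF lim[OF that]]) auto
  have b_nonneg: "0 \<le> b n" for n
  proof -
    have "0 \<le> (\<integral>x. f n x \<partial>M)" using f(2) by (intro integral_nonneg_AE) auto
    then show ?thesis using b(1)[of n] by simp
  qed
  have B: "0 \<le> B" using b_nonneg by (intro LIMSEQ_le_const[OF b(2)]) auto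
  have "(\<integral>\<^sup>+x. ennreal (g x) \<partial>M) = (\<integral>\<^sup>+x. liminf (\<lambda>n. ennreal (f n x)) \<partial>M)"
  proof (rule nn_integral_cong)
    fix x assume "x \<in> space M"
    then have "(\<lambda>n. ennreal (f n x)) \<longlonglongrightarrow> ennreal (g x)" by (intro tendsto_ennrealI lim)
    then show "ennreal (g x) = liminf (\<lambda>n. ennreal (f n x))"
      by (intro lim_imp_Liminf[symmetric]) auto
  qed
  also have "\<dots> \<le> liminf (\<lambda>n. \<integral>\<^sup>+x. ennreal (f n x) \<partial>M)"
    using f(1) by (intro nn_integral_liminf) auto
  also have "\<dots> \<le> liminf (\<lambda>n. ennreal (b n))"
  proof (intro Liminf_mono always_eventually allI)
    fix n
    have "(\<integral>\<^sup>+x. ennreal (f n x) \<partial>M) = ennreal (\<integral>x. f n x \<partial>M)"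
      using f by (intro nn_integral_eq_integral) auto
    also have "\<dots> \<le> ennreal (b n)" by (intro ennreal_leI b)
    finally show "(\<integral>\<^sup>+x. ennreal (f n x) \<partial>M) \<le> ennreal (b n)" .
  qed
  also have "\<dots> = ennreal B" using b(2) by (intro lim_imp_Liminf tendsto_ennrealI) auto
  finally have le: "(\<integral>\<^sup>+x. ennreal (g x) \<partial>M) \<le> ennreal B" .
  show int: "integrable M g"
    using g_nonneg le by (intro integrableI_nonneg g_meas) (auto intro: le_less_trans)
  show "(\<integral>x. g x \<partial>M) \<le> B"
    using le B g_nonneg g_meas by (subst integral_eq_nn_integral) (auto intro: enn2real_leI)
qed

text \<open>Only integrability of the negative part of the terminal value is assumed: it propagates backwards
  in time by localization, and then Fatou's lemma controls the expectation forwards in time.\<close>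

lemma martingale_transform_integral:
  fixes X :: "nat \<Rightarrow> 'a \<Rightarrow> real" and D :: "nat \<Rightarrow> 'a \<Rightarrow> real" and F :: "nat \<Rightarrow> 'a measure"
  assumes prob: "prob_space Q" and sub: "\<And>i. subalgebra Q (F i)"
    and mono: "\<And>i j. i \<le> j \<Longrightarrow> sets (F i) \<subseteq> sets (F j)"
    and X_meas: "\<And>i j. j \<le> i \<Longrightarrow> X j \<in> borel_measurable (F i)"
    and X_int: "\<And>i. i \<le> N \<Longrightarrow> integrable Q (X i)"
    and orth: "\<And>i u B. i < N \<Longrightarrow> u \<in> borel_measurable (F i) \<Longrightarrow> (\<And>x. \<bar>u x\<bar> \<le> B) \<Longrightarrow>
      (\<integral>x. u x * (X (i + 1) x - X i x) \<partial>Q) = 0"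
    and D_meas: "\<And>i. i \<in> {1..<N} \<Longrightarrow> D i \<in> borel_measurable (F i)"
    and N: "N \<ge> 1"
    and Z: "integrable Q Z" "\<And>x. x \<in> space Q \<Longrightarrow> - Z x \<le> (\<Sum>i\<in>{1..<N}. D i x * (X (i + 1) x - X i x))"
  shows "integrable Q (\<lambda>x. \<Sum>i\<in>{1..<N}. D i x * (X (i + 1) x - X i x))"
    and "(\<integral>x. (\<Sum>i\<in>{1..<N}. D i x * (X (i + 1) x - X i x)) \<partial>Q) \<le> 0"
proof -
  interpret prob_space Q by (rule prob)
  define M where "M k x = (\<Sum>i\<in>{1..<k}. D i x * (X (i + 1) x - X i x))" for k x
  have up: "f \<in> borel_measurable (F k)" if "f \<in> borel_measurable (F i)" "i \<le> k" for f :: "'a \<Rightarrow> real" and i k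
  proof (rule measurable_from_subalg[OF _ that(1)])
    show "subalgebra (F k) (F i)" using sub mono[OF that(2)] unfolding subalgebra_def by simp
  qed
  have toQ: "f \<in> borel_measurable Q" if "f \<in> borel_measurable (F i)" for f :: "'a \<Rightarrow> real" and i
    by (rule measurable_from_subalg[OF sub that])
  have M_meas: "M k \<in> borel_measurable (F k)" if "k \<le> N" for k
    unfolding M_def[abs_def] using that
    by (intro borel_measurable_sum borel_measurable_times borel_measurable_diff)
      (auto intro!: X_meas intro: up[OF D_meas])
  have M_Suc: "M (Suc k) x = M k x + D k x * (X (Suc k) x - X k x)" if "k \<ge> 1" for k x
    unfolding M_def using that by simp
  \<comment> \<open>Localisation at level m: on this event, known at date k, both the position and
    the accumulated gain are bounded, so the next gain integrates to zero.\<close>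
  define T where "T k m x = (if \<bar>D k x\<bar> \<le> real m \<and> \<bar>M k x\<bar> \<le> real m then 1 else 0 :: real)" for k m x
  have T01: "0 \<le> T k m x" "T k m x \<le> 1" for k m x by (auto simp: T_def)
  have T_meas: "T k m \<in> borel_measurable (F k)" if "1 \<le> k" "k < N" for k m
  proof -
    have [measurable]: "D k \<in> borel_measurable (F k)" "M k \<in> borel_measurable (F k)"
      using D_meas[of k] M_meas[of k] that by auto
    show ?thesis unfolding T_def[abs_def] by measurable
  qed
  have T_lim: "(\<lambda>m. T k m x) \<longlonglongrightarrow> 1" for k x
  proof (rule tendsto_eventually)
    obtain m0 where m0: "max \<bar>D k x\<bar> \<bar>M k x\<bar> < real m0" using reals_Archimedean2 by blast
    have "T k m x = 1" if "m \<ge> m0" for m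
    proof -
      have "real m0 \<le> real m" using that by simp
      then show ?thesis using m0 unfolding T_def by simp
    qed
    then show "\<forall>\<^sub>F m in sequentially. T k m x = 1" unfolding eventually_sequentially by blast
  qed
  \<comment> \<open>The factor v selects an event known at date k; it is used with {M k < 0} and
    with the whole space.\<close>
  have localized: "integrable Q (\<lambda>x. M k x * (v x * T k m x)) \<and> integrable Q (\<lambda>x. M (Suc k) x * (v x * T k m x)) \<and>
      (\<integral>x. M (Suc k) x * (v x * T k m x) \<partial>Q) = (\<integral>x. M k x * (v x * T k m x) \<partial>Q)"
    if k: "1 \<le> k" "k < N" and v: "v \<in> borel_measurable (F k)" "\<And>x. 0 \<le> v x" "\<And>x. v x \<le> 1" for k m v
  proof -
    have vT: "\<bar>v x * T k m x\<bar> \<le> 1" for x using v T01 by (auto simp: abs_mult intro!: mult_le_one)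
    have b1: "\<bar>M k x * (v x * T k m x)\<bar> \<le> real m" for x
    proof (cases "T k m x = 0")
      case False
      then have "\<bar>M k x\<bar> \<le> real m" unfolding T_def by (auto split: if_splits)
      then show ?thesis using mult_mono[OF _ vT, of "\<bar>M k x\<bar>" "real m" x] by (simp add: abs_mult)
    qed simp
    have b2: "\<bar>D k x * (v x * T k m x)\<bar> \<le> real m" for x
    proof (cases "T k m x = 0")
      case False
      then have "\<bar>D k x\<bar> \<le> real m" unfolding T_def by (auto split: if_splits)
      then show ?thesis using mult_mono[OF _ vT, of "\<bar>D k x\<bar>" "real m" x] by (simp add: abs_mult)
    qed simp
    have m1: "(\<lambda>x. M k x * (v x * T k m x)) \<in> borel_measurable (F k)"
      using M_meas[of k] T_meas[OF k] v(1) k by (intro borel_measurable_times) auto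
    have m2: "(\<lambda>x. D k x * (v x * T k m x)) \<in> borel_measurable (F k)"
      using D_meas[of k] T_meas[OF k] v(1) k by (intro borel_measurable_times) auto
    have i1: "integrable Q (\<lambda>x. M k x * (v x * T k m x))"
      using b1 by (intro integrable_const_bound[where B = "real m"] toQ[OF m1]) auto
    have dX: "integrable Q (\<lambda>x. X (Suc k) x - X k x)"
      using k by (intro Bochner_Integration.integrable_diff X_int) auto
    have i2: "integrable Q (\<lambda>x. D k x * (v x * T k m x) * (X (Suc k) x - X k x))"
    proof (rule Bochner_Integration.integrable_bound)
      show "integrable Q (\<lambda>x. real m * (X (Suc k) x - X k x))" using dX by (rule integrable_mult_right)
      show "(\<lambda>x. D k x * (v x * T k m x) * (X (Suc k) x - X k x)) \<in> borel_measurable Q"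
        by (rule borel_measurable_times[OF toQ[OF m2] borel_measurable_integrable[OF dX]])
      show "AE x in Q. norm (D k x * (v x * T k m x) * (X (Suc k) x - X k x)) \<le> norm (real m * (X (Suc k) x - X k x))"
      proof (intro AE_I2)
        fix x
        have "\<bar>D k x * (v x * T k m x)\<bar> * \<bar>X (Suc k) x - X k x\<bar> \<le> real m * \<bar>X (Suc k) x - X k x\<bar>"
          by (intro mult_right_mono b2) simp
        then show "norm (D k x * (v x * T k m x) * (X (Suc k) x - X k x)) \<le> norm (real m * (X (Suc k) x - X k x))"
          by (simp add: abs_mult)
      qed
    qed
    have eq: "M (Suc k) x * (v x * T k m x)
        = M k x * (v x * T k m x) + D k x * (v x * T k m x) * (X (Suc k) x - X k x)" for x
      unfolding M_Suc[OF k(1)] by (simp add: algebra_simps)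
    have "(\<integral>x. D k x * (v x * T k m x) * (X (Suc k) x - X k x) \<partial>Q) = 0"
      using orth[OF k(2) m2 b2] by simp
    then show ?thesis unfolding eq using i1 i2 by simp
  qed
  have neg: "integrable Q (\<lambda>x. max 0 (- M k x))" if "k \<le> N" "1 \<le> k" for k
    using that
  proof (induction rule: inc_induct)
    case base
    show ?case
    proof (rule Bochner_Integration.integrable_bound[OF Z(1)])
      show "(\<lambda>x. max 0 (- M N x)) \<in> borel_measurable Q" 
        by (intro borel_measurable_max borel_measurable_const borel_measurable_uminus toQ[OF M_meas]) simp
      show "AE x in Q. norm (max 0 (- M N x)) \<le> norm (Z x)"
        using Z(2) unfolding M_def[symmetric] by (intro AE_I2) force
    qed
  next
    case (step k)
    define v where "v x = (if M k x < 0 then 1 else 0 :: real)" for x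
    have v_meas: "v \<in> borel_measurable (F k)"
    proof -
      have [measurable]: "M k \<in> borel_measurable (F k)" using M_meas[of k] step.hyps by simp
      show ?thesis unfolding v_def[abs_def] by measurable
    qed
    have loc: "integrable Q (\<lambda>x. M k x * (v x * T k m x))" "integrable Q (\<lambda>x. M (Suc k) x * (v x * T k m x))"
      "(\<integral>x. M (Suc k) x * (v x * T k m x) \<partial>Q) = (\<integral>x. M k x * (v x * T k m x) \<partial>Q)" for m
      using localized[of k v m] step v_meas by (auto simp: v_def)
    have next_int: "integrable Q (\<lambda>x. max 0 (- M (Suc k) x))" by (rule step.IH) simp
    \<comment> \<open>On {M k < 0} the localised loss at date k has the same mean as the one at date
      k + 1, so the integrable loss of the next date bounds it for every m.\<close>
    show ?case
    proof (rule Fatou_real(1))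
      show "integrable Q (\<lambda>x. - (M k x * (v x * T k m x)))" for m using loc(1) by simp
      show "0 \<le> - (M k x * (v x * T k m x))" for m x using T01[of k m x] by (simp add: v_def mult_nonpos_nonneg)
      show "(\<lambda>m. - (M k x * (v x * T k m x))) \<longlonglongrightarrow> max 0 (- M k x)" for x
      proof -
        have "(\<lambda>m. - (M k x * (v x * T k m x))) \<longlonglongrightarrow> - (M k x * (v x * 1))"
          by (intro tendsto_minus tendsto_mult_left T_lim)
        then show ?thesis by (simp add: v_def max_def split: if_splits)
      qed
      show "(\<integral>x. - (M k x * (v x * T k m x)) \<partial>Q) \<le> (\<integral>x. max 0 (- M (Suc k) x) \<partial>Q)" for m
      proof -
        have "(\<integral>x. - (M k x * (v x * T k m x)) \<partial>Q) = (\<integral>x. - (M (Suc k) x * (v x * T k m x)) \<partial>Q)"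
          using loc(3) by simp
        also have "\<dots> \<le> (\<integral>x. max 0 (- M (Suc k) x) \<partial>Q)"
        proof (intro integral_mono next_int)
          show "integrable Q (\<lambda>x. - (M (Suc k) x * (v x * T k m x)))" using loc(2) by simp
          show "- (M (Suc k) x * (v x * T k m x)) \<le> max 0 (- M (Suc k) x)" for x
            by (auto simp: v_def T_def)
        qed
        finally show ?thesis .
      qed
      show "(\<lambda>m. \<integral>x. max 0 (- M (Suc k) x) \<partial>Q) \<longlonglongrightarrow> (\<integral>x. max 0 (- M (Suc k) x) \<partial>Q)" by simp
    qed
  qed
  have "integrable Q (M k) \<and> (\<integral>x. M k x \<partial>Q) \<le> 0" if "1 \<le> k" "k \<le> N" for k
    using that
  proof (induction rule: dec_induct)
    case base
    show ?case by (simp add: M_def[abs_def])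
  next
    case (step k)
    then have IH: "integrable Q (M k)" "(\<integral>x. M k x \<partial>Q) \<le> 0" by auto
    have loc: "integrable Q (\<lambda>x. M (Suc k) x * T k m x)"
      "(\<integral>x. M (Suc k) x * T k m x \<partial>Q) = (\<integral>x. M k x * T k m x \<partial>Q)" for m
      using localized[of k "\<lambda>_. 1" m] step by auto
    have n: "integrable Q (\<lambda>x. max 0 (- M (Suc k) x))" using step by (intro neg) auto
    have lim: "(\<lambda>m. \<integral>x. M k x * T k m x \<partial>Q) \<longlonglongrightarrow> (\<integral>x. M k x \<partial>Q)"
    proof (rule integral_dominated_convergence[where w = "\<lambda>x. \<bar>M k x\<bar>"])
      show "M k \<in> borel_measurable Q" "integrable Q (\<lambda>x. \<bar>M k x\<bar>)" using IH(1) by auto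
      show "(\<lambda>x. M k x * T k m x) \<in> borel_measurable Q" for m
        using IH(1) toQ[OF T_meas[of k m]] step by (intro borel_measurable_times) auto
      show "AE x in Q. (\<lambda>m. M k x * T k m x) \<longlonglongrightarrow> M k x"
        using tendsto_mult_left[OF T_lim] by (intro AE_I2) fastforce
      show "AE x in Q. norm (M k x * T k m x) \<le> \<bar>M k x\<bar>" for m
        by (intro AE_I2) (auto simp: T_def)
    qed
    \<comment> \<open>Adding the integrable negative part makes the localised values nonnegative, as
      Fatou's lemma demands; it is subtracted again at the end.\<close>
    let ?f = "\<lambda>m x. M (Suc k) x * T k m x + max 0 (- M (Suc k) x)"
    have int: "integrable Q (?f m)" for m using loc(1) n by (intro Bochner_Integration.integrable_add)
    have nonneg: "0 \<le> ?f m x" for m x by (auto simp: T_def)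
    have flim: "(\<lambda>m. ?f m x) \<longlonglongrightarrow> M (Suc k) x * 1 + max 0 (- M (Suc k) x)" for x
      by (intro tendsto_add tendsto_mult_left T_lim tendsto_const)
    have fint: "(\<integral>x. ?f m x \<partial>Q) \<le> (\<integral>x. M k x * T k m x \<partial>Q) + (\<integral>x. max 0 (- M (Suc k) x) \<partial>Q)" for m
      using loc n by simp
    have blim: "(\<lambda>m. (\<integral>x. M k x * T k m x \<partial>Q) + (\<integral>x. max 0 (- M (Suc k) x) \<partial>Q))
        \<longlonglongrightarrow> (\<integral>x. M k x \<partial>Q) + (\<integral>x. max 0 (- M (Suc k) x) \<partial>Q)"
      by (intro tendsto_add lim tendsto_const)
    note fatou = Fatou_real[where f = ?f, OF int nonneg flim fint blim]
    have "integrable Q (\<lambda>x. (M (Suc k) x * 1 + max 0 (- M (Suc k) x)) - max 0 (- M (Suc k) x))"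
      by (rule Bochner_Integration.integrable_diff[OF fatou(1) n])
    then have int_Suc: "integrable Q (M (Suc k))" by simp
    then show ?case using fatou(2) n IH(2) by simp
  qed
  from this[OF N order_refl]
  show "integrable Q (\<lambda>x. \<Sum>i\<in>{1..<N}. D i x * (X (i + 1) x - X i x))"
    and "(\<integral>x. (\<Sum>i\<in>{1..<N}. D i x * (X (i + 1) x - X i x)) \<partial>Q) \<le> 0"
    unfolding M_def[abs_def] by auto
qed

section \<open>Weak duality\<close>

lemma coordinate_function:
  assumes f: "f \<in> CVX_L" and i: "i \<in> {1..n}"
  shows "(\<lambda>x. f (x i)) \<in> lin_growth n" "(\<lambda>x. f (x i)) \<in> borel_measurable (path_space n)"
    "unif_cont_bounded n (\<lambda>x. f (x i))"
proof -
  obtain K where K: "K \<ge> 0" "\<And>x. x \<ge> 0 \<Longrightarrow> \<bar>f x\<bar> \<le> K * (1 + x)" using CVX_L_D(3)[OF f] by blast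
  show "(\<lambda>x. f (x i)) \<in> lin_growth n"
  proof (rule lin_growthI[where C = K])
    fix x assume x: "x \<in> paths n"
    have "\<bar>f (x i)\<bar> \<le> K * (1 + x i)" using K(2) path_nonneg[OF x i] by simp
    also have "\<dots> \<le> K * (1 + path_sum n x)"
      using coordinate_le_sum[OF x i] K(1) by (intro mult_left_mono) auto
    finally show "\<bar>f (x i)\<bar> \<le> K * (1 + path_sum n x)" .
  qed
  show "(\<lambda>x. f (x i)) \<in> borel_measurable (path_space n)"
    by (rule measurable_compose[OF measurable_coordinate_Rp[OF i] borel_measurable_borel_Rp[OF CVX_L_D(1)[OF f]]])
  show "unif_cont_bounded n (\<lambda>x. f (x i))"
    unfolding unif_cont_bounded_def
  proof (intro allI impI)
    fix K e :: real assume e: "e > 0"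
    have "uniformly_continuous_on {0..K} f"
      by (intro compact_uniformly_continuous continuous_on_subset[OF CVX_L_D(1)[OF f]]) auto
    then obtain d where d: "d > 0" "\<And>s t. s \<in> {0..K} \<Longrightarrow> t \<in> {0..K} \<Longrightarrow> \<bar>s - t\<bar> < d \<Longrightarrow> \<bar>f s - f t\<bar> < e"
      using e unfolding uniformly_continuous_on_def dist_real_def by metis
    have "\<bar>f (x i) - f (y i)\<bar> < e" if x: "x \<in> paths n" and y: "y \<in> paths n"
      and c: "\<forall>i\<in>{1..n}. x i \<le> K \<and> y i \<le> K \<and> \<bar>x i - y i\<bar> < d" for x y
      using path_nonneg[OF x i] path_nonneg[OF y i] bspec[OF c i] by (intro d(2)) auto
    then show "\<exists>d>0. \<forall>x\<in>paths n. \<forall>y\<in>paths n.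
        (\<forall>i\<in>{1..n}. x i \<le> K \<and> y i \<le> K \<and> \<bar>x i - y i\<bar> < d) \<longrightarrow> \<bar>f (x i) - f (y i)\<bar> < e"
      using d(1) by blast
  qed
qed

lemma integrable_lin_growth:
  assumes Q: "prob_space Q" "sets Q = sets (path_space n)"
    and int: "\<And>i. i \<in> {1..n} \<Longrightarrow> integrable Q (\<lambda>x. x i)"
    and f: "f \<in> lin_growth n" "f \<in> borel_measurable (path_space n)"
  shows "integrable Q f"
proof -
  interpret prob_space Q by (rule Q)
  obtain C where C: "\<And>x. x \<in> paths n \<Longrightarrow> \<bar>f x\<bar> \<le> C * (1 + path_sum n x)"
    using lin_growthE[OF f(1)] by metis
  show ?thesis
  proof (rule Bochner_Integration.integrable_bound)
    show "integrable Q (\<lambda>x. C * (1 + path_sum n x))"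
      using int by (intro integrable_mult_right Bochner_Integration.integrable_add Bochner_Integration.integrable_sum) auto
    show "f \<in> borel_measurable Q" using f(2) measurable_cong_sets[OF Q(2) refl] by blast
    show "AE x in Q. norm (f x) \<le> norm (C * (1 + path_sum n x))"
    proof (rule AE_I2)
      fix x assume "x \<in> space Q"
      then have "\<bar>f x\<bar> \<le> C * (1 + path_sum n x)"
        using C sets_eq_imp_space_eq[OF Q(2)] by blast
      then show "norm (f x) \<le> norm (C * (1 + path_sum n x))" by simp
    qed
  qed
qed

lemma integral_marginal_law:
  assumes Q: "sets Q = sets (path_space n)" and f: "f \<in> CVX_L" and i: "i \<in> {1..n}"
  shows "(\<integral>x. f x \<partial>marginal_law Q i) = (\<integral>x. f (x i) \<partial>Q)"
  unfolding marginal_law_def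
proof (rule integral_distr)
  show "(\<lambda>\<omega>. \<omega> i) \<in> Q \<rightarrow>\<^sub>M borel_Rp"
    using measurable_coordinate_Rp[OF i] measurable_cong_sets[OF Q refl] by blast
  show "f \<in> borel_measurable borel_Rp" by (rule borel_measurable_borel_Rp[OF CVX_L_D(1)[OF f]])
qed

lemma martingale_measuresD:
  assumes "Q \<in> martingale_measures n x0"
  shows "prob_space Q" "sets Q = sets (path_space n)" "i \<in> {1..n} \<Longrightarrow> integrable Q (\<lambda>x. x i)"
proof -
  show "prob_space Q" "sets Q = sets (path_space n)" using assms unfolding martingale_measures_def by auto
  assume i: "i \<in> {1..n}"
  then have "integrable Q (canonical_process x0 i)"
    using assms unfolding martingale_measures_def martingale_upto_def by auto
  then show "integrable Q (\<lambda>x. x i)" using i unfolding canonical_process_def[abs_def] by simp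
qed

text \<open>A bounded multiplier known at date i passes through the conditional expectation.\<close>

lemma martingale_orthogonal:
  assumes Q: "Q \<in> martingale_measures n x0" and i: "i < n"
    and u: "u \<in> borel_measurable (natural_filtration Q (canonical_process x0) i)" "\<And>x. \<bar>u x\<bar> \<le> B"
  shows "(\<integral>x. u x * (canonical_process x0 (i + 1) x - canonical_process x0 i x) \<partial>Q) = 0"
proof -
  note QD = martingale_measuresD[OF Q]
  interpret prob_space Q by (rule QD)
  let ?X = "canonical_process x0" and ?F = "natural_filtration Q (canonical_process x0) i"
  have sub: "subalgebra Q ?F" by (rule subalgebra_natural_filtration[OF QD(2)])
  interpret finite_measure_subalgebra Q ?F by standard (rule sub)
  have X_int: "integrable Q (?X j)" if "j \<le> n" for j by (rule integrable_canonical[OF QD(2,1,3) that])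
  have u_meas: "u \<in> borel_measurable Q" by (rule measurable_from_subalg[OF sub u(1)])
  have uX_int: "integrable Q (\<lambda>x. u x * ?X j x)" if j: "j \<le> n" for j
  proof (rule Bochner_Integration.integrable_bound)
    show "integrable Q (\<lambda>x. B * ?X j x)" using X_int[OF j] by (rule integrable_mult_right)
    show "(\<lambda>x. u x * ?X j x) \<in> borel_measurable Q"
      by (rule borel_measurable_times[OF u_meas borel_measurable_integrable[OF X_int[OF j]]])
    show "AE x in Q. norm (u x * ?X j x) \<le> norm (B * ?X j x)"
    proof (rule AE_I2)
      fix x
      have "\<bar>u x\<bar> \<le> \<bar>B\<bar>" using u(2)[of x] by simp
      then show "norm (u x * ?X j x) \<le> norm (B * ?X j x)" by (simp add: abs_mult mult_right_mono)
    qed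
  qed
  have "AE x in Q. real_cond_exp Q ?F (?X (i + 1)) x = ?X i x"
    using Q i unfolding martingale_measures_def martingale_upto_def by auto
  then have "AE x in Q. u x * real_cond_exp Q ?F (?X (i + 1)) x = u x * ?X i x" by eventually_elim simp
  then have "(\<integral>x. u x * real_cond_exp Q ?F (?X (i + 1)) x \<partial>Q) = (\<integral>x. u x * ?X i x \<partial>Q)"
    using u_meas X_int[of i] i borel_measurable_times[OF u_meas borel_measurable_cond_exp2]
      borel_measurable_times[OF u_meas borel_measurable_integrable[OF X_int[of i]]]
    by (intro integral_cong_AE) auto
  moreover have "(\<integral>x. u x * real_cond_exp Q ?F (?X (i + 1)) x \<partial>Q) = (\<integral>x. u x * ?X (i + 1) x \<partial>Q)"
    using i by (intro real_cond_exp_intg(2) uX_int u(1) borel_measurable_integrable[OF X_int]) auto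
  ultimately show ?thesis
    using i uX_int[of i] uX_int[of "i + 1"] by (simp add: right_diff_distrib)
qed

lemma superhedgesD:
  assumes "(\<psi>a, \<psi>b) \<in> superhedges n h"
  shows "i \<in> {1..n} \<Longrightarrow> \<psi>a i \<in> CVX_L" "i \<in> {1..n} \<Longrightarrow> \<psi>b i \<in> CVX_L"
    "\<exists>\<Delta>. (\<forall>i\<in>{1..<n}. \<Delta> i \<in> borel_measurable (path_space i)) \<and>
      (\<forall>x\<in>paths n. h x \<le> (\<Sum>i\<in>{1..n}. \<psi>a i (x i) - \<psi>b i (x i)) +
        (\<Sum>i\<in>{1..<n}. \<Delta> i (restrict x {1..i}) * (x (i + 1) - x i)))"
  using assms unfolding superhedges_def by auto

lemma superhedgesI:
  assumes "\<And>i. i \<in> {1..n} \<Longrightarrow> \<psi>a i \<in> CVX_L" "\<And>i. i \<in> {1..n} \<Longrightarrow> \<psi>b i \<in> CVX_L"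
    and "\<And>i. i \<in> {1..<n} \<Longrightarrow> \<Delta> i \<in> borel_measurable (path_space i)"
    and "\<And>x. x \<in> paths n \<Longrightarrow> h x \<le> (\<Sum>i\<in>{1..n}. \<psi>a i (x i) - \<psi>b i (x i)) +
      (\<Sum>i\<in>{1..<n}. \<Delta> i (restrict x {1..i}) * (x (i + 1) - x i))"
  shows "(\<psi>a, \<psi>b) \<in> superhedges n h"
  unfolding superhedges_def using assms by (intro CollectI case_prodI conjI exI[of _ \<Delta>] ballI) simp_all

lemma weak_duality:
  assumes n: "n \<ge> 1" and Q: "Q \<in> consistent_martingale_measures n x0 \<mu>b \<mu>a"
    and h: "h \<in> lin_growth n" "h \<in> borel_measurable (path_space n)"
    and sh: "(\<psi>a, \<psi>b) \<in> superhedges n h"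
  shows "(\<integral>x. h x \<partial>Q) \<le> (\<Sum>i\<in>{1..n}. (\<integral>x. \<psi>a i x \<partial>\<mu>a i) - (\<integral>x. \<psi>b i x \<partial>\<mu>b i))"
proof -
  have Qm: "Q \<in> martingale_measures n x0"
    and cx: "\<And>i. i \<in> {1..n} \<Longrightarrow> \<mu>b i \<preceq>\<^sub>c\<^sub>x marginal_law Q i \<and> marginal_law Q i \<preceq>\<^sub>c\<^sub>x \<mu>a i"
    using Q unfolding consistent_martingale_measures_def by auto
  note QD = martingale_measuresD[OF Qm]
  interpret prob_space Q by (rule QD)
  let ?X = "canonical_process x0" and ?F = "natural_filtration Q (canonical_process x0)"
  have sp: "space Q = paths n" by (rule sets_eq_imp_space_eq[OF QD(2)])
  obtain \<Delta> where D: "\<And>i. i \<in> {1..<n} \<Longrightarrow> \<Delta> i \<in> borel_measurable (path_space i)"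
    and ge: "\<And>x. x \<in> paths n \<Longrightarrow> h x \<le> (\<Sum>i\<in>{1..n}. \<psi>a i (x i) - \<psi>b i (x i)) +
      (\<Sum>i\<in>{1..<n}. \<Delta> i (restrict x {1..i}) * (x (i + 1) - x i))"
    using superhedgesD(3)[OF sh] by blast
  have psi_int: "integrable Q (\<lambda>x. \<psi>a i (x i))" "integrable Q (\<lambda>x. \<psi>b i (x i))" if "i \<in> {1..n}" for i
    using superhedgesD(1,2)[OF sh that] that
    by (auto intro!: integrable_lin_growth[OF QD] coordinate_function)
  define \<Psi> where "\<Psi> x = (\<Sum>i\<in>{1..n}. \<psi>a i (x i) - \<psi>b i (x i))" for x
  have \<Psi>_int: "integrable Q \<Psi>"
    unfolding \<Psi>_def by (intro Bochner_Integration.integrable_sum Bochner_Integration.integrable_diff psi_int)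
  have h_int: "integrable Q h" by (rule integrable_lin_growth[OF QD h])
  define M where "M x = (\<Sum>i\<in>{1..<n}. \<Delta> i (restrict x {1..i}) * (?X (i + 1) x - ?X i x))" for x
  have M_eq: "M x = (\<Sum>i\<in>{1..<n}. \<Delta> i (restrict x {1..i}) * (x (i + 1) - x i))" for x
    unfolding M_def by (intro sum.cong) (auto simp: canonical_process_def)
  \<comment> \<open>Positions may be unbounded, but superhedging bounds the gain below by h minus
    the static payoff, and both are integrable.\<close>
  have Z_int: "integrable Q (\<lambda>x. \<Psi> x - h x)" by (rule Bochner_Integration.integrable_diff[OF \<Psi>_int h_int])
  have Z_le: "- (\<Psi> x - h x) \<le> (\<Sum>i\<in>{1..<n}. \<Delta> i (restrict x {1..i}) * (?X (i + 1) x - ?X i x))" if "x \<in> space Q" for x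
    using ge[of x] that unfolding sp M_def[symmetric] M_eq \<Psi>_def by simp
  have D_meas: "(\<lambda>x. \<Delta> i (restrict x {1..i})) \<in> borel_measurable (?F i)" if "i \<in> {1..<n}" for i
    using that by (intro measurable_compose[OF measurable_restrict_path[OF QD(2)] D]) auto
  have M: "integrable Q M" "(\<integral>x. M x \<partial>Q) \<le> 0"
    unfolding M_def
    by (rule martingale_transform_integral[where F = ?F and X = ?X and D = "\<lambda>i x. \<Delta> i (restrict x {1..i})" and N = n
        and Q = Q and Z = "\<lambda>x. \<Psi> x - h x", OF QD(1) subalgebra_natural_filtration[OF QD(2)]
        natural_filtration_mono[OF QD(2)] measurable_natural_filtration[OF QD(2)]
        integrable_canonical[OF QD(2,1,3)] martingale_orthogonal[OF Qm] D_meas n Z_int Z_le]; assumption)+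
  have "(\<integral>x. h x \<partial>Q) \<le> (\<integral>x. \<Psi> x + M x \<partial>Q)"
    using ge unfolding \<Psi>_def[symmetric] M_eq[symmetric]
    by (intro integral_mono h_int Bochner_Integration.integrable_add \<Psi>_int M) (auto simp: sp)
  also have "\<dots> \<le> (\<integral>x. \<Psi> x \<partial>Q)" using \<Psi>_int M by simp
  also have "\<dots> = (\<Sum>i\<in>{1..n}. (\<integral>x. \<psi>a i (x i) \<partial>Q) - (\<integral>x. \<psi>b i (x i) \<partial>Q))"
    unfolding \<Psi>_def using psi_int
    by (subst Bochner_Integration.integral_sum) (auto intro!: sum.cong)
  also have "\<dots> \<le> (\<Sum>i\<in>{1..n}. (\<integral>x. \<psi>a i x \<partial>\<mu>a i) - (\<integral>x. \<psi>b i x \<partial>\<mu>b i))"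
  proof (rule sum_mono)
    fix i assume i: "i \<in> {1..n}"
    have "(\<integral>x. \<psi>a i (x i) \<partial>Q) \<le> (\<integral>x. \<psi>a i x \<partial>\<mu>a i)"
      using cx[OF i] superhedgesD(1)[OF sh i] unfolding convex_order_def
      by (simp add: integral_marginal_law[OF QD(2) _ i])
    moreover have "(\<integral>x. \<psi>b i x \<partial>\<mu>b i) \<le> (\<integral>x. \<psi>b i (x i) \<partial>Q)"
      using cx[OF i] superhedgesD(2)[OF sh i] unfolding convex_order_def
      by (simp add: integral_marginal_law[OF QD(2) _ i])
    ultimately show "(\<integral>x. \<psi>a i (x i) \<partial>Q) - (\<integral>x. \<psi>b i (x i) \<partial>Q) \<le> (\<integral>x. \<psi>a i x \<partial>\<mu>a i) - (\<integral>x. \<psi>b i x \<partial>\<mu>b i)"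
      by simp
  qed
  finally show ?thesis .
qed

section \<open>The cost of superhedging\<close>

text \<open>An infimum of reals, hence informative only once the set of costs is seen to be nonempty
  and bounded below; both are proved for payoffs of linear growth.\<close>

definition price ::
  "nat \<Rightarrow> (nat \<Rightarrow> real measure) \<Rightarrow> (nat \<Rightarrow> real measure) \<Rightarrow> ((nat \<Rightarrow> real) \<Rightarrow> real) \<Rightarrow> real" where
  "price n \<mu>b \<mu>a h =
     (INF (\<psi>a, \<psi>b)\<in>superhedges n h. \<Sum>i\<in>{1..n}. (\<integral>x. \<psi>a i x \<partial>\<mu>a i) - (\<integral>x. \<psi>b i x \<partial>\<mu>b i))"

section \<open>Sums, multiples and existence of superhedges\<close>

lemma superhedges_add:
  assumes f: "(\<psi>a, \<psi>b) \<in> superhedges n f" and g: "(\<phi>a, \<phi>b) \<in> superhedges n g"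
  shows "(\<lambda>i x. \<psi>a i x + \<phi>a i x, \<lambda>i x. \<psi>b i x + \<phi>b i x) \<in> superhedges n (\<lambda>x. f x + g x)"
proof -
  obtain D where D: "\<And>i. i \<in> {1..<n} \<Longrightarrow> D i \<in> borel_measurable (path_space i)"
    and D_ge: "\<And>x. x \<in> paths n \<Longrightarrow> f x \<le> (\<Sum>i\<in>{1..n}. \<psi>a i (x i) - \<psi>b i (x i)) +
      (\<Sum>i\<in>{1..<n}. D i (restrict x {1..i}) * (x (i + 1) - x i))"
    using superhedgesD(3)[OF f] by blast
  obtain E where E: "\<And>i. i \<in> {1..<n} \<Longrightarrow> E i \<in> borel_measurable (path_space i)"
    and E_ge: "\<And>x. x \<in> paths n \<Longrightarrow> g x \<le> (\<Sum>i\<in>{1..n}. \<phi>a i (x i) - \<phi>b i (x i)) +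
      (\<Sum>i\<in>{1..<n}. E i (restrict x {1..i}) * (x (i + 1) - x i))"
    using superhedgesD(3)[OF g] by blast
  show ?thesis
  proof (rule superhedgesI[where \<Delta> = "\<lambda>i x. D i x + E i x"])
    fix x assume x: "x \<in> paths n"
    show "f x + g x \<le> (\<Sum>i\<in>{1..n}. (\<psi>a i (x i) + \<phi>a i (x i)) - (\<psi>b i (x i) + \<phi>b i (x i))) +
      (\<Sum>i\<in>{1..<n}. (D i (restrict x {1..i}) + E i (restrict x {1..i})) * (x (i + 1) - x i))"
      using add_mono[OF D_ge[OF x] E_ge[OF x]]
      by (simp add: distrib_right sum.distrib sum_subtractf algebra_simps)
  qed (use superhedgesD(1,2)[OF f] superhedgesD(1,2)[OF g] D E in \<open>auto intro: CVX_L_add\<close>)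
qed

lemma superhedges_cmult:
  assumes f: "(\<psi>a, \<psi>b) \<in> superhedges n f" and c: "c \<ge> 0"
  shows "(\<lambda>i x. c * \<psi>a i x, \<lambda>i x. c * \<psi>b i x) \<in> superhedges n (\<lambda>x. c * f x)"
proof -
  obtain D where D: "\<And>i. i \<in> {1..<n} \<Longrightarrow> D i \<in> borel_measurable (path_space i)"
    and D_ge: "\<And>x. x \<in> paths n \<Longrightarrow> f x \<le> (\<Sum>i\<in>{1..n}. \<psi>a i (x i) - \<psi>b i (x i)) +
      (\<Sum>i\<in>{1..<n}. D i (restrict x {1..i}) * (x (i + 1) - x i))"
    using superhedgesD(3)[OF f] by blast
  show ?thesis
  proof (rule superhedgesI[where \<Delta> = "\<lambda>i x. c * D i x"])
    fix x assume x: "x \<in> paths n"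
    show "c * f x \<le> (\<Sum>i\<in>{1..n}. c * \<psi>a i (x i) - c * \<psi>b i (x i)) +
      (\<Sum>i\<in>{1..<n}. c * D i (restrict x {1..i}) * (x (i + 1) - x i))"
      using mult_left_mono[OF D_ge[OF x] c]
      by (simp add: distrib_left sum_distrib_left right_diff_distrib mult.assoc)
  qed (use superhedgesD(1,2)[OF f] D c in \<open>auto intro: CVX_L_cmult\<close>)
qed

text \<open>The growth bound is itself an affine static payoff. Its constant is paid at each of the
  n dates, which only adds to the hedge because C \<ge> 0 and n \<ge> 1.\<close>

lemma superhedges_exist:
  assumes n: "n \<ge> 1" and f: "f \<in> lin_growth n"
  shows "superhedges n f \<noteq> {}"
proof -
  obtain C where C: "C \<ge> 0" "\<And>x. x \<in> paths n \<Longrightarrow> \<bar>f x\<bar> \<le> C * (1 + path_sum n x)"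
    using lin_growthE[OF f] by metis
  have "(\<lambda>i x. C + C * x, \<lambda>i x. 0) \<in> superhedges n f"
  proof (rule superhedgesI[where \<Delta> = "\<lambda>i x. 0"])
    fix x assume x: "x \<in> paths n"
    have "f x \<le> C + C * path_sum n x" using C(2)[OF x] by (simp add: algebra_simps)
    also have "\<dots> \<le> real n * C + C * path_sum n x" using n C(1) mult_right_mono[of 1 "real n" C] by simp
    also have "\<dots> = (\<Sum>i\<in>{1..n}. C + C * x i - 0)" by (simp add: sum.distrib sum_distrib_left)
    finally show "f x \<le> (\<Sum>i\<in>{1..n}. C + C * x i - 0) + (\<Sum>i\<in>{1..<n}. 0 * (x (i + 1) - x i))" by simp
  qed (auto intro: CVX_L_affine CVX_L_const)
  then show ?thesis by blast
qed

section \<open>The superhedging price as a sublinear functional\<close>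

locale market =
  fixes n :: nat and x0 :: real and \<mu>b \<mu>a :: "nat \<Rightarrow> real measure"
  assumes n: "n \<ge> 1"
    and b: "i \<in> {1..n} \<Longrightarrow> \<mu>b i \<in> prob_first_moment \<and> barycenter (\<mu>b i) = x0"
    and a: "i \<in> {1..n} \<Longrightarrow> \<mu>a i \<in> prob_first_moment \<and> barycenter (\<mu>a i) = x0"
    and cx: "1 \<le> i \<Longrightarrow> i \<le> j \<Longrightarrow> j \<le> n \<Longrightarrow> \<mu>b i \<preceq>\<^sub>c\<^sub>x \<mu>a j"
begin

definition cost :: "(nat \<Rightarrow> real \<Rightarrow> real) \<Rightarrow> (nat \<Rightarrow> real \<Rightarrow> real) \<Rightarrow> real" where
  "cost \<psi>a \<psi>b = (\<Sum>i\<in>{1..n}. (\<integral>x. \<psi>a i x \<partial>\<mu>a i) - (\<integral>x. \<psi>b i x \<partial>\<mu>b i))"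

abbreviation "\<pi> \<equiv> price n \<mu>b \<mu>a"

lemma integrable_a: "i \<in> {1..n} \<Longrightarrow> f \<in> CVX_L \<Longrightarrow> integrable (\<mu>a i) f"
  using a by (auto intro: integrable_CVX_L)

lemma integrable_b: "i \<in> {1..n} \<Longrightarrow> f \<in> CVX_L \<Longrightarrow> integrable (\<mu>b i) f"
  using b by (auto intro: integrable_CVX_L)

lemma cost_add:
  assumes "(\<psi>a, \<psi>b) \<in> superhedges n f" "(\<phi>a, \<phi>b) \<in> superhedges n g"
  shows "cost (\<lambda>i x. \<psi>a i x + \<phi>a i x) (\<lambda>i x. \<psi>b i x + \<phi>b i x) = cost \<psi>a \<psi>b + cost \<phi>a \<phi>b"
  unfolding cost_def sum.distrib[symmetric]
  using superhedgesD(1,2)[OF assms(1)] superhedgesD(1,2)[OF assms(2)]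
  by (intro sum.cong refl) (simp add: integrable_a integrable_b)

lemma cost_cmult: "cost (\<lambda>i x. c * \<psi>a i x) (\<lambda>i x. c * \<psi>b i x) = c * cost \<psi>a \<psi>b"
  unfolding cost_def by (simp add: sum_distrib_left right_diff_distrib)

lemma cost_nonneg:
  assumes sh: "(\<psi>a, \<psi>b) \<in> superhedges n h" and h: "\<And>x. x \<in> paths n \<Longrightarrow> 0 \<le> h x"
  shows "0 \<le> cost \<psi>a \<psi>b"
proof -
  obtain \<Delta> where ge: "\<And>x. x \<in> paths n \<Longrightarrow> h x \<le> (\<Sum>i\<in>{1..n}. \<psi>a i (x i) - \<psi>b i (x i)) +
      (\<Sum>i\<in>{1..<n}. \<Delta> i (restrict x {1..i}) * (x (i + 1) - x i))"
    using superhedgesD(3)[OF sh] by blast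
  show ?thesis
    unfolding cost_def
  proof (rule hedge_cost_nonneg[OF n b a cx, where \<Delta> = \<Delta>])
    fix x :: "nat \<Rightarrow> real" assume x: "\<And>i. i \<in> {1..n} \<Longrightarrow> x i \<ge> 0"
    \<comment> \<open>Paths are extensional functions whereas the bound ranges over all functions,
      so x is cut to its first n coordinates; neither payoffs nor positions notice.\<close>
    let ?y = "restrict x {1..n}"
    have y: "?y \<in> paths n" using x by (auto simp: space_path_space)
    have r: "restrict ?y {1..i} = restrict x {1..i}" if "i < n" for i
      using that by (auto simp: restrict_def)
    have "(\<Sum>i\<in>{1..<n}. \<Delta> i (restrict ?y {1..i}) * (?y (i + 1) - ?y i))
        = (\<Sum>i\<in>{1..<n}. \<Delta> i (restrict x {1..i}) * (x (i + 1) - x i))"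
      by (intro sum.cong refl) (simp add: r del: restrict_restrict One_nat_def)
    moreover have "(\<Sum>i\<in>{1..n}. \<psi>a i (?y i) - \<psi>b i (?y i)) = (\<Sum>i\<in>{1..n}. \<psi>a i (x i) - \<psi>b i (x i))"
      by (intro sum.cong) auto
    ultimately show "0 \<le> (\<Sum>i\<in>{1..n}. \<psi>a i (x i) - \<psi>b i (x i)) +
        (\<Sum>i\<in>{1..<n}. \<Delta> i (restrict x {1..i}) * (x (i + 1) - x i))"
      using ge[OF y] h[OF y] by simp
  qed (use superhedgesD(1,2)[OF sh] in auto)
qed

lemma price_eq: "\<pi> h = (INF (\<psi>a, \<psi>b)\<in>superhedges n h. cost \<psi>a \<psi>b)"
  unfolding price_def cost_def ..

text \<open>Adding a fixed superhedge of -f to a superhedge of f gives a hedge of zero, whose cost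
  is nonnegative by the market assumption. So the costs are bounded below.\<close>

lemma
  assumes f: "f \<in> lin_growth n"
  shows price_le: "(\<psi>a, \<psi>b) \<in> superhedges n f \<Longrightarrow> \<pi> f \<le> cost \<psi>a \<psi>b"
    and price_ge: "(\<And>\<psi>a \<psi>b. (\<psi>a, \<psi>b) \<in> superhedges n f \<Longrightarrow> c \<le> cost \<psi>a \<psi>b) \<Longrightarrow> c \<le> \<pi> f"
    and price_approx: "e > 0 \<Longrightarrow> \<exists>\<psi>a \<psi>b. (\<psi>a, \<psi>b) \<in> superhedges n f \<and> cost \<psi>a \<psi>b < \<pi> f + e"
proof -
  obtain \<phi>a \<phi>b where phi: "(\<phi>a, \<phi>b) \<in> superhedges n (\<lambda>x. - f x)"
    using superhedges_exist[OF n lin_growth_uminus[OF f]] by auto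
  have bdd: "bdd_below ((\<lambda>(\<psi>a, \<psi>b). cost \<psi>a \<psi>b) ` superhedges n f)"
  proof (rule bdd_belowI2[where m = "- cost \<phi>a \<phi>b"], clarify)
    fix \<psi>a \<psi>b assume psi: "(\<psi>a, \<psi>b) \<in> superhedges n f"
    show "- cost \<phi>a \<phi>b \<le> cost \<psi>a \<psi>b"
      using cost_nonneg[OF superhedges_add[OF psi phi]] cost_add[OF psi phi] by simp
  qed
  have ne: "superhedges n f \<noteq> {}" by (rule superhedges_exist[OF n f])
  show "(\<psi>a, \<psi>b) \<in> superhedges n f \<Longrightarrow> \<pi> f \<le> cost \<psi>a \<psi>b"
    unfolding price_eq using cINF_lower[OF bdd, of "(\<psi>a, \<psi>b)"] by simp
  show "(\<And>\<psi>a \<psi>b. (\<psi>a, \<psi>b) \<in> superhedges n f \<Longrightarrow> c \<le> cost \<psi>a \<psi>b) \<Longrightarrow> c \<le> \<pi> f"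
    unfolding price_eq by (rule cINF_greatest[OF ne]) auto
  show "e > 0 \<Longrightarrow> \<exists>\<psi>a \<psi>b. (\<psi>a, \<psi>b) \<in> superhedges n f \<and> cost \<psi>a \<psi>b < \<pi> f + e"
    unfolding price_eq using cINF_less_iff[OF ne bdd, of "(INF (\<psi>a, \<psi>b)\<in>superhedges n f. cost \<psi>a \<psi>b) + e"] by auto
qed

lemma price_sublinear: "sublinear_on (lin_growth n) \<pi>"
  unfolding sublinear_on_def
proof (intro conjI ballI allI impI)
  fix f g assume f: "f \<in> lin_growth n" and g: "g \<in> lin_growth n"
  show "\<pi> (\<lambda>x. f x + g x) \<le> \<pi> f + \<pi> g"
  proof (rule field_le_epsilon)
    fix e :: real assume e: "e > 0"
    obtain \<psi>a \<psi>b where psi: "(\<psi>a, \<psi>b) \<in> superhedges n f" "cost \<psi>a \<psi>b < \<pi> f + e / 2"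
      using price_approx[OF f, of "e / 2"] e by auto
    obtain \<phi>a \<phi>b where phi: "(\<phi>a, \<phi>b) \<in> superhedges n g" "cost \<phi>a \<phi>b < \<pi> g + e / 2"
      using price_approx[OF g, of "e / 2"] e by auto
    have "\<pi> (\<lambda>x. f x + g x) \<le> cost \<psi>a \<psi>b + cost \<phi>a \<phi>b"
      using price_le[OF lin_growth_add[OF f g] superhedges_add[OF psi(1) phi(1)]]
      unfolding cost_add[OF psi(1) phi(1)] .
    then show "\<pi> (\<lambda>x. f x + g x) \<le> \<pi> f + \<pi> g + e" using psi(2) phi(2) by simp
  qed
next
  have le: "\<pi> (\<lambda>x. c * f x) \<le> c * \<pi> f" if f: "f \<in> lin_growth n" and c: "c > 0" for f c
  proof -
    have "\<pi> (\<lambda>x. c * f x) / c \<le> \<pi> f"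
    proof (rule price_ge[OF f])
      fix \<psi>a \<psi>b assume psi: "(\<psi>a, \<psi>b) \<in> superhedges n f"
      have "\<pi> (\<lambda>x. c * f x) \<le> c * cost \<psi>a \<psi>b"
        using price_le[OF lin_growth_cmult[OF f] superhedges_cmult[OF psi, of c]] c unfolding cost_cmult by simp
      then show "\<pi> (\<lambda>x. c * f x) / c \<le> cost \<psi>a \<psi>b" using c by (simp add: field_simps)
    qed
    then show ?thesis using c by (simp add: field_simps)
  qed
  fix f c assume f: "f \<in> lin_growth n" and c: "(0::real) \<le> c"
  show "\<pi> (\<lambda>x. c * f x) = c * \<pi> f"
  proof (cases "c = 0")
    case True
    have "(\<lambda>i x. 0, \<lambda>i x. 0) \<in> superhedges n (\<lambda>x. 0)"
      by (rule superhedgesI[where \<Delta> = "\<lambda>i x. 0"]) (auto intro: CVX_L_const)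
    then have "\<pi> (\<lambda>x. 0) \<le> 0" using price_le[OF lin_growth_const[of 0]] by (fastforce simp: cost_def)
    moreover have "0 \<le> \<pi> (\<lambda>x. 0)" by (rule price_ge[OF lin_growth_const]) (rule cost_nonneg, auto)
    ultimately show ?thesis using True by simp
  next
    case False
    then have c: "c > 0" using c by simp
    \<comment> \<open>The reverse inequality is the one already shown, applied to c f with factor
      1/c.\<close>
    have "\<pi> (\<lambda>x. inverse c * (c * f x)) \<le> inverse c * \<pi> (\<lambda>x. c * f x)"
      using c by (intro le lin_growth_cmult f) auto
    moreover have "(\<lambda>x. inverse c * (c * f x)) = f" using c by auto
    ultimately have "c * \<pi> f \<le> \<pi> (\<lambda>x. c * f x)" using c by (simp add: field_simps)
    then show ?thesis using le[OF f c] by simp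
  qed
qed

lemma price_nonpos:
  assumes "f \<in> lin_growth n" "\<And>x. x \<in> paths n \<Longrightarrow> f x \<le> 0"
  shows "\<pi> f \<le> 0"
proof -
  have "(\<lambda>i x. 0, \<lambda>i x. 0) \<in> superhedges n f"
    using assms(2) by (intro superhedgesI[where \<Delta> = "\<lambda>i x. 0"]) (auto intro: CVX_L_const)
  then show ?thesis using price_le[OF assms(1)] by (fastforce simp: cost_def)
qed

text \<open>A static purchase is charged at the ask, a static sale earns the bid. For a linear
  functional below the price these two inequalities become the convex order relations.\<close>

lemma price_coordinate_le:
  assumes f: "f \<in> CVX_L" and i: "i \<in> {1..n}"
  shows "\<pi> (\<lambda>x. f (x i)) \<le> (\<integral>x. f x \<partial>\<mu>a i)" "\<pi> (\<lambda>x. - f (x i)) \<le> - (\<integral>x. f x \<partial>\<mu>b i)"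
proof -
  let ?\<psi> = "\<lambda>j. if j = i then f else (\<lambda>x. 0)"
  have sum: "(\<Sum>j\<in>{1..n}. ?\<psi> j (x j)) = f (x i)" for x :: "nat \<Rightarrow> real"
  proof -
    have "(\<Sum>j\<in>{1..n}. ?\<psi> j (x j)) = (\<Sum>j\<in>{1..n}. if j = i then f (x i) else 0)" by (intro sum.cong) auto
    then show ?thesis using i by simp
  qed
  have int: "(\<Sum>j\<in>{1..n}. \<integral>x. ?\<psi> j x \<partial>\<mu> j) = (\<integral>x. f x \<partial>\<mu> i)" for \<mu> :: "nat \<Rightarrow> real measure"
  proof -
    have "(\<Sum>j\<in>{1..n}. \<integral>x. ?\<psi> j x \<partial>\<mu> j) = (\<Sum>j\<in>{1..n}. if j = i then (\<integral>x. f x \<partial>\<mu> i) else 0)"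
      by (intro sum.cong) auto
    then show ?thesis using i by simp
  qed
  have psi: "?\<psi> j \<in> CVX_L" for j using f CVX_L_const by auto
  have "(?\<psi>, \<lambda>j x. 0) \<in> superhedges n (\<lambda>x. f (x i))"
    by (rule superhedgesI[where \<Delta> = "\<lambda>i x. 0"]) (simp_all add: psi CVX_L_const sum del: One_nat_def)
  from price_le[OF coordinate_function(1)[OF f i] this]
  show "\<pi> (\<lambda>x. f (x i)) \<le> (\<integral>x. f x \<partial>\<mu>a i)" unfolding cost_def using int by simp
  have "(\<lambda>j x. 0, ?\<psi>) \<in> superhedges n (\<lambda>x. - f (x i))"
    by (rule superhedgesI[where \<Delta> = "\<lambda>i x. 0"]) (simp_all add: psi CVX_L_const sum sum_negf del: One_nat_def)
  from price_le[OF lin_growth_uminus[OF coordinate_function(1)[OF f i]] this]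
  show "\<pi> (\<lambda>x. - f (x i)) \<le> - (\<integral>x. f x \<partial>\<mu>b i)" unfolding cost_def using int by (simp add: sum_negf)
qed

text \<open>Trading gains are free. Applied to u and to -u, this makes a dominated linear functional
  vanish on the test functions built from increments.\<close>

lemma price_increment_nonpos:
  assumes i: "i \<in> {1..<n}" and u: "u \<in> borel_measurable (path_space i)"
    and lg: "(\<lambda>x. u (restrict x {1..i}) * (x (i + 1) - x i)) \<in> lin_growth n"
  shows "\<pi> (\<lambda>x. u (restrict x {1..i}) * (x (i + 1) - x i)) \<le> 0"
proof -
  let ?D = "\<lambda>j. if j = i then u else (\<lambda>x. 0)"
  have sum: "(\<Sum>j\<in>{1..<n}. ?D j (restrict x {1..j}) * (x (j + 1) - x j)) = u (restrict x {1..i}) * (x (i + 1) - x i)" for x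
  proof -
    have "(\<Sum>j\<in>{1..<n}. ?D j (restrict x {1..j}) * (x (j + 1) - x j))
        = (\<Sum>j\<in>{1..<n}. if j = i then u (restrict x {1..i}) * (x (i + 1) - x i) else 0)"
      by (intro sum.cong) auto
    then show ?thesis using i by simp
  qed
  have "(\<lambda>j x. 0, \<lambda>j x. 0) \<in> superhedges n (\<lambda>x. u (restrict x {1..i}) * (x (i + 1) - x i))"
    using u by (intro superhedgesI[where \<Delta> = ?D]) (auto simp add: CVX_L_const sum simp del: One_nat_def)
  from price_le[OF lg this] show ?thesis unfolding cost_def by simp
qed

end

section \<open>Test functions for the martingale property\<close>

text \<open>Continuous approximation from above to the indicator of t \<le> c, falling with slope -m
  to the right of c.\<close>

definition cutoff :: "nat \<Rightarrow> real \<Rightarrow> real \<Rightarrow> real" where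
  "cutoff m c t = max 0 (min 1 (1 - real m * (t - c)))"

lemma cutoff_bounds: "0 \<le> cutoff m c t" "cutoff m c t \<le> 1"
  by (auto simp: cutoff_def)

lemma cutoff_lipschitz: "\<bar>cutoff m c s - cutoff m c t\<bar> \<le> real m * \<bar>s - t\<bar>"
proof -
  have "\<bar>cutoff m c s - cutoff m c t\<bar> \<le> \<bar>(1 - real m * (s - c)) - (1 - real m * (t - c))\<bar>"
    unfolding cutoff_def by linarith
  also have "\<dots> = \<bar>real m * (t - s)\<bar>" by (simp add: algebra_simps)
  also have "\<dots> = real m * \<bar>s - t\<bar>" by (simp add: abs_mult abs_minus_commute)
  finally show ?thesis .
qed

text \<open>A cutoff equals 1 up to and including c, so satisfied constraints contribute exactly 1;
  a violated one leaves the transition zone for large m and makes the product zero.\<close>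

lemma prod_cutoff_tendsto:
  fixes c x :: "nat \<Rightarrow> real"
  shows "(\<lambda>m. \<Prod>k\<in>{1..i}. cutoff m (c k) (x k)) \<longlonglongrightarrow> indicator {x. \<forall>k\<in>{1..i}. x k \<le> c k} x"
proof (cases "\<forall>k\<in>{1..i}. x k \<le> c k")
  case True
  have "cutoff m (c k) (x k) = 1" if "k \<in> {1..i}" for m k
    using True that mult_nonneg_nonpos[of "real m" "x k - c k"] unfolding cutoff_def by simp
  then have "(\<Prod>k\<in>{1..i}. cutoff m (c k) (x k)) = 1" for m by (intro prod.neutral) auto
  then show ?thesis using True by simp
next
  case False
  then obtain k where k: "k \<in> {1..i}" "x k > c k" by auto
  obtain m0 where m0: "1 < real m0 * (x k - c k)" using reals_Archimedean3[of "x k - c k"] k by auto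
  have "(\<Prod>k\<in>{1..i}. cutoff m (c k) (x k)) = 0" if m: "m \<ge> m0" for m
  proof -
    have "real m0 * (x k - c k) \<le> real m * (x k - c k)" using m k by (intro mult_right_mono) auto
    then have "cutoff m (c k) (x k) = 0" using m0 unfolding cutoff_def by simp
    then show ?thesis using k(1) by (intro prod_zero) auto
  qed
  then have "(\<lambda>m. \<Prod>k\<in>{1..i}. cutoff m (c k) (x k)) \<longlonglongrightarrow> 0"
    by (intro tendsto_eventually) (auto simp: eventually_sequentially)
  moreover have "indicator {x. \<forall>k\<in>{1..i}. x k \<le> c k} x = (0::real)" using False by (intro indicator_simps(2)) simp
  ultimately show ?thesis by (simp only:)
qed

text \<open>The growth assumptions serve to bound both factors on a box.\<close>

lemma unif_cont_bounded_mult: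
  assumes f: "unif_cont_bounded n f" "f \<in> lin_growth n" and g: "unif_cont_bounded n g" "g \<in> lin_growth n"
  shows "unif_cont_bounded n (\<lambda>x. f x * g x)"
  unfolding unif_cont_bounded_def
proof (intro allI impI)
  fix K e :: real assume e: "e > 0"
  have bound: "\<exists>B>0. \<forall>x\<in>paths n. (\<forall>i\<in>{1..n}. x i \<le> K) \<longrightarrow> \<bar>q x\<bar> \<le> B"
    if q: "q \<in> lin_growth n" for q
  proof -
    obtain C where C: "C \<ge> 0" "\<And>x. x \<in> paths n \<Longrightarrow> \<bar>q x\<bar> \<le> C * (1 + path_sum n x)"
      using lin_growthE[OF q] by metis
    have "\<bar>q x\<bar> \<le> C * (1 + real n * \<bar>K\<bar>) + 1" if x: "x \<in> paths n" "\<forall>i\<in>{1..n}. x i \<le> K" for x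
    proof -
      have "path_sum n x \<le> (\<Sum>i\<in>{1..n}. \<bar>K\<bar>)" using x(2) by (intro sum_mono) fastforce
      then have "C * (1 + path_sum n x) \<le> C * (1 + real n * \<bar>K\<bar>)" using C(1) by (intro mult_left_mono) auto
      then show ?thesis using C(2)[OF x(1)] by simp
    qed
    moreover have "C * (1 + real n * \<bar>K\<bar>) + 1 > 0" using C(1) by (simp add: add_nonneg_pos)
    ultimately show ?thesis by blast
  qed
  obtain A where A: "A > 0" "\<And>x. x \<in> paths n \<Longrightarrow> \<forall>i\<in>{1..n}. x i \<le> K \<Longrightarrow> \<bar>f x\<bar> \<le> A"
    using bound[OF f(2)] by blast
  obtain B where B: "B > 0" "\<And>x. x \<in> paths n \<Longrightarrow> \<forall>i\<in>{1..n}. x i \<le> K \<Longrightarrow> \<bar>g x\<bar> \<le> B"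
    using bound[OF g(2)] by blast
  obtain d1 where d1: "d1 > 0" "\<And>x y. x \<in> paths n \<Longrightarrow> y \<in> paths n \<Longrightarrow>
     (\<forall>i\<in>{1..n}. x i \<le> K \<and> y i \<le> K \<and> \<bar>x i - y i\<bar> < d1) \<Longrightarrow> \<bar>f x - f y\<bar> < e / (2 * B)"
    using f(1)[unfolded unif_cont_bounded_def, THEN spec, THEN spec, THEN mp, of "e / (2 * B)" K] e B(1) by auto
  obtain d2 where d2: "d2 > 0" "\<And>x y. x \<in> paths n \<Longrightarrow> y \<in> paths n \<Longrightarrow>
     (\<forall>i\<in>{1..n}. x i \<le> K \<and> y i \<le> K \<and> \<bar>x i - y i\<bar> < d2) \<Longrightarrow> \<bar>g x - g y\<bar> < e / (2 * A)"
    using g(1)[unfolded unif_cont_bounded_def, THEN spec, THEN spec, THEN mp, of "e / (2 * A)" K] e A(1) by auto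
  have "\<bar>f x * g x - f y * g y\<bar> < e" if x: "x \<in> paths n" and y: "y \<in> paths n"
    and c: "\<forall>i\<in>{1..n}. x i \<le> K \<and> y i \<le> K \<and> \<bar>x i - y i\<bar> < min d1 d2" for x y
  proof -
    have df: "\<bar>f x - f y\<bar> < e / (2 * B)" using c by (intro d1(2) x y) auto
    have dg: "\<bar>g x - g y\<bar> < e / (2 * A)" using c by (intro d2(2) x y) auto
    have bg: "\<bar>g x\<bar> \<le> B" using c by (intro B(2) x) auto
    have bf: "\<bar>f y\<bar> \<le> A" using c by (intro A(2) y) auto
    have "\<bar>f x - f y\<bar> * \<bar>g x\<bar> \<le> \<bar>f x - f y\<bar> * B" by (intro mult_left_mono bg) simp
    also have "\<dots> < e / (2 * B) * B" using df B(1) by (intro mult_strict_right_mono)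
    also have "\<dots> = e / 2" using B(1) by simp
    finally have 1: "\<bar>f x - f y\<bar> * \<bar>g x\<bar> < e / 2" .
    have "\<bar>f y\<bar> * \<bar>g x - g y\<bar> \<le> A * \<bar>g x - g y\<bar>" by (intro mult_right_mono bf) simp
    also have "\<dots> < A * (e / (2 * A))" using dg A(1) by (intro mult_strict_left_mono)
    also have "\<dots> = e / 2" using A(1) by simp
    finally have 2: "\<bar>f y\<bar> * \<bar>g x - g y\<bar> < e / 2" .
    have "f x * g x - f y * g y = (f x - f y) * g x + f y * (g x - g y)" by (simp add: algebra_simps)
    then show ?thesis using 1 2 abs_triangle_ineq[of "(f x - f y) * g x" "f y * (g x - g y)"] by (simp add: abs_mult)
  qed
  then show "\<exists>d>0. \<forall>x\<in>paths n. \<forall>y\<in>paths n.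
      (\<forall>i\<in>{1..n}. x i \<le> K \<and> y i \<le> K \<and> \<bar>x i - y i\<bar> < d) \<longrightarrow> \<bar>f x * g x - f y * g y\<bar> < e"
    using d1(1) d2(1) by (intro exI[of _ "min d1 d2"]) auto
qed

text \<open>A product of cutoffs takes values in [0,1] and is Lipschitz factor by factor, so
  multiplying by it preserves the linear growth and the continuity of the increment.\<close>

lemma increment_test_function:
  assumes i: "i \<in> {1..<n}"
  shows "(\<lambda>x. (\<Prod>k\<in>{1..i}. cutoff m (c k) (x k)) * (x (i + 1) - x i)) \<in> lin_growth n"
    and "unif_cont_bounded n (\<lambda>x. (\<Prod>k\<in>{1..i}. cutoff m (c k) (x k)) * (x (i + 1) - x i))"
proof -
  let ?G = "\<lambda>x. \<Prod>k\<in>{1..i}. cutoff m (c k) (x k)" and ?d = "\<lambda>x. x (i + 1) - x i :: real"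
  have G: "0 \<le> ?G x" "?G x \<le> 1" for x
    by (auto intro!: prod_nonneg prod_le_1 simp: cutoff_bounds)
  have d: "?d \<in> lin_growth n" using i by (intro lin_growth_diff lin_growth_coordinate) auto
  have Gl: "?G \<in> lin_growth n" by (rule lin_growth_mono[OF lin_growth_const[of 1]]) (use G in auto)
  show "(\<lambda>x. ?G x * ?d x) \<in> lin_growth n"
  proof (rule lin_growth_mono[OF d])
    fix x :: "nat \<Rightarrow> real"
    have "\<bar>?G x\<bar> * \<bar>?d x\<bar> \<le> 1 * \<bar>?d x\<bar>" using G[of x] by (intro mult_right_mono) auto
    then show "\<bar>?G x * ?d x\<bar> \<le> \<bar>?d x\<bar>" by (simp add: abs_mult)
  qed
  show "unif_cont_bounded n (\<lambda>x. ?G x * ?d x)"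
  proof (intro unif_cont_bounded_mult Gl d)
    show "unif_cont_bounded n ?G"
    proof (rule lipschitz_unif_cont_bounded[where M = "real m"])
      fix x y :: "nat \<Rightarrow> real"
      have "norm (?G x - ?G y) \<le> (\<Sum>k\<in>{1..i}. norm (cutoff m (c k) (x k) - cutoff m (c k) (y k)))"
        by (intro norm_prod_diff) (auto simp: cutoff_bounds)
      also have "\<dots> \<le> (\<Sum>k\<in>{1..i}. real m * \<bar>x k - y k\<bar>)"
        unfolding real_norm_def by (intro sum_mono cutoff_lipschitz)
      also have "\<dots> \<le> (\<Sum>k\<in>{1..n}. real m * \<bar>x k - y k\<bar>)" using i by (intro sum_mono2) auto
      finally show "\<bar>?G x - ?G y\<bar> \<le> real m * (\<Sum>k\<in>{1..n}. \<bar>x k - y k\<bar>)" by (simp add: sum_distrib_left)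
    qed
    show "unif_cont_bounded n ?d"
    proof (rule lipschitz_unif_cont_bounded[where M = 2])
      fix x y :: "nat \<Rightarrow> real"
      have "\<bar>x k - y k\<bar> \<le> (\<Sum>k\<in>{1..n}. \<bar>x k - y k\<bar>)" if "k \<in> {1..n}" for k
        using that by (intro member_le_sum) auto
      from this[of "i + 1"] this[of i]
      have "\<bar>x (i + 1) - y (i + 1)\<bar> \<le> (\<Sum>k\<in>{1..n}. \<bar>x k - y k\<bar>)" "\<bar>x i - y i\<bar> \<le> (\<Sum>k\<in>{1..n}. \<bar>x k - y k\<bar>)"
        using i by auto
      then show "\<bar>?d x - ?d y\<bar> \<le> 2 * (\<Sum>k\<in>{1..n}. \<bar>x k - y k\<bar>)" by linarith
    qed
  qed
qed

section \<open>Strong duality\<close>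

context market
begin

text \<open>Each requirement is read off from one kind of instrument: total mass from constants,
  decay of the tails from calls, the means from the identity, convex order from static positions,
  orthogonality from trades of both signs.\<close>

lemma dominated_functional_measure:
  assumes le: "\<And>f. f \<in> lin_growth n \<Longrightarrow> L f \<le> \<pi> f"
    and add: "\<And>f g. f \<in> lin_growth n \<Longrightarrow> g \<in> lin_growth n \<Longrightarrow> L (\<lambda>x. f x + g x) = L f + L g"
    and scale: "\<And>f c. f \<in> lin_growth n \<Longrightarrow> L (\<lambda>x. c * f x) = c * L f"
  obtains Q where "Q \<in> consistent_martingale_measures n x0 \<mu>b \<mu>a"
    "\<And>f. f \<in> lin_growth n \<Longrightarrow> unif_cont_bounded n f \<Longrightarrow> (\<integral>x. f x \<partial>Q) = L f"
proof -
  have neg: "L (\<lambda>x. - f x) = - L f" if "f \<in> lin_growth n" for f using scale[OF that, of "-1"] by simp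
  have mono: "L f \<le> L g" if f: "f \<in> lin_growth n" and g: "g \<in> lin_growth n"
    and fg: "\<And>x. x \<in> paths n \<Longrightarrow> f x \<le> g x" for f g
  proof -
    have d: "(\<lambda>x. f x + - g x) \<in> lin_growth n" by (intro lin_growth_add lin_growth_uminus f g)
    have "L (\<lambda>x. f x + - g x) \<le> 0"
      using fg by (intro order_trans[OF le[OF d] price_nonpos[OF d]]) auto
    then show ?thesis using add[OF f lin_growth_uminus[OF g]] neg[OF g] by simp
  qed
  have coord_a: "L (\<lambda>x. f (x i)) \<le> (\<integral>x. f x \<partial>\<mu>a i)" if "f \<in> CVX_L" "i \<in> {1..n}" for f i
    using le[OF coordinate_function(1)[OF that]] price_coordinate_le(1)[OF that] by simp
  have coord_b: "(\<integral>x. f x \<partial>\<mu>b i) \<le> L (\<lambda>x. f (x i))" if "f \<in> CVX_L" "i \<in> {1..n}" for f i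
    using le[OF lin_growth_uminus[OF coordinate_function(1)[OF that]]] price_coordinate_le(2)[OF that]
      neg[OF coordinate_function(1)[OF that]] by simp
  \<comment> \<open>Bid and ask agree on constants, both measures being probabilities.\<close>
  have one: "L (\<lambda>x. 1) = 1"
  proof -
    have 1: "1 \<in> {1..n}" using n by simp
    interpret A: prob_space "\<mu>a 1" using a[OF 1] by (intro prob_first_momentD) auto
    interpret B: prob_space "\<mu>b 1" using b[OF 1] by (intro prob_first_momentD) auto
    show ?thesis using coord_a[OF CVX_L_const[of 1] 1] coord_b[OF CVX_L_const[of 1] 1]
      by (simp add: A.prob_space B.prob_space del: One_nat_def)
  qed
  have tail: "(\<lambda>k. L (\<lambda>x. max 0 (x i - real k))) \<longlonglongrightarrow> 0" if i: "i \<in> {1..n}" for i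
  proof (rule tendsto_sandwich[OF _ _ tendsto_const call_price_tendsto_0])
    show "\<mu>a i \<in> prob_first_moment" using a[OF i] by simp
    have zero: "L (\<lambda>x. 0) = 0" using scale[OF lin_growth_const, of 0 0] by simp
    show "\<forall>\<^sub>F k in sequentially. 0 \<le> L (\<lambda>x. max 0 (x i - real k))"
    proof (intro always_eventually allI)
      fix k
      have "L (\<lambda>x. 0) \<le> L (\<lambda>x. max 0 (x i - real k))"
        by (intro mono lin_growth_const coordinate_function(1)[OF CVX_L_call i]) auto
      then show "0 \<le> L (\<lambda>x. max 0 (x i - real k))" using zero by simp
    qed
    show "\<forall>\<^sub>F k in sequentially. L (\<lambda>x. max 0 (x i - real k)) \<le> call_price (\<mu>a i) (real k)"
      unfolding call_price_def by (intro always_eventually allI coord_a CVX_L_call i) simp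
  qed
  have "\<exists>Q. prob_space Q \<and> sets Q = sets (path_space n) \<and> (\<forall>i\<in>{1..n}. integrable Q (\<lambda>x. x i)) \<and>
      (\<forall>f\<in>lin_growth n. unif_cont_bounded n f \<longrightarrow> (\<integral>x. f x \<partial>Q) = L f)"
  proof (rule path_space_representation[of n L])
    show "L (\<lambda>x. f x + g x) = L f + L g" if "f \<in> lin_growth n" "g \<in> lin_growth n" for f g by (rule add[OF that])
    show "L (\<lambda>x. c * f x) = c * L f" if "f \<in> lin_growth n" for f c by (rule scale[OF that])
    show "L f \<le> L g" if "f \<in> lin_growth n" "g \<in> lin_growth n" "\<And>x. x \<in> paths n \<Longrightarrow> f x \<le> g x" for f g
      by (rule mono[OF that])
    show "L (\<lambda>x. 1) = 1" by (rule one)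
    show "(\<lambda>k. L (\<lambda>x. max 0 (x i - real k))) \<longlonglongrightarrow> 0" if "i \<in> {1..n}" for i by (rule tail[OF that])
  qed blast
  then obtain Q where Q: "prob_space Q" "sets Q = sets (path_space n)"
    "\<And>i. i \<in> {1..n} \<Longrightarrow> integrable Q (\<lambda>x. x i)"
    and rep: "\<And>f. f \<in> lin_growth n \<Longrightarrow> unif_cont_bounded n f \<Longrightarrow> (\<integral>x. f x \<partial>Q) = L f" by blast
  have sp: "space Q = paths n" by (rule sets_eq_imp_space_eq[OF Q(2)])
  have rep_coord: "(\<integral>x. f (x i) \<partial>Q) = L (\<lambda>x. f (x i))" if "f \<in> CVX_L" "i \<in> {1..n}" for f i
    using coordinate_function[OF that] by (intro rep)
  have "Q \<in> martingale_measures n x0"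
  proof (rule martingale_measuresI[OF Q(2,1,3)])
    fix i assume i: "i \<in> {1..n}"
    show "(\<integral>x. x i \<partial>Q) = x0"
      using coord_a[OF CVX_L_id i] coord_b[OF CVX_L_id i] a[OF i] b[OF i] rep_coord[OF CVX_L_id i]
      by (simp add: barycenter_def)
  next
    fix i and c :: "nat \<Rightarrow> real" assume i: "i \<in> {1..<n}"
    have test: "(\<integral>x. (\<Prod>k\<in>{1..i}. cutoff m (c k) (x k)) * (x (i + 1) - x i) \<partial>Q) = 0" for m
    proof -
      let ?f = "\<lambda>x. (\<Prod>k\<in>{1..i}. cutoff m (c k) (x k)) * (x (i + 1) - x i)"
      define u where "u y = (\<Prod>k\<in>{1..i}. cutoff m (c k) (y k))" for y :: "nat \<Rightarrow> real"
      have [measurable]: "(\<lambda>x. x k) \<in> borel_measurable (path_space i)" for k by (rule measurable_coordinate)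
      have u_meas: "u \<in> borel_measurable (path_space i)" unfolding u_def[abs_def] cutoff_def by measurable
      have u_eq: "u (restrict x {1..i}) = (\<Prod>k\<in>{1..i}. cutoff m (c k) (x k))" for x
        unfolding u_def by (intro prod.cong) auto
      note tf = increment_test_function[OF i, of m c]
      have "\<pi> ?f \<le> 0" using price_increment_nonpos[OF i u_meas] tf(1) unfolding u_eq by simp
      moreover have "\<pi> (\<lambda>x. - ?f x) \<le> 0"
        using price_increment_nonpos[OF i, of "\<lambda>y. - u y"] u_meas lin_growth_uminus[OF tf(1)] unfolding u_eq by simp
      ultimately have "L ?f \<le> 0" "L (\<lambda>x. - ?f x) \<le> 0"
        using le[OF tf(1)] le[OF lin_growth_uminus[OF tf(1)]] by auto
      then show ?thesis using rep[OF tf] neg[OF tf(1)] by simp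
    qed
    have d_int: "integrable Q (\<lambda>x. x (i + 1) - x i)" using i by (intro Bochner_Integration.integrable_diff Q(3)) auto
    have [measurable]: "(\<lambda>x. x k) \<in> borel_measurable Q" for k
      using measurable_coordinate measurable_cong_sets[OF Q(2) refl] by blast
    have lim: "(\<lambda>m. (\<Prod>k\<in>{1..i}. cutoff m (c k) (x k)) * (x (i + 1) - x i))
        \<longlonglongrightarrow> indicator {x. \<forall>k\<in>{1..i}. x k \<le> c k} x * (x (i + 1) - x i)" for x
      by (intro tendsto_mult_right prod_cutoff_tendsto)
    have meas: "(\<lambda>x. (\<Prod>k\<in>{1..i}. cutoff m (c k) (x k)) * (x (i + 1) - x i)) \<in> borel_measurable Q" for m
      unfolding cutoff_def by measurable
    \<comment> \<open>The cutoffs sharpen to the indicator of the box, with the absolute increment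
      as dominating function.\<close>
    have "(\<lambda>m. \<integral>x. (\<Prod>k\<in>{1..i}. cutoff m (c k) (x k)) * (x (i + 1) - x i) \<partial>Q)
        \<longlonglongrightarrow> (\<integral>x. indicator {x. \<forall>k\<in>{1..i}. x k \<le> c k} x * (x (i + 1) - x i) \<partial>Q)"
    proof (rule integral_dominated_convergence[where w = "\<lambda>x. \<bar>x (i + 1) - x i\<bar>"])
      show "(\<lambda>x. indicator {x. \<forall>k\<in>{1..i}. x k \<le> c k} x * (x (i + 1) - x i)) \<in> borel_measurable Q"
        by (rule borel_measurable_LIMSEQ_real[OF lim meas])
      show "integrable Q (\<lambda>x. \<bar>x (i + 1) - x i\<bar>)" using d_int by simp
      show "AE x in Q. norm ((\<Prod>k\<in>{1..i}. cutoff m (c k) (x k)) * (x (i + 1) - x i)) \<le> \<bar>x (i + 1) - x i\<bar>" for m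
      proof (rule AE_I2)
        fix x :: "nat \<Rightarrow> real"
        have "0 \<le> (\<Prod>k\<in>{1..i}. cutoff m (c k) (x k))" "(\<Prod>k\<in>{1..i}. cutoff m (c k) (x k)) \<le> 1"
          by (auto intro!: prod_nonneg prod_le_1 simp: cutoff_bounds)
        then show "norm ((\<Prod>k\<in>{1..i}. cutoff m (c k) (x k)) * (x (i + 1) - x i)) \<le> \<bar>x (i + 1) - x i\<bar>"
          by (simp add: abs_mult mult_left_le_one_le)
      qed
    qed (use meas lim in auto)
    then show "(\<integral>x. indicator {x. \<forall>k\<in>{1..i}. x k \<le> c k} x * (x (i + 1) - x i) \<partial>Q) = 0"
      unfolding test by (simp add: LIMSEQ_const_iff)
  qed
  moreover have "\<mu>b i \<preceq>\<^sub>c\<^sub>x marginal_law Q i \<and> marginal_law Q i \<preceq>\<^sub>c\<^sub>x \<mu>a i" if i: "i \<in> {1..n}" for i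
    unfolding convex_order_def
    using coord_a[OF _ i] coord_b[OF _ i] by (auto simp: integral_marginal_law[OF Q(2) _ i] rep_coord[OF _ i])
  ultimately have "Q \<in> consistent_martingale_measures n x0 \<mu>b \<mu>a"
    unfolding consistent_martingale_measures_def by blast
  then show thesis using rep that by blast
qed

lemma duality:
  assumes usc: "upper_semicontinuous_on (paths n) h" and h: "h \<in> lin_growth n"
  shows "h \<in> borel_measurable (path_space n)"
    and "\<exists>Q\<in>consistent_martingale_measures n x0 \<mu>b \<mu>a. \<pi> h \<le> (\<integral>x. h x \<partial>Q)"
proof -
  obtain H C where H: "\<And>m. unif_cont_bounded n (H m)"
    "\<And>m x. x \<in> paths n \<Longrightarrow> \<bar>H m x\<bar> \<le> C * (1 + path_sum n x)"
    "\<And>m x. x \<in> paths n \<Longrightarrow> h x \<le> H m x"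
    "\<And>x. x \<in> paths n \<Longrightarrow> (\<lambda>m. H m x) \<longlonglongrightarrow> h x"
    using sup_convolution[OF usc h] by metis
  have H_lin: "H m \<in> lin_growth n" for m by (rule lin_growthI[OF H(2)])
  have H_meas: "H m \<in> borel_measurable (path_space n)" for m by (rule unif_cont_bounded_measurable[OF H(1)])
  show h_meas: "h \<in> borel_measurable (path_space n)"
    by (rule borel_measurable_LIMSEQ_real[OF H(4) H_meas])
  obtain L where L: "\<And>f. f \<in> lin_growth n \<Longrightarrow> L f \<le> \<pi> f"
    "\<And>f g. f \<in> lin_growth n \<Longrightarrow> g \<in> lin_growth n \<Longrightarrow> L (\<lambda>x. f x + g x) = L f + L g"
    "\<And>f c. f \<in> lin_growth n \<Longrightarrow> L (\<lambda>x. c * f x) = c * L f" "L h = \<pi> h"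
    using hahn_banach_functions[OF price_sublinear function_subspace_lin_growth h] by blast
  obtain Q where Q: "Q \<in> consistent_martingale_measures n x0 \<mu>b \<mu>a"
    and rep: "\<And>f. f \<in> lin_growth n \<Longrightarrow> unif_cont_bounded n f \<Longrightarrow> (\<integral>x. f x \<partial>Q) = L f"
    using dominated_functional_measure[OF L(1,2,3)] by blast
  have "Q \<in> martingale_measures n x0" using Q unfolding consistent_martingale_measures_def by auto
  note QD = martingale_measuresD[OF this]
  interpret prob_space Q by (rule QD)
  have sp: "space Q = paths n" by (rule sets_eq_imp_space_eq[OF QD(2)])
  have toQ: "f \<in> borel_measurable Q" if "f \<in> borel_measurable (path_space n)" for f :: "_ \<Rightarrow> real"
    using that measurable_cong_sets[OF QD(2) refl] by blast
  have "(\<lambda>m. \<integral>x. H m x \<partial>Q) \<longlonglongrightarrow> (\<integral>x. h x \<partial>Q)"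
  proof (rule integral_dominated_convergence[where w = "\<lambda>x. C * (1 + path_sum n x)"])
    show "integrable Q (\<lambda>x. C * (1 + path_sum n x))"
      using QD(3) by (intro integrable_mult_right Bochner_Integration.integrable_add Bochner_Integration.integrable_sum) auto
    show "AE x in Q. (\<lambda>m. H m x) \<longlonglongrightarrow> h x" by (intro AE_I2 H(4)) (simp add: sp)
    show "AE x in Q. norm (H m x) \<le> C * (1 + path_sum n x)" for m
      unfolding real_norm_def by (intro AE_I2 H(2)) (simp add: sp)
  qed (intro toQ h_meas H_meas)+
  moreover have "\<pi> h \<le> (\<integral>x. H m x \<partial>Q)" for m
  proof -
    \<comment> \<open>Positivity of \<open>L\<close>: the difference of h and \<open>H m\<close> is
      nonpositive, hence superhedged by the zero position.\<close>
    have d: "(\<lambda>x. h x + - H m x) \<in> lin_growth n" by (intro lin_growth_add lin_growth_uminus h H_lin)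
    have "L (\<lambda>x. h x + - H m x) \<le> 0"
      using H(3) by (intro order_trans[OF L(1)[OF d] price_nonpos[OF d]]) auto
    moreover have "L (\<lambda>x. h x + - H m x) = L h - L (H m)"
      using L(2)[OF h lin_growth_uminus[OF H_lin]] L(3)[OF H_lin, of "-1"] by simp
    ultimately show ?thesis using L(4) rep[OF H_lin H(1)] by simp
  qed
  ultimately have "\<pi> h \<le> (\<integral>x. h x \<partial>Q)" by (intro LIMSEQ_le_const) auto
  then show "\<exists>Q\<in>consistent_martingale_measures n x0 \<mu>b \<mu>a. \<pi> h \<le> (\<integral>x. h x \<partial>Q)" using Q by blast
qed

end

theorem theorem3p4:
  fixes N :: nat and x0 :: real
    and \<mu>b \<mu>a :: "nat \<Rightarrow> real measure"
    and h :: "(nat \<Rightarrow> real) \<Rightarrow> real"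
  assumes "N \<ge> 1" and "x0 \<ge> 0"
    and "\<And>i. i \<in> {1..N} \<Longrightarrow> \<mu>b i \<in> prob_first_moment \<and> barycenter (\<mu>b i) = x0"
    and "\<And>i. i \<in> {1..N} \<Longrightarrow> \<mu>a i \<in> prob_first_moment \<and> barycenter (\<mu>a i) = x0"
    and "\<And>i j. 1 \<le> i \<Longrightarrow> i \<le> j \<Longrightarrow> j \<le> N \<Longrightarrow> \<mu>b i \<preceq>\<^sub>c\<^sub>x \<mu>a j"
    and "upper_semicontinuous_on (space (path_space N)) h"
    and "linear_growth_on (space (path_space N)) (\<lambda>x. L2_set x {1..N}) h"
  shows "(SUP Q\<in>consistent_martingale_measures N x0 \<mu>b \<mu>a. ereal (\<integral>\<omega>. h \<omega> \<partial>Q)) =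
           (INF (\<psi>a, \<psi>b)\<in>superhedges N h.
              ereal (\<Sum>i\<in>{1..N}. (\<integral>x. \<psi>a i x \<partial>\<mu>a i) - (\<integral>x. \<psi>b i x \<partial>\<mu>b i)))
       \<and> (\<exists>Q\<^sub>0\<in>consistent_martingale_measures N x0 \<mu>b \<mu>a.
            ereal (\<integral>\<omega>. h \<omega> \<partial>Q\<^sub>0) =
              (SUP Q\<in>consistent_martingale_measures N x0 \<mu>b \<mu>a. ereal (\<integral>\<omega>. h \<omega> \<partial>Q)))"
proof -
  interpret market N x0 \<mu>b \<mu>a by unfold_locales (fact assms)+
  let ?\<M> = "consistent_martingale_measures N x0 \<mu>b \<mu>a"
  let ?I = "INF (\<psi>a, \<psi>b)\<in>superhedges N h.
    ereal (\<Sum>i\<in>{1..N}. (\<integral>x. \<psi>a i x \<partial>\<mu>a i) - (\<integral>x. \<psi>b i x \<partial>\<mu>b i))"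
  have h: "h \<in> lin_growth N" by (rule linear_growth_on_path_space[OF assms(7)])
  note dual = duality[OF assms(6) h]
  obtain Q0 where Q0: "Q0 \<in> ?\<M>" "\<pi> h \<le> (\<integral>x. h x \<partial>Q0)" using dual(2) by blast
  have weak: "ereal (\<integral>x. h x \<partial>Q) \<le> ?I" if "Q \<in> ?\<M>" for Q
    by (rule INF_greatest) (use weak_duality[OF assms(1) that h dual(1)] in auto)
  \<comment> \<open>\<open>?I\<close> is an extended-real infimum and the price a real one;
    near-optimal superhedges transfer the bound.\<close>
  have "?I \<le> ereal (\<pi> h)"
  proof (rule ereal_le_epsilon2)
    fix e :: real assume "e > 0"
    then obtain \<psi>a \<psi>b where psi: "(\<psi>a, \<psi>b) \<in> superhedges N h" "cost \<psi>a \<psi>b < \<pi> h + e"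
      using price_approx[OF h] by blast
    have "?I \<le> ereal (cost \<psi>a \<psi>b)" unfolding cost_def by (rule INF_lower2[OF psi(1)]) simp
    also have "\<dots> \<le> ereal (\<pi> h + e)" using psi(2) by simp
    finally show "?I \<le> ereal (\<pi> h) + ereal e" by simp
  qed
  also have "\<dots> \<le> ereal (\<integral>x. h x \<partial>Q0)" using Q0(2) by simp
  finally have strong: "?I \<le> ereal (\<integral>x. h x \<partial>Q0)" .
  have upper: "ereal (\<integral>x. h x \<partial>Q0) \<le> (SUP Q\<in>?\<M>. ereal (\<integral>x. h x \<partial>Q))" by (rule SUP_upper[OF Q0(1)])
  have least: "(SUP Q\<in>?\<M>. ereal (\<integral>x. h x \<partial>Q)) \<le> ?I" by (rule SUP_least[OF weak])
  show ?thesis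
  proof (intro conjI bexI[OF _ Q0(1)])
    show "(SUP Q\<in>?\<M>. ereal (\<integral>x. h x \<partial>Q)) = ?I" by (rule antisym[OF least order_trans[OF strong upper]])
    show "ereal (\<integral>x. h x \<partial>Q0) = (SUP Q\<in>?\<M>. ereal (\<integral>x. h x \<partial>Q))"
      by (rule antisym[OF upper order_trans[OF least strong]])
  qed
qed

end
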